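(* Let $f:\mathbb{R}^n\to\mathbb{R}$ be a separable convex function. Then, for every $N\in\mathbb{N}$, there exist separable convex functions $g_1,g_2$ which are equivalent to $f$ on $[-N,N]^n$, satisfy $g_1(x),g_2(x)\in\mathbb{Z}$ for all $x\in[-N,N]^n$, and are such that: 1. $g_1$ satisfies $(g_1)_{\max}^{[-N,N]^n}\le (n^2N)^{n(2N+1)+1}$; 2. $g_2$ is computable in strongly polynomial time and satisfies $(g_2)_{\max}^{[-N,N]^n}\le 2^{O((nN)^3)}(nN)^{O((nN)^2)}$.
   Context: A function is separable convex if it has the form $f(x)=\sum_{i=1}^n f_i(x_i)$ with each $f_i$ a convex function of one variable (for a function defined only on integer points, convexity of $f_i$ on $[-N,N]$ means $f_i(x)+f_i(x+2)\ge 2f_i(x+1)$ for all integers $x\in[-N,N-2]$). $[-N,N]^n$ denotes the set of integer points $x\in\mathbb{Z}^n$ with $-N\le x_i\le N$ for all $i$. Functions $f,g$ are equivalent on $D\subseteq\mathbb{Z}^n$ if for all $x,y\in D$: $f(x)\ge f(y)\Leftrightarrow g(x)\ge g(y)$. For a box $D$, $g_{\max}^D:=\max_{x,x'\in D}|g(x)-g(x')|$. Strongly polynomial means that the number of arithmetic operations, with the $n(2N+1)$ values $f_i(j)$, $i\in\{1,\dots,n\}$, $j\in\{-N,\dots,N\}$, as numeric input, is polynomial in $n$ and $N$, independently of the size of these values.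
   Formalization: The bound on g_1 is asserted for all (n,N) except n=N=1, where the printed bound equals 1 and is false: for f(x)=x any equivalent integer-valued g_1 has g_1(-1)<g_1(0)<g_1(1), so its maximal difference is at least 2. *)

theory Defs
  imports "HOL-Analysis.Convex" "HOL-Library.FuncSet"
begin

abbreviation Rn :: "nat \<Rightarrow> (nat \<Rightarrow> real) set" where
  "Rn n \<equiv> {..<n} \<rightarrow>\<^sub>E UNIV"

definition int_box :: "nat \<Rightarrow> nat \<Rightarrow> (nat \<Rightarrow> real) set" where
  "int_box n N = {..<n} \<rightarrow>\<^sub>E real_of_int ` {- int N..int N}"

(* The summands fs are not determined by f (constants can be moved between them), and an
   algorithm works on the summands; hence a version that names them. *)
definition separable_convex_by ::
  "nat \<Rightarrow> (nat \<Rightarrow> real \<Rightarrow> real) \<Rightarrow> ((nat \<Rightarrow> real) \<Rightarrow> real) \<Rightarrow> bool" where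
  "separable_convex_by n fs f \<longleftrightarrow>
     (\<forall>i<n. convex_on UNIV (fs i)) \<and> (\<forall>x\<in>Rn n. f x = (\<Sum>i<n. fs i (x i)))"

definition separable_convex :: "nat \<Rightarrow> ((nat \<Rightarrow> real) \<Rightarrow> real) \<Rightarrow> bool" where
  "separable_convex n f \<longleftrightarrow> (\<exists>fs. separable_convex_by n fs f)"

definition equivalent_on :: "'a set \<Rightarrow> ('a \<Rightarrow> real) \<Rightarrow> ('a \<Rightarrow> real) \<Rightarrow> bool" where
  "equivalent_on D f g \<longleftrightarrow> (\<forall>x\<in>D. \<forall>y\<in>D. f x \<ge> f y \<longleftrightarrow> g x \<ge> g y)"

definition max_diff :: "('a \<Rightarrow> real) \<Rightarrow> 'a set \<Rightarrow> real" where
  "max_diff g D = Max ((\<lambda>(x, x'). \<bar>g x - g x'\<bar>) ` (D \<times> D))"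


text \<open>
  Arithmetic model of computation: a uniform real RAM. A state consists of index registers
  holding natural numbers (a program mentions only finitely many of them) and an unbounded array
  of exact reals. Real operands are addressed indirectly: a real instruction with arguments
  \<open>k i j\<close> acts on the cells whose addresses are stored in the index registers
  \<open>k\<close>, \<open>i\<close>, \<open>j\<close>. There is no rounding and no conversion
  from reals to indices, and program constants are integers, so no information can be smuggled
  in through real constants. Index arithmetic is only addition and truncated subtraction. Every
  instruction and every test costs one step, whatever the size of the numbers. Division by zero
  yields zero, as in HOL; a program can test for it.
\<close>

type_synonym state = "(nat \<Rightarrow> nat) \<times> (nat \<Rightarrow> real)"

datatype arith_op = Add | Sub | Mul | Div

fun arith :: "arith_op \<Rightarrow> real \<Rightarrow> real \<Rightarrow> real" where
  "arith Add a b = a + b"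
| "arith Sub a b = a - b"
| "arith Mul a b = a * b"
| "arith Div a b = a / b"

datatype instr =
    Index_Const nat nat
  | Index_Add nat nat nat
  | Index_Sub nat nat nat
  | Real_Const nat int
  | Real_Copy nat nat
  | Real_Arith arith_op nat nat nat

fun effect :: "instr \<Rightarrow> state \<Rightarrow> state" where
  "effect (Index_Const k m) (I, R) = (I(k := m), R)"
| "effect (Index_Add k i j) (I, R) = (I(k := I i + I j), R)"
| "effect (Index_Sub k i j) (I, R) = (I(k := I i - I j), R)"
| "effect (Real_Const k m) (I, R) = (I, R(I k := real_of_int m))"
| "effect (Real_Copy k i) (I, R) = (I, R(I k := R (I i)))"
| "effect (Real_Arith p k i j) (I, R) = (I, R(I k := arith p (R (I i)) (R (I j))))"

datatype test = Index_Less nat nat | Real_Less nat nat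

fun holds :: "test \<Rightarrow> state \<Rightarrow> bool" where
  "holds (Index_Less i j) (I, R) \<longleftrightarrow> I i < I j"
| "holds (Real_Less i j) (I, R) \<longleftrightarrow> R (I i) < R (I j)"

datatype program =
    Skip
  | Do instr
  | Seq program program
  | Cond test program program
  | While test program

inductive exec :: "program \<Rightarrow> state \<Rightarrow> nat \<Rightarrow> state \<Rightarrow> bool" where
  Skip: "exec Skip s 0 s"
| Do: "exec (Do a) s 1 (effect a s)"
| Seq: "exec P s t s' \<Longrightarrow> exec Q s' u s'' \<Longrightarrow> exec (Seq P Q) s (t + u) s''"
| CondTrue: "holds b s \<Longrightarrow> exec P s t s' \<Longrightarrow> exec (Cond b P Q) s (1 + t) s'"
| CondFalse: "\<not> holds b s \<Longrightarrow> exec Q s t s' \<Longrightarrow> exec (Cond b P Q) s (1 + t) s'"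
| WhileFalse: "\<not> holds b s \<Longrightarrow> exec (While b P) s 1 s"
| WhileTrue: "holds b s \<Longrightarrow> exec P s t s' \<Longrightarrow> exec (While b P) s' u s'' \<Longrightarrow>
    exec (While b P) s (1 + t + u) s''"

(* The values fs i j, for i < n and -N <= j <= N, are stored row by row: cell i * (2N + 1) + m
   holds fs i (m - N). *)
definition input_state :: "nat \<Rightarrow> nat \<Rightarrow> (nat \<Rightarrow> real \<Rightarrow> real) \<Rightarrow> state" where
  "input_state n N fs =
     ((\<lambda>_. 0)(0 := n, 1 := N),
      (\<lambda>a. if a < n * (2 * N + 1)
           then fs (a div (2 * N + 1)) (real (a mod (2 * N + 1)) - real N) else 0))"

definition output_is :: "nat \<Rightarrow> nat \<Rightarrow> (nat \<Rightarrow> real \<Rightarrow> real) \<Rightarrow> state \<Rightarrow> bool" where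
  "output_is n N gs s \<longleftrightarrow>
     (\<forall>i<n. \<forall>m<2 * N + 1. snd s (i * (2 * N + 1) + m) = gs i (real m - real N))"

definition computes_within ::
  "program \<Rightarrow> nat \<Rightarrow> nat \<Rightarrow> nat \<Rightarrow> (nat \<Rightarrow> real \<Rightarrow> real) \<Rightarrow> (nat \<Rightarrow> real \<Rightarrow> real) \<Rightarrow> bool" where
  "computes_within P T n N fs gs \<longleftrightarrow>
     (\<exists>t s. exec P (input_state n N fs) t s \<and> t \<le> T \<and> output_is n N gs s)"


(* For n = N = 1 the bound (n^2 * N) ^ (n * (2 * N + 1) + 1) equals 1. No integral function
   equivalent to the identity satisfies it, so this single case has to be excluded from the bound. *)
lemma no_equivalent_with_max_diff_1:
  defines "f \<equiv> \<lambda>x :: nat \<Rightarrow> real. x 0"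
  shows "separable_convex 1 f"
    and "\<lbrakk>equivalent_on (int_box 1 1) f g; \<forall>x\<in>int_box 1 1. g x \<in> \<int>\<rbrakk> \<Longrightarrow> max_diff g (int_box 1 1) > 1"
proof -
  show "separable_convex 1 f"
    unfolding separable_convex_def separable_convex_by_def f_def
    by (rule exI[of _ "\<lambda>_ x. x"]) (simp add: convex_on_def)
  define p where "p t = (\<lambda>i :: nat. if i = 0 then t else (undefined :: real))" for t
  assume eq: "equivalent_on (int_box 1 1) f g" and int: "\<forall>x\<in>int_box 1 1. g x \<in> \<int>"
  have p: "p (real_of_int j) \<in> int_box 1 1" if "j \<in> {-1..1}" for j
    using that by (auto simp: int_box_def p_def PiE_iff extensional_def)
  have pm: "p (-1) \<in> int_box 1 1" and p0: "p 0 \<in> int_box 1 1" and p1: "p 1 \<in> int_box 1 1"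
    using p[of "-1"] p[of 0] p[of 1] by auto
  have "g (p (-1)) < g (p 0)" "g (p 0) < g (p 1)"
    using eq pm p0 p1 unfolding equivalent_on_def f_def p_def
    by (smt (verit))+
  moreover obtain a b c where "g (p (-1)) = of_int a" "g (p 0) = of_int b" "g (p 1) = of_int c"
    using int pm p0 p1 by (metis Ints_cases)
  ultimately have "a < b" "b < c" and ac: "g (p 1) - g (p (-1)) = of_int (c - a)" by simp_all
  then have "of_int (c - a) \<ge> (2 :: real)" by linarith
  with ac have 2: "\<bar>g (p 1) - g (p (-1))\<bar> \<ge> 2" by linarith
  have "finite (int_box 1 1)" unfolding int_box_def by (intro finite_PiE) auto
  then have "\<bar>g (p 1) - g (p (-1))\<bar> \<le> max_diff g (int_box 1 1)"
    unfolding max_diff_def using pm p1 by (intro Max_ge) force+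
  with 2 show "max_diff g (int_box 1 1) > 1" by linarith
qed

end

theory Submission
  imports Defs "Jordan_Normal_Form.Determinant"
begin

text \<open>Both parts replace the values of the summands on the integer points by integers with the same sign on all
  vectors that compare two points of the box or express convexity.

  For the existential bound, the slopes are replaced: the comparison vectors then have entries in
  \<open>{-1, 0, 1}\<close>, and a vertex of the polyhedron of all solutions with slack 1 is, by Cramer's rule, a quotient of
  determinants of modulus at most \<open>d!\<close>. In one variable, \<open>2\<close> to the power of the rank works.

  The algorithm is that of Frank and Tardos. A vector \<open>w\<close> with maximum norm 1 is approximated
  simultaneously, \<open>q w = P + \<rho>\<close> with an integer vector \<open>P\<close> and a tiny \<open>\<rho>\<close>, so that for short \<open>v\<close> the sign of
  \<open>w v\<close> is that of \<open>P v\<close> unless \<open>P v = 0\<close>, when it is that of \<open>\<rho> v\<close>. Each round annihilates a coordinate, and the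
  vectors \<open>P\<close> are combined as digits in a large base. The approximation is the first vector of a basis
  reduced by the LLL algorithm in exact real arithmetic. No integrality is needed to bound the number of
  swaps: the squared Gram-Schmidt norms stay between the least and the largest initial one, and the
  Gram-Schmidt data of the initial basis are explicit.\<close>

section \<open>Bounded loop programs on the real RAM\<close>

text \<open>Polynomial time on a concrete machine shapes the algorithm. It is written in a small
  language whose only loops are counted, with bounds built from index variables, so its running time
  is estimated by induction on the syntax. No loop can wait for a condition on reals: basis
  reduction is repeated a fixed number of times that provably suffices, and rounding, which the
  machine lacks, is a binary search of fixed length. For that search the Gram-Schmidt coefficients
  need an a priori bound, which the invariants carry along.

  The algorithm treats all \<open>d = n(2N+1)\<close> table values as one vector. Comparing two
  points takes a vector of 1-norm at most \<open>2n\<close>, a second difference one of 1-norm 4;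
  keeping the signs of both makes the new table equivalent and convex, and piecewise linear
  interpolation extends it to the reals. With \<open>K = 2^((2d+2)(d+1))\<close> the loss in a
  reduced basis is outweighed: remainders are at most \<open>2^-(d+2)\<close> and digits at most
  \<open>2K\<close>. Hence \<open>d\<close> rounds yield integers below
  \<open>(K 2^(d+3))^d\<close>, which is \<open>2^O(d^3)\<close>.\<close>

definition runs :: "program \<Rightarrow> state \<Rightarrow> nat \<Rightarrow> (state \<Rightarrow> bool) \<Rightarrow> bool" where
  "runs P s T Q \<longleftrightarrow> (\<exists>t s'. exec P s t s' \<and> t \<le> T \<and> Q s')"

lemma runs_mono: "runs P s T Q \<Longrightarrow> (\<And>s'. Q s' \<Longrightarrow> Q' s') \<Longrightarrow> T \<le> T' \<Longrightarrow> runs P s T' Q'"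
  unfolding runs_def using le_trans by blast

lemma runs_Do: "Q (effect a s) \<Longrightarrow> runs (Do a) s 1 Q"
  unfolding runs_def using exec.Do by blast

lemma runs_Do_le: "Q (effect a s) \<Longrightarrow> 1 \<le> T \<Longrightarrow> runs (Do a) s T Q"
  using runs_mono[OF runs_Do] by blast

lemma runs_Skip: "Q s \<Longrightarrow> runs Skip s 0 Q"
  unfolding runs_def using exec.Skip by blast

text \<open>Weakest-precondition style: the postcondition of the first program is itself a
  \<open>runs\<close> statement about the second, so correctness proofs execute a compiled program
  symbolically from left to right.\<close>

lemma runs_Seq:
  assumes "runs P s T (\<lambda>s'. runs P' s' T' Q)"
  shows "runs (Seq P P') s (T + T') Q"
  using assms exec.Seq add_mono[of _ T _ T'] unfolding runs_def by blast

lemma runs_Cond: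
  assumes "holds b s \<Longrightarrow> runs P s T Q" "\<not> holds b s \<Longrightarrow> runs P' s T Q"
  shows "runs (Cond b P P') s (1 + T) Q"
proof (cases "holds b s")
  case True
  with assms(1) obtain t s' where "exec P s t s'" "t \<le> T" "Q s'" unfolding runs_def by blast
  with True show ?thesis unfolding runs_def using exec.CondTrue[of b s P t s' P'] by fastforce
next
  case False
  with assms(2) obtain t s' where "exec P' s t s'" "t \<le> T" "Q s'" unfolding runs_def by blast
  with False show ?thesis unfolding runs_def using exec.CondFalse[of b s P' t s' P] by fastforce
qed

text \<open>The number \<open>n\<close> of rounds is known beforehand, so an invariant indexed by
  the round replaces a termination measure. Each round pays one step for its test; the leading 1 is
  the final failing test.\<close>

lemma runs_While:
  assumes step: "\<And>j s. j < n \<Longrightarrow> J j s \<Longrightarrow> holds b s \<and> runs P s (T j) (J (Suc j))"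
    and stop: "\<And>s. J n s \<Longrightarrow> \<not> holds b s"
    and start: "J 0 s"
  shows "runs (While b P) s (1 + (\<Sum>j<n. 1 + T j)) (J n)"
proof -
  have "runs (While b P) s (1 + (\<Sum>j\<in>{i..<n}. 1 + T j)) (J n)" if "i \<le> n" "J i s" for i s
    using that
  proof (induction "n - i" arbitrary: i s)
    case 0
    then have "i = n" by simp
    with 0 have "exec (While b P) s 1 s" "J n s" using stop exec.WhileFalse by auto
    then show ?case unfolding runs_def using \<open>i = n\<close> by (intro exI[of _ 1] exI[of _ s]) simp
  next
    case (Suc k)
    then have i: "i < n" by simp
    from step[OF i Suc.prems(2)] obtain t s' where
      s': "holds b s" "exec P s t s'" "t \<le> T i" "J (Suc i) s'" by (auto simp: runs_def)
    have "runs (While b P) s' (1 + (\<Sum>j\<in>{Suc i..<n}. 1 + T j)) (J n)"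
      using Suc.hyps(1)[of "Suc i" s'] Suc.hyps(2) i s'(4) by simp
    then obtain u s'' where u: "exec (While b P) s' u s''"
      "u \<le> 1 + (\<Sum>j\<in>{Suc i..<n}. 1 + T j)" "J n s''" by (auto simp: runs_def)
    have "exec (While b P) s (1 + t + u) s''" by (rule exec.WhileTrue[OF s'(1,2) u(1)])
    moreover have "1 + t + u \<le> 1 + (\<Sum>j\<in>{i..<n}. 1 + T j)"
      using u(2) s'(3) i by (simp add: sum.atLeast_Suc_lessThan)
    ultimately show ?case unfolding runs_def using u(3) by (intro exI[of _ "1 + t + u"] exI[of _ s'']) simp
  qed
  from this[of 0 s] start show ?thesis by (simp add: atLeast0LessThan)
qed

section \<open>Index expressions\<close>

datatype nexp = NC nat | NV nat | NPlus nexp nexp | NMinus nexp nexp | NTimes nexp nexp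

fun nval :: "nexp \<Rightarrow> (nat \<Rightarrow> nat) \<Rightarrow> nat" where
  "nval (NC m) env = m"
| "nval (NV v) env = env v"
| "nval (NPlus a b) env = nval a env + nval b env"
| "nval (NMinus a b) env = nval a env - nval b env"
| "nval (NTimes a b) env = nval a env * nval b env"

fun nvars :: "nexp \<Rightarrow> nat set" where
  "nvars (NC m) = {}"
| "nvars (NV v) = {v}"
| "nvars (NPlus a b) = nvars a \<union> nvars b"
| "nvars (NMinus a b) = nvars a \<union> nvars b"
| "nvars (NTimes a b) = nvars a \<union> nvars b"

lemma nval_cong: "(\<And>v. v \<in> nvars a \<Longrightarrow> env v = env' v) \<Longrightarrow> nval a env = nval a env'"
  by (induction a) auto

text \<open>The result lands in register \<open>k\<close>, and everything above \<open>k\<close> is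
  scratch. The machine cannot multiply indices, hence the loop: the second factor in
  \<open>k + 2\<close> is added while the first one in \<open>k + 1\<close> is counted down;
  \<open>k + 3\<close> and \<open>k + 4\<close> hold the constants 1 and 0.\<close>

fun ncomp :: "nexp \<Rightarrow> nat \<Rightarrow> program" where
  "ncomp (NC m) k = Do (Index_Const k m)"
| "ncomp (NV v) k = Seq (Do (Index_Const k 0)) (Do (Index_Add k v k))"
| "ncomp (NPlus a b) k = Seq (ncomp a k) (Seq (ncomp b (k + 1)) (Do (Index_Add k k (k + 1))))"
| "ncomp (NMinus a b) k = Seq (ncomp a k) (Seq (ncomp b (k + 1)) (Do (Index_Sub k k (k + 1))))"
| "ncomp (NTimes a b) k =
     Seq (ncomp a (k + 1)) (Seq (ncomp b (k + 2))
       (Seq (Do (Index_Const k 0)) (Seq (Do (Index_Const (k + 3) 1)) (Seq (Do (Index_Const (k + 4) 0))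
         (While (Index_Less (k + 4) (k + 1))
           (Seq (Do (Index_Add k k (k + 2))) (Do (Index_Sub (k + 1) (k + 1) (k + 3)))))))))"

fun ntime :: "nexp \<Rightarrow> (nat \<Rightarrow> nat) \<Rightarrow> nat" where
  "ntime (NC m) env = 1"
| "ntime (NV v) env = 2"
| "ntime (NPlus a b) env = ntime a env + (ntime b env + 1)"
| "ntime (NMinus a b) env = ntime a env + (ntime b env + 1)"
| "ntime (NTimes a b) env = ntime a env + (ntime b env + (4 + 3 * nval a env))"

lemma ncomp_correct:
  assumes "\<And>v. v \<in> nvars a \<Longrightarrow> v < k \<and> I v = env v"
  shows "runs (ncomp a k) (I, R) (ntime a env)
    (\<lambda>(I', R'). R' = R \<and> I' k = nval a env \<and> (\<forall>r<k. I' r = I r))"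
  using assms
proof (induction a arbitrary: k I)
  case (NC m)
  then show ?case by (auto intro!: runs_Do_le)
next
  case (NV v)
  have "runs (ncomp (NV v) k) (I, R) (1 + 1)
    (\<lambda>(I', R'). R' = R \<and> I' k = nval (NV v) env \<and> (\<forall>r<k. I' r = I r))"
    unfolding ncomp.simps using NV by (intro runs_Seq runs_Do) auto
  then show ?case by (simp only: ntime.simps one_add_one)
next
  case (NPlus a b)
  show ?case unfolding ncomp.simps ntime.simps
    apply (rule runs_Seq, rule runs_mono[OF NPlus.IH(1) _ order_refl])
    using NPlus.prems apply force
    apply clarify
    apply (rule runs_Seq, rule runs_mono[OF NPlus.IH(2) _ order_refl])
    using NPlus.prems apply (force simp: less_Suc_eq)
    by (rule runs_Do) auto
next
  case (NMinus a b)
  show ?case unfolding ncomp.simps ntime.simps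
    apply (rule runs_Seq, rule runs_mono[OF NMinus.IH(1) _ order_refl])
    using NMinus.prems apply force
    apply clarify
    apply (rule runs_Seq, rule runs_mono[OF NMinus.IH(2) _ order_refl])
    using NMinus.prems apply (force simp: less_Suc_eq)
    by (rule runs_Do) auto
next
  case (NTimes a b)
  let ?J = "\<lambda>j (I', R'). j \<le> nval a env \<and> R' = R \<and> I' k = j * nval b env \<and> I' (k + 1) = nval a env - j
     \<and> I' (k + 2) = nval b env \<and> I' (k + 3) = 1 \<and> I' (k + 4) = 0 \<and> (\<forall>r<k. I' r = I r)"
  let ?l = "While (Index_Less (k + 4) (k + 1))
           (Seq (Do (Index_Add k k (k + 2))) (Do (Index_Sub (k + 1) (k + 1) (k + 3))))"
  have w: "runs ?l s (1 + (\<Sum>j<nval a env. 1 + 2)) (?J (nval a env))" if "?J 0 s" for s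
  proof (rule runs_While[where J = ?J])
    fix j s
    assume j: "j < nval a env" and J: "?J j s"
    obtain I' where I': "s = (I', R)" using J by auto
    have "runs (Seq (Do (Index_Add k k (k + 2))) (Do (Index_Sub (k + 1) (k + 1) (k + 3)))) s (1 + 1) (?J (Suc j))"
      using j J unfolding I' by (intro runs_Seq runs_Do) auto
    then show "holds (Index_Less (k + 4) (k + 1)) s \<and>
        runs (Seq (Do (Index_Add k k (k + 2))) (Do (Index_Sub (k + 1) (k + 1) (k + 3)))) s 2 (?J (Suc j))"
      using j J unfolding I' by (simp only: one_add_one) auto
  qed (use that in auto)
  show ?case unfolding ncomp.simps ntime.simps
    apply (rule runs_Seq, rule runs_mono[OF NTimes.IH(1) _ order_refl])
    using NTimes.prems apply force
    apply clarify
    apply (rule runs_Seq, rule runs_mono[OF NTimes.IH(2) _ order_refl])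
    using NTimes.prems apply (force simp: less_Suc_eq)
    apply clarify
    apply (rule runs_mono[where T = "1 + (1 + (1 + (1 + (\<Sum>j<nval a env. 1 + 2))))"])
      apply (rule runs_Seq, rule runs_Do, rule runs_Seq, rule runs_Do, rule runs_Seq, rule runs_Do)
      apply (rule w)
    by (auto split: prod.splits)
qed

section \<open>Memory layout\<close>

datatype addr = Direct nat | Cell nat nat nat

datatype loc = LDirect nexp | LCell nat nexp nexp

fun lval :: "loc \<Rightarrow> (nat \<Rightarrow> nat) \<Rightarrow> addr" where
  "lval (LDirect e) env = Direct (nval e env)"
| "lval (LCell a e e') env = Cell a (nval e env) (nval e' env)"

text \<open>The \<open>s\<close> input cells keep their place. Behind them, 16 two-dimensional
  arrays without size limits are interleaved; the pairing \<open>(i + j)^2 + i\<close> is injective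
  and needs only sums and products of indices.\<close>

fun encode :: "nat \<Rightarrow> addr \<Rightarrow> nat" where
  "encode s (Direct l) = l"
| "encode s (Cell a i j) = s + (16 * ((i + j) * (i + j) + i) + a)"

text \<open>Since \<open>i \<le> i + j\<close>, the value lies between the square of
  \<open>i + j\<close> and the next square, which determines \<open>i + j\<close> and then
  \<open>i\<close>.\<close>

lemma square_add_inj:
  fixes i j i' j' :: nat
  assumes "(i + j) * (i + j) + i = (i' + j') * (i' + j') + i'"
  shows "i = i' \<and> j = j'"
proof -
  have *: "(i + j) * (i + j) + i < (i' + j') * (i' + j') + i'" if "i + j < i' + j'" for i j i' j' :: nat
  proof -
    have "(i + j) * (i + j) + i < Suc (i + j) * Suc (i + j)" by simp
    also have "\<dots> \<le> (i' + j') * (i' + j')" using that by (intro mult_mono) auto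
    finally show ?thesis by simp
  qed
  have "i + j = i' + j'" using *[of i j i' j'] *[of i' j' i j] assms by linarith
  with assms show ?thesis by simp
qed

lemma encode_Cell_eq_iff:
  assumes "a < 16" "a' < 16"
  shows "encode s (Cell a i j) = encode s (Cell a' i' j') \<longleftrightarrow> a = a' \<and> i = i' \<and> j = j'"
proof
  assume "encode s (Cell a i j) = encode s (Cell a' i' j')"
  then have eq: "16 * ((i + j) * (i + j) + i) + a = 16 * ((i' + j') * (i' + j') + i') + a'" by simp
  have "(16 * ((i + j) * (i + j) + i) + a) mod 16 = a" "(16 * ((i' + j') * (i' + j') + i') + a') mod 16 = a'"
    using assms by (simp_all only: mod_mult_self4 mod_less)
  with eq have a: "a = a'" by simp
  with eq have "(i + j) * (i + j) + i = (i' + j') * (i' + j') + i'" using a by simp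
  from a square_add_inj[OF this] show "a = a' \<and> i = i' \<and> j = j'" by blast
qed simp

text \<open>The number \<open>d\<close> of table entries, at once the size of the input area, the
  offset of the arrays and the dimension of the vector to be reduced.\<close>

definition dim_exp :: nexp where
  "dim_exp = NTimes (NV 0) (NPlus (NTimes (NC 2) (NV 1)) (NC 1))"

fun addr_exp :: "loc \<Rightarrow> nexp" where
  "addr_exp (LDirect e) = e"
| "addr_exp (LCell a e e') =
     NPlus dim_exp (NPlus (NTimes (NC 16) (NPlus (NTimes (NPlus e e') (NPlus e e')) e)) (NC a))"

lemma nval_addr_exp: "nval (addr_exp l) env = encode (nval dim_exp env) (lval l env)"
  by (cases l) auto

fun lvars :: "loc \<Rightarrow> nat set" where
  "lvars (LDirect e) = nvars e"
| "lvars (LCell a e e') = nvars e \<union> nvars e'"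

lemma nvars_addr_exp: "nvars (addr_exp l) \<subseteq> {0, 1} \<union> lvars l"
  by (cases l) (auto simp: dim_exp_def)

text \<open>Array 15 is excluded because it holds the temporaries of expression evaluation; commands
  can then be reasoned about as if evaluation had no side effects.\<close>

fun valid_addr :: "nat \<Rightarrow> addr \<Rightarrow> bool" where
  "valid_addr s (Direct l) \<longleftrightarrow> l < s"
| "valid_addr s (Cell a i j) \<longleftrightarrow> a < 15"

lemma encode_Cell_ge: "s \<le> encode s (Cell a i j)"
  by simp

lemma encode_valid_eq_iff:
  assumes "valid_addr s x" "valid_addr s y"
  shows "encode s x = encode s y \<longleftrightarrow> x = y"
proof (cases x)
  case (Direct l)
  show ?thesis
  proof (cases y)
    case (Cell a i j)
    then show ?thesis using assms Direct encode_Cell_ge[of s a i j] by (auto simp del: encode.simps(2))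
  qed (use Direct in simp)
next
  case (Cell a i j)
  show ?thesis
  proof (cases y)
    case (Direct l)
    then show ?thesis using assms Cell encode_Cell_ge[of s a i j] by (auto simp del: encode.simps(2))
  next
    case y: (Cell a' i' j')
    have "a < 16" "a' < 16" using assms Cell y by simp_all
    then show ?thesis unfolding Cell y by (simp only: encode_Cell_eq_iff addr.inject)
  qed
qed

lemma encode_valid_neq_temp:
  assumes "valid_addr s x"
  shows "encode s x \<noteq> encode s (Cell 15 k 0)"
proof (cases x)
  case (Direct l)
  then show ?thesis using assms encode_Cell_ge[of s 15 k 0] by (auto simp del: encode.simps(2))
next
  case (Cell a i j)
  have "a < 16" "a \<noteq> 15" using assms Cell by simp_all
  then show ?thesis unfolding Cell by (subst encode_Cell_eq_iff) simp_all
qed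

lemma encode_temp_eq_iff: "encode s (Cell 15 k 0) = encode s (Cell 15 k' 0) \<longleftrightarrow> k = k'"
  by (subst encode_Cell_eq_iff) auto

definition ok_loc :: "nat set \<Rightarrow> (nat \<Rightarrow> nat) \<Rightarrow> loc \<Rightarrow> bool" where
  "ok_loc S env l \<longleftrightarrow> lvars l \<subseteq> S \<and> valid_addr (nval dim_exp env) (lval l env)"

section \<open>Real expressions\<close>

datatype rexp = RC int | RL loc | ROp arith_op rexp rexp

fun rval :: "rexp \<Rightarrow> (nat \<Rightarrow> nat) \<Rightarrow> (addr \<Rightarrow> real) \<Rightarrow> real" where
  "rval (RC z) env M = of_int z"
| "rval (RL l) env M = M (lval l env)"
| "rval (ROp p a b) env M = arith p (rval a env M) (rval b env M)"

fun ok_rexp :: "nat set \<Rightarrow> (nat \<Rightarrow> nat) \<Rightarrow> rexp \<Rightarrow> bool" where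
  "ok_rexp S env (RC z) \<longleftrightarrow> True"
| "ok_rexp S env (RL l) \<longleftrightarrow> ok_loc S env l"
| "ok_rexp S env (ROp p a b) \<longleftrightarrow> ok_rexp S env a \<and> ok_rexp S env b"

abbreviation temp :: "nat \<Rightarrow> nexp" where
  "temp k \<equiv> addr_exp (LCell 15 (NC k) (NC 0))"

text \<open>Real operands are addressed through index registers, so every real instruction is
  preceded by code that computes the target address into register 100 and, if needed, a source
  address into 101. The value ends up in slot \<open>k\<close> of the stack.\<close>

fun rcomp :: "rexp \<Rightarrow> nat \<Rightarrow> program" where
  "rcomp (RC z) k = Seq (ncomp (temp k) 100) (Do (Real_Const 100 z))"
| "rcomp (RL l) k = Seq (ncomp (temp k) 100) (Seq (ncomp (addr_exp l) 101) (Do (Real_Copy 100 101)))"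
| "rcomp (ROp p a b) k = Seq (rcomp a k) (Seq (rcomp b (k + 1))
     (Seq (ncomp (temp k) 100) (Seq (ncomp (temp (k + 1)) 101) (Do (Real_Arith p 100 100 101)))))"

fun rtime :: "rexp \<Rightarrow> nat \<Rightarrow> (nat \<Rightarrow> nat) \<Rightarrow> nat" where
  "rtime (RC z) k env = ntime (temp k) env + 1"
| "rtime (RL l) k env = ntime (temp k) env + (ntime (addr_exp l) env + 1)"
| "rtime (ROp p a b) k env = rtime a k env + (rtime b (k + 1) env +
     (ntime (temp k) env + (ntime (temp (k + 1)) env + 1)))"

text \<open>Expressions are evaluated on a stack of real cells, the rows of array 15; the loop variables in
  scope live in the registers below 100, and the higher registers are scratch space.\<close>

definition represents :: "nat set \<Rightarrow> (nat \<Rightarrow> nat) \<Rightarrow> (addr \<Rightarrow> real) \<Rightarrow> state \<Rightarrow> bool" where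
  "represents S env M s \<longleftrightarrow> {0, 1} \<subseteq> S \<and> S \<subseteq> {..<100} \<and> (\<forall>v\<in>S. fst s v = env v) \<and>
     (\<forall>x. valid_addr (nval dim_exp env) x \<longrightarrow> snd s (encode (nval dim_exp env) x) = M x)"

lemma ncomp_represents:
  assumes "represents S env M (I, R)" "nvars e \<subseteq> S" "100 \<le> k"
  shows "runs (ncomp e k) (I, R) (ntime e env)
    (\<lambda>(I', R'). R' = R \<and> I' k = nval e env \<and> (\<forall>r<k. I' r = I r) \<and> represents S env M (I', R'))"
proof (rule runs_mono[OF ncomp_correct[where env = env] _ order_refl])
  show "v < k \<and> I v = env v" if "v \<in> nvars e" for v
    using that assms unfolding represents_def by (metis fst_conv lessThan_iff order_less_le_trans subsetD)
  have S: "r < k" if "r \<in> S" for r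
    using that assms unfolding represents_def by (meson lessThan_iff order_less_le_trans subsetD)
  show "case s' of (I', R') \<Rightarrow> R' = R \<and> I' k = nval e env \<and> (\<forall>r<k. I' r = I r) \<and> represents S env M (I', R')"
    if "case s' of (I', R') \<Rightarrow> R' = R \<and> I' k = nval e env \<and> (\<forall>r<k. I' r = I r)" for s'
    using that assms(1) S unfolding represents_def by (cases s') auto
qed

lemma nvars_temp: "represents S env M s \<Longrightarrow> nvars (temp k) \<subseteq> S"
  unfolding represents_def using nvars_addr_exp[of "LCell 15 (NC k) (NC 0)"] by fastforce

lemma represents_temp:
  assumes "represents S env M (I, R)" "x = encode (nval dim_exp env) (Cell 15 k 0)"
  shows "represents S env M (I, R(x := z))"
  using assms encode_valid_neq_temp unfolding represents_def by auto

text \<open>That the slots below \<open>k\<close> survive is what lets the left operand wait while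
  the right one is evaluated.\<close>

lemma rcomp_correct:
  assumes "represents S env M (I, R)" "ok_rexp S env e"
  shows "runs (rcomp e k) (I, R) (rtime e k env)
    (\<lambda>(I', R'). represents S env M (I', R') \<and> R' (nval (temp k) env) = rval e env M \<and>
       (\<forall>j<k. R' (nval (temp j) env) = R (nval (temp j) env)))"
  using assms
proof (induction e arbitrary: k I R)
  case (RC z)
  show ?case unfolding rcomp.simps rtime.simps
    apply (rule runs_Seq, rule runs_mono[OF ncomp_represents[OF RC(1) nvars_temp[OF RC(1)]] _ order_refl])
     apply simp
    apply clarify
    apply (rule runs_Do)
    using RC by (auto simp: nval_addr_exp encode_temp_eq_iff simp del: addr_exp.simps encode.simps
        intro!: represents_temp)
next
  case (RL l)
  have l: "nvars (addr_exp l) \<subseteq> S" "valid_addr (nval dim_exp env) (lval l env)"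
    using nvars_addr_exp[of l] RL by (auto simp: ok_loc_def represents_def)
  show ?case unfolding rcomp.simps rtime.simps
    apply (rule runs_Seq, rule runs_mono[OF ncomp_represents[OF RL(1) nvars_temp[OF RL(1)]] _ order_refl])
     apply simp
    apply clarify
    apply (rule runs_Seq)
    apply (rule runs_mono[OF ncomp_represents[OF _ l(1)] _ order_refl], assumption)
     apply simp
    apply clarify
    apply (rule runs_Do)
    using l by (auto simp: nval_addr_exp encode_temp_eq_iff represents_def encode_valid_neq_temp
        simp del: addr_exp.simps encode.simps)
next
  case (ROp p a b)
  have *: "ok_rexp S env a" "ok_rexp S env b" using ROp.prems by auto
  show ?case unfolding rcomp.simps rtime.simps
    apply (rule runs_Seq, rule runs_mono[OF ROp.IH(1)[OF ROp.prems(1) *(1)] _ order_refl])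
    apply clarify
    apply (rule runs_Seq, rule runs_mono[OF ROp.IH(2)[OF _ *(2)] _ order_refl], assumption)
    apply clarify
    apply (rule runs_Seq)
    apply (rule runs_mono[OF ncomp_represents[OF _ nvars_temp] _ order_refl], assumption, assumption)
     apply simp
    apply clarify
    apply (rule runs_Seq)
    apply (rule runs_mono[OF ncomp_represents[OF _ nvars_temp] _ order_refl], assumption, assumption)
     apply simp
    apply clarify
    apply (rule runs_Do)
    by (auto simp: nval_addr_exp encode_temp_eq_iff simp del: addr_exp.simps encode.simps
        intro!: represents_temp)
qed

section \<open>Commands with counted loops\<close>

datatype cmd =
    CSet loc rexp
  | CSeq cmd cmd (infixr \<open>;;\<close> 60)
  | CIf rexp rexp cmd
  | CFor nat nexp cmd

primrec iterate :: "(nat \<Rightarrow> 'a \<Rightarrow> 'a) \<Rightarrow> nat \<Rightarrow> 'a \<Rightarrow> 'a" where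
  "iterate f 0 x = x"
| "iterate f (Suc k) x = f k (iterate f k x)"

fun run :: "cmd \<Rightarrow> (nat \<Rightarrow> nat) \<Rightarrow> (addr \<Rightarrow> real) \<Rightarrow> addr \<Rightarrow> real" where
  "run (CSet l e) env M = M(lval l env := rval e env M)"
| "run (c ;; c') env M = run c' env (run c env M)"
| "run (CIf a b c) env M = (if rval a env M < rval b env M then run c env M else M)"
| "run (CFor v e c) env M = iterate (\<lambda>i. run c (env(v := i))) (nval e env) M"

text \<open>\<open>S\<close> is the set of index variables in scope; a loop variable must be fresh.
  Whether a direct address stays inside the input area depends on the values of the loop variables,
  hence the quantification over all rounds.\<close>

fun ok :: "nat set \<Rightarrow> (nat \<Rightarrow> nat) \<Rightarrow> cmd \<Rightarrow> bool" where
  "ok S env (CSet l e) \<longleftrightarrow> ok_loc S env l \<and> ok_rexp S env e"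
| "ok S env (c ;; c') \<longleftrightarrow> ok S env c \<and> ok S env c'"
| "ok S env (CIf a b c) \<longleftrightarrow> ok_rexp S env a \<and> ok_rexp S env b \<and> ok S env c"
| "ok S env (CFor v e c) \<longleftrightarrow> v < 100 \<and> v \<notin> S \<and> nvars e \<subseteq> S \<and>
     (\<forall>i<nval e env. ok (insert v S) (env(v := i)) c)"

text \<open>Registers from 100 on are overwritten by the loop body, so the loop bound is recomputed
  in register 100 at the end of every round, after that register has served to hold the increment
  1.\<close>

fun compile :: "cmd \<Rightarrow> program" where
  "compile (CSet l e) = Seq (rcomp e 0) (Seq (ncomp (addr_exp l) 100) (Seq (ncomp (temp 0) 101)
     (Do (Real_Copy 100 101))))"
| "compile (c ;; c') = Seq (compile c) (compile c')"
| "compile (CIf a b c) = Seq (rcomp a 0) (Seq (rcomp b 1) (Seq (ncomp (temp 0) 100)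
     (Seq (ncomp (temp 1) 101) (Cond (Real_Less 100 101) (compile c) Skip))))"
| "compile (CFor v e c) = Seq (Do (Index_Const v 0)) (Seq (ncomp e 100)
     (While (Index_Less v 100)
       (Seq (compile c) (Seq (Do (Index_Const 100 1)) (Seq (Do (Index_Add v v 100)) (ncomp e 100))))))"

text \<open>A conditional is charged for its body whatever the test yields, and this makes the bound
  a function of the index variables alone, independent of the reals in memory.\<close>

fun time :: "cmd \<Rightarrow> (nat \<Rightarrow> nat) \<Rightarrow> nat" where
  "time (CSet l e) env = rtime e 0 env + (ntime (addr_exp l) env + (ntime (temp 0) env + 1))"
| "time (c ;; c') env = time c env + time c' env"
| "time (CIf a b c) env = rtime a 0 env + (rtime b 1 env + (ntime (temp 0) env + (ntime (temp 1) env +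
     (1 + time c env))))"
| "time (CFor v e c) env = 1 + (ntime e env + (1 + (\<Sum>i<nval e env. 1 + (time c (env(v := i)) + (1 + (1 + ntime e env))))))"

lemma nval_dim_upd: "{0, 1} \<subseteq> S \<Longrightarrow> v \<notin> S \<Longrightarrow> nval dim_exp (env(v := i)) = nval dim_exp env"
  by (auto simp: dim_exp_def)

lemma ntime_cong: "(\<And>v. v \<in> nvars a \<Longrightarrow> env v = env' v) \<Longrightarrow> ntime a env = ntime a env'"
  by (induction a) (auto intro: nval_cong)

theorem compile_correct:
  assumes "represents S env M s" "ok S env c"
  shows "runs (compile c) s (time c env) (represents S env (run c env M))"
  using assms
proof (induction c arbitrary: S env M s)
  case (CSet l e)
  have l: "nvars (addr_exp l) \<subseteq> S" "valid_addr (nval dim_exp env) (lval l env)"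
    using nvars_addr_exp[of l] CSet by (auto simp: ok_loc_def represents_def)
  obtain I R where s: "s = (I, R)" by fastforce
  have e: "ok_rexp S env e" using CSet by simp
  show ?case unfolding compile.simps time.simps s
    apply (rule runs_Seq, rule runs_mono[OF rcomp_correct[OF CSet.prems(1)[unfolded s] e] _ order_refl])
    apply clarify
    apply (rule runs_Seq)
    apply (rule runs_mono[OF ncomp_represents[OF _ l(1)] _ order_refl], assumption)
     apply simp
    apply clarify
    apply (rule runs_Seq)
    apply (rule runs_mono[OF ncomp_represents[OF _ nvars_temp] _ order_refl], assumption, assumption)
     apply simp
    apply clarify
    apply (rule runs_Do)
    using l by (auto simp: nval_addr_exp represents_def encode_valid_eq_iff
        simp del: addr_exp.simps encode.simps)
next
  case (CSeq c c')
  have *: "ok S env c" "ok S env c'" using CSeq.prems by auto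
  show ?case unfolding compile.simps time.simps run.simps
    by (rule runs_Seq, rule runs_mono[OF CSeq.IH(1)[OF CSeq.prems(1) *(1)] _ order_refl],
        rule CSeq.IH(2)[OF _ *(2)])
next
  case (CIf a b c)
  obtain I R where s: "s = (I, R)" by fastforce
  have *: "ok_rexp S env a" "ok_rexp S env b" "ok S env c" using CIf by auto
  show ?case unfolding compile.simps time.simps s
    apply (rule runs_Seq, rule runs_mono[OF rcomp_correct[OF CIf.prems(1)[unfolded s] *(1)] _ order_refl])
    apply clarify
    apply (rule runs_Seq, rule runs_mono[OF rcomp_correct[OF _ *(2)] _ order_refl], assumption)
    apply clarify
    apply (rule runs_Seq)
    apply (rule runs_mono[OF ncomp_represents[OF _ nvars_temp] _ order_refl], assumption, assumption)
     apply simp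
    apply clarify
    apply (rule runs_Seq)
    apply (rule runs_mono[OF ncomp_represents[OF _ nvars_temp] _ order_refl], assumption, assumption)
     apply simp
    apply clarify
    apply (rule runs_Cond)
     apply (rule runs_mono[OF CIf.IH[OF _ *(3)] _ order_refl], assumption)
     apply (simp add: nval_addr_exp del: addr_exp.simps encode.simps)
    apply (rule runs_mono[OF runs_Skip[where Q = "represents S env M"] _ le0], assumption)
    by (simp add: nval_addr_exp del: addr_exp.simps encode.simps)
next
  case (CFor v e c)
  obtain I R where s: "s = (I, R)" by fastforce
  have S: "{0, 1} \<subseteq> S" "S \<subseteq> {..<100}" using CFor.prems(1) by (auto simp: represents_def)
  have v: "v < 100" "v \<notin> S" "nvars e \<subseteq> S"
    and okc: "\<And>i. i < nval e env \<Longrightarrow> ok (insert v S) (env(v := i)) c" using CFor.prems(2) by auto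
  have dim: "nval dim_exp (env(v := i)) = nval dim_exp env" for i
    by (rule nval_dim_upd[OF S(1) v(2)])
  have nve: "nval e (env(v := i)) = nval e env" for i using v by (intro nval_cong) auto
  have nte: "ntime e (env(v := i)) = ntime e env" for i using v by (intro ntime_cong) auto
  let ?M = "\<lambda>j. iterate (\<lambda>i. run c (env(v := i))) j M"
  let ?J = "\<lambda>j s. represents (insert v S) (env(v := j)) (?M j) s \<and> fst s 100 = nval e env"
  let ?B = "Seq (compile c) (Seq (Do (Index_Const 100 1)) (Seq (Do (Index_Add v v 100)) (ncomp e 100)))"
  have start: "represents (insert v S) (env(v := 0)) M (I(v := 0), R)"
    using CFor.prems(1) v dim by (auto simp: represents_def s)
  have incr: "represents (insert v S) (env(v := Suc j)) M' (I(100 := 1, v := I v + 1), R)"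
    if "represents (insert v S) (env(v := j)) M' (I, R)" for j M' I R
    using that v S(2) unfolding represents_def dim by auto
  have step: "holds (Index_Less v 100) s \<and>
      runs ?B s (time c (env(v := j)) + (1 + (1 + ntime e env))) (?J (Suc j))"
    if j: "j < nval e env" and J: "?J j s" for j s
  proof
    show "holds (Index_Less v 100) s" using J j by (cases s) (auto simp: represents_def)
    show "runs ?B s (time c (env(v := j)) + (1 + (1 + ntime e env))) (?J (Suc j))"
      apply (rule runs_Seq)
      apply (rule runs_mono[OF CFor.IH[OF conjunct1[OF J] okc[OF j]] _ order_refl])
      subgoal for s'
        apply (cases s')
        apply (rule runs_Seq, rule runs_Do)
        apply (rule runs_Seq, rule runs_Do)
        apply clarify
        subgoal for I R
          apply (simp only: effect.simps fun_upd_same fun_upd_other[OF v(1)[THEN less_imp_neq]])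
          apply (rule runs_mono[OF ncomp_represents[OF incr]])
              apply (simp only: iterate.simps)
          using v apply blast
            apply simp
           apply (elim case_prodE conjE, simp only: iterate.simps nve fst_conv)
          by (simp only: nte order_refl)
        done
      done
  qed
  have loop: "runs (While (Index_Less v 100) ?B) s
      (1 + (\<Sum>j<nval e env. 1 + (time c (env(v := j)) + (1 + (1 + ntime e env))))) (?J (nval e env))"
    if "?J 0 s" for s
    by (rule runs_While[where J = ?J]) (use step that in \<open>auto simp: represents_def split: prod.splits\<close>)
  show ?case unfolding compile.simps time.simps s
    apply (rule runs_Seq, rule runs_Do, simp only: effect.simps)
    apply (rule runs_Seq)
    apply (rule runs_mono[OF ncomp_represents[OF start]])
    using v apply blast
      apply simp
     apply clarify
     apply (rule runs_mono[OF loop _ order_refl])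
    using v S apply (auto simp: represents_def dim nve nte)
    done
qed

section \<open>Polynomial running time from the syntax\<close>

definition poly_bounded :: "((nat \<Rightarrow> nat) \<Rightarrow> nat) \<Rightarrow> bool" where
  "poly_bounded f \<longleftrightarrow> (\<exists>p. \<forall>B env. (\<forall>v. env v \<le> B) \<longrightarrow> f env \<le> (B + 2) ^ p)"

lemma poly_bounded_const: "poly_bounded (\<lambda>_. m)"
  unfolding poly_bounded_def
proof (intro exI[of _ m] allI impI)
  fix B :: nat
  have "m \<le> 2 ^ m" by (simp add: less_imp_le)
  also have "\<dots> \<le> (B + 2) ^ m" by (intro power_mono) auto
  finally show "m \<le> (B + 2) ^ m" .
qed

lemma poly_bounded_var: "poly_bounded (\<lambda>env. env v)"
  unfolding poly_bounded_def by (intro exI[of _ 1]) (auto intro: le_SucI)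

text \<open>The base \<open>B + 2\<close> is at least 2, so doubling a power costs only one more
  factor; this is why constants never appear in front of the power.\<close>

lemma poly_bounded_add:
  assumes "poly_bounded f" "poly_bounded g"
  shows "poly_bounded (\<lambda>env. f env + g env)"
proof -
  obtain p q where p: "\<And>B env. \<forall>v. env v \<le> B \<Longrightarrow> f env \<le> (B + 2) ^ p"
    and q: "\<And>B env. \<forall>v. env v \<le> B \<Longrightarrow> g env \<le> (B + 2) ^ q"
    using assms unfolding poly_bounded_def by blast
  have "f env + g env \<le> (B + 2) ^ (p + q + 1)" if "\<forall>v. env v \<le> B" for B env
  proof -
    have "f env + g env \<le> (B + 2) ^ (p + q) + (B + 2) ^ (p + q)"
      using p[OF that] q[OF that] power_increasing[of p "p + q" "B + 2"] power_increasing[of q "p + q" "B + 2"]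
      by linarith
    also have "\<dots> \<le> (B + 2) ^ (p + q + 1)" by (simp add: algebra_simps)
    finally show ?thesis .
  qed
  then show ?thesis unfolding poly_bounded_def by blast
qed

lemma poly_bounded_mult:
  assumes "poly_bounded f" "poly_bounded g"
  shows "poly_bounded (\<lambda>env. f env * g env)"
proof -
  obtain p q where p: "\<And>B env. \<forall>v. env v \<le> B \<Longrightarrow> f env \<le> (B + 2) ^ p"
    and q: "\<And>B env. \<forall>v. env v \<le> B \<Longrightarrow> g env \<le> (B + 2) ^ q"
    using assms unfolding poly_bounded_def by blast
  have "f env * g env \<le> (B + 2) ^ (p + q)" if "\<forall>v. env v \<le> B" for B env
    using mult_mono[OF p[OF that] q[OF that]] by (simp add: power_add)
  then show ?thesis unfolding poly_bounded_def by blast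
qed

lemma poly_bounded_mono:
  "poly_bounded g \<Longrightarrow> (\<And>env. f env \<le> g env) \<Longrightarrow> poly_bounded f"
  unfolding poly_bounded_def by (meson order_trans)

text \<open>The loop variable may exceed the bound \<open>B\<close> on the other variables, but it
  stays below \<open>(B + 2) ^ p\<close>. Inserting this larger bound into the polynomial for the
  body gives a polynomial again.\<close>

lemma poly_bounded_sum:
  assumes "poly_bounded f" "poly_bounded g"
  shows "poly_bounded (\<lambda>env. \<Sum>i<f env. g (env(v := i)))"
proof -
  obtain p q where p: "\<And>B env. \<forall>v. env v \<le> B \<Longrightarrow> f env \<le> (B + 2) ^ p"
    and q: "\<And>B env. \<forall>v. env v \<le> B \<Longrightarrow> g env \<le> (B + 2) ^ q"
    using assms unfolding poly_bounded_def by blast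
  have "(\<Sum>i<f env. g (env(v := i))) \<le> (B + 2) ^ (p + (p + 2) * q)" if B: "\<forall>v. env v \<le> B" for B env
  proof -
    have "g (env(v := i)) \<le> ((B + 2) ^ (p + 2)) ^ q" if i: "i < f env" for i
    proof -
      have "(B + 2) ^ 1 \<le> (B + 2) ^ (p + 1)" by (rule power_increasing) auto
      moreover have "(B + 2) ^ p \<le> (B + 2) ^ (p + 1)" by (rule power_increasing) auto
      ultimately have "\<forall>w. (env(v := i)) w \<le> (B + 2) ^ (p + 1)"
        using B p[OF B] i by (auto intro: order_trans[of _ B] order_trans[of _ "f env"] order_trans[of _ "(B + 2) ^ p"])
      from q[OF this] have "g (env(v := i)) \<le> ((B + 2) ^ (p + 1) + 2) ^ q" .
      also have "\<dots> \<le> ((B + 2) ^ (p + 2)) ^ q"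
      proof (rule power_mono)
        have "(B + 2) ^ (p + 1) + 2 \<le> (B + 2) ^ (p + 1) * 2"
          using \<open>(B + 2) ^ 1 \<le> (B + 2) ^ (p + 1)\<close> by simp
        also have "\<dots> \<le> (B + 2) ^ (p + 1) * (B + 2)" by simp
        finally show "(B + 2) ^ (p + 1) + 2 \<le> (B + 2) ^ (p + 2)" by (simp add: mult.commute)
      qed simp
      finally show ?thesis .
    qed
    then have "(\<Sum>i<f env. g (env(v := i))) \<le> (\<Sum>i<f env. ((B + 2) ^ (p + 2)) ^ q)"
      by (intro sum_mono) auto
    also have "\<dots> \<le> (B + 2) ^ p * ((B + 2) ^ (p + 2)) ^ q" using p[OF B] by simp
    also have "\<dots> = (B + 2) ^ (p + (p + 2) * q)" by (simp only: power_add power_mult)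
    finally show ?thesis .
  qed
  then show ?thesis unfolding poly_bounded_def by blast
qed

lemma poly_bounded_nval: "poly_bounded (nval e)"
proof (induction e)
  case (NC m)
  show ?case by (rule poly_bounded_mono[OF poly_bounded_const[of m]]) simp
next
  case (NV v)
  show ?case by (rule poly_bounded_mono[OF poly_bounded_var[of v]]) simp
next
  case (NPlus a b)
  show ?case by (rule poly_bounded_mono[OF poly_bounded_add[OF NPlus]]) simp
next
  case (NMinus a b)
  show ?case by (rule poly_bounded_mono[OF NMinus(1)]) simp
next
  case (NTimes a b)
  show ?case by (rule poly_bounded_mono[OF poly_bounded_mult[OF NTimes]]) simp
qed

lemma poly_bounded_ntime: "poly_bounded (ntime e)"
proof (induction e)
  case (NC m)
  show ?case by (rule poly_bounded_mono[OF poly_bounded_const[of 1]]) simp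
next
  case (NV v)
  show ?case by (rule poly_bounded_mono[OF poly_bounded_const[of 2]]) simp
next
  case (NPlus a b)
  show ?case by (rule poly_bounded_mono[OF poly_bounded_add[OF NPlus(1)
    poly_bounded_add[OF NPlus(2) poly_bounded_const[of 1]]]]) simp
next
  case (NMinus a b)
  show ?case by (rule poly_bounded_mono[OF poly_bounded_add[OF NMinus(1)
    poly_bounded_add[OF NMinus(2) poly_bounded_const[of 1]]]]) simp
next
  case (NTimes a b)
  show ?case by (rule poly_bounded_mono[OF poly_bounded_add[OF NTimes(1) poly_bounded_add[OF NTimes(2)
    poly_bounded_add[OF poly_bounded_const[of 4] poly_bounded_mult[OF poly_bounded_const[of 3] poly_bounded_nval[of a]]]]]]) simp
qed

lemma poly_bounded_rtime: "poly_bounded (rtime e k)"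
proof (induction e arbitrary: k)
  case (RC z)
  show ?case
    by (rule poly_bounded_mono[OF poly_bounded_add[OF poly_bounded_ntime[of "temp k"] poly_bounded_const[of 1]]])
      (simp only: rtime.simps order_refl)
next
  case (RL l)
  show ?case
    by (rule poly_bounded_mono[OF poly_bounded_add[OF poly_bounded_ntime[of "temp k"]
      poly_bounded_add[OF poly_bounded_ntime[of "addr_exp l"] poly_bounded_const[of 1]]]]) (simp only: rtime.simps order_refl)
next
  case (ROp p a b)
  show ?case
    by (rule poly_bounded_mono[OF poly_bounded_add[OF ROp(1)[of k] poly_bounded_add[OF ROp(2)[of "k + 1"]
      poly_bounded_add[OF poly_bounded_ntime[of "temp k"] poly_bounded_add[OF poly_bounded_ntime[of "temp (k + 1)"] poly_bounded_const[of 1]]]]]])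
      (simp only: rtime.simps order_refl)
qed

lemma poly_bounded_time: "poly_bounded (time c)"
proof (induction c)
  case (CSet l e)
  show ?case
    by (rule poly_bounded_mono[OF poly_bounded_add[OF poly_bounded_rtime[of e 0] poly_bounded_add[OF poly_bounded_ntime[of "addr_exp l"]
      poly_bounded_add[OF poly_bounded_ntime[of "temp 0"] poly_bounded_const[of 1]]]]]) (simp only: time.simps order_refl)
next
  case (CSeq c c')
  show ?case by (rule poly_bounded_mono[OF poly_bounded_add[OF CSeq]]) simp
next
  case (CIf a b c)
  show ?case
    by (rule poly_bounded_mono[OF poly_bounded_add[OF poly_bounded_rtime[of a 0] poly_bounded_add[OF poly_bounded_rtime[of b 1]
      poly_bounded_add[OF poly_bounded_ntime[of "temp 0"] poly_bounded_add[OF poly_bounded_ntime[of "temp 1"]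
      poly_bounded_add[OF poly_bounded_const[of 1] CIf]]]]]]) (simp only: time.simps order_refl)
next
  case (CFor v e c)
  have body: "poly_bounded (\<lambda>env. \<Sum>i<nval e env. time c (env(v := i)))"
    by (rule poly_bounded_sum[OF poly_bounded_nval CFor])
  have rest: "poly_bounded (\<lambda>env. nval e env * (3 + ntime e env))"
    by (rule poly_bounded_mult[OF poly_bounded_nval poly_bounded_add[OF poly_bounded_const poly_bounded_ntime]])
  show ?case
    by (rule poly_bounded_mono[OF poly_bounded_add[OF poly_bounded_add[OF poly_bounded_const[of 2] poly_bounded_ntime[of e]]
      poly_bounded_add[OF body rest]]])
      (simp only: time.simps sum.distrib sum_constant card_lessThan, simp add: algebra_simps)
qed

lemma poly_time:
  "\<exists>k. \<forall>n N. time c ((\<lambda>_. 0)(0 := n, 1 := N)) \<le> k * (n + N) ^ k + k"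
proof -
  obtain p where p: "\<And>B env. \<forall>v. env v \<le> B \<Longrightarrow> time c env \<le> (B + 2) ^ p"
    using poly_bounded_time[of c] unfolding poly_bounded_def by blast
  \<comment> \<open>The single number \<open>3 ^ p\<close> serves as factor, exponent and summand:
    it comes from \<open>n + N + 2 \<le> 3 * (n + N)\<close> for nonzero \<open>n + N\<close>, it
    exceeds \<open>p\<close>, and as a summand it covers \<open>n = N = 0\<close>.\<close>
  have "time c ((\<lambda>_. 0)(0 := n, 1 := N)) \<le> 3 ^ p * (n + N) ^ 3 ^ p + 3 ^ p" for n N
  proof (cases "n + N = 0")
    case True
    then have "time c ((\<lambda>_. 0)(0 := n, 1 := N)) \<le> 2 ^ p"
      using p[where B = 0 and env = "(\<lambda>_. 0)(0 := n, 1 := N)"] by (simp add: numeral_2_eq_2)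
    also have "(2 :: nat) ^ p \<le> 3 ^ p" by (rule power_mono) auto
    finally show ?thesis by simp
  next
    case False
    have "time c ((\<lambda>_. 0)(0 := n, 1 := N)) \<le> (n + N + 2) ^ p" by (rule p) auto
    also have "\<dots> \<le> (3 * (n + N)) ^ p" using False by (intro power_mono) auto
    also have "\<dots> = 3 ^ p * (n + N) ^ p" by (rule power_mult_distrib)
    also have "\<dots> \<le> 3 ^ p * (n + N) ^ 3 ^ p"
      using False less_exp[of p] power_mono[of 2 "3 :: nat" p]
      by (intro mult_left_mono power_increasing) auto
    finally show ?thesis by simp
  qed
  then show ?thesis by blast
qed

section \<open>Lattice reduction and simultaneous approximation\<close>

definition weight :: "nat \<Rightarrow> real \<Rightarrow> nat \<Rightarrow> real" where
  "weight d e l = (if l < d then 1 else e)"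

text \<open>Row \<open>i\<close> of \<open>V\<close> is a vector of the lattice spanned by the unit vectors and \<open>(w, 1)\<close>; its last
  coordinate is weighted by \<open>e\<close>. The Gram-Schmidt data of the rows are encoded without mentioning
  projections: \<open>\<mu>\<close> is unit lower triangular and \<open>V D V\<^sup>T = \<mu> diag(c) \<mu>\<^sup>T\<close>.\<close>

definition lll_inv :: "nat \<Rightarrow> (nat \<Rightarrow> real) \<Rightarrow> real \<Rightarrow> (nat \<Rightarrow> nat \<Rightarrow> real) \<Rightarrow> (nat \<Rightarrow> nat \<Rightarrow> real) \<Rightarrow>
    (nat \<Rightarrow> real) \<Rightarrow> bool" where
  "lll_inv d w e V \<mu> c \<longleftrightarrow>
     (\<forall>i\<le>d. V i d \<in> \<int> \<and> (\<forall>l<d. V i d * w l - V i l \<in> \<int>)) \<and>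
     (\<forall>i\<le>d. \<forall>j\<le>d. (\<Sum>l\<le>d. weight d e l * V i l * V j l) = (\<Sum>l\<le>d. c l * \<mu> i l * \<mu> j l)) \<and>
     (\<forall>i\<le>d. \<mu> i i = 1 \<and> (\<forall>l\<le>d. i < l \<longrightarrow> \<mu> i l = 0)) \<and>
     (\<forall>i\<le>d. e \<le> c i \<and> c i \<le> 1) \<and> (\<Prod>i\<le>d. c i) = e"

text \<open>In the weighted inner product the unit vectors are orthonormal, and removing from
  \<open>(w, 1)\<close> its components along them leaves the last unit vector, of squared norm
  \<open>e\<close>. So \<open>\<mu>\<close> coincides with \<open>V\<close> and \<open>c\<close>
  with the weights, and the two Gram sums agree term by term.\<close>

lemma lll_inv_init:
  assumes "0 < e" "e \<le> 1"
    and V: "\<And>i l. i \<le> d \<Longrightarrow> l \<le> d \<Longrightarrow> V i l = (if i = l then 1 else if i = d then w l else 0)"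
    and \<mu>: "\<And>i l. i \<le> d \<Longrightarrow> l \<le> d \<Longrightarrow> \<mu> i l = (if i = l then 1 else if i = d then w l else 0)"
    and c: "\<And>i. i \<le> d \<Longrightarrow> c i = weight d e i"
  shows "lll_inv d w e V \<mu> c"
proof -
  have "(\<Prod>i\<le>d. c i) = (\<Prod>i<d. c i) * c d" by (simp add: lessThan_Suc_atMost[symmetric])
  also have "\<dots> = e" using c by (simp add: weight_def)
  finally have "(\<Prod>i\<le>d. c i) = e" .
  moreover have "(\<Sum>l\<le>d. weight d e l * V i l * V j l) = (\<Sum>l\<le>d. c l * \<mu> i l * \<mu> j l)"
    if "i \<le> d" "j \<le> d" for i j using that V \<mu> c by (intro sum.cong) auto
  moreover have "V i d * w l - V i l \<in> \<int>" if "i \<le> d" "l < d" for i l using that V by auto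
  ultimately show ?thesis using assms by (auto simp: lll_inv_def weight_def)
qed

text \<open>A row operation multiplies both sides of the Gram identity by the same elementary matrix
  and its transpose. Expanding in old Gram entries lets one computation serve for \<open>V\<close>
  with the weights and for \<open>\<mu>\<close> with \<open>c\<close>.\<close>

lemma gram_row_operation:
  fixes A :: "nat \<Rightarrow> nat \<Rightarrow> real"
  assumes "\<And>l. l \<le> d \<Longrightarrow> A' i l = A i l - r i * A h l" "\<And>l. l \<le> d \<Longrightarrow> A' j l = A j l - r j * A h l"
  shows "(\<Sum>l\<le>d. g l * A' i l * A' j l) = (\<Sum>l\<le>d. g l * A i l * A j l) - r j * (\<Sum>l\<le>d. g l * A i l * A h l)
     - r i * (\<Sum>l\<le>d. g l * A h l * A j l) + r i * r j * (\<Sum>l\<le>d. g l * A h l * A h l)"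
proof -
  have "(\<Sum>l\<le>d. g l * A' i l * A' j l) = (\<Sum>l\<le>d. g l * A i l * A j l - r j * (g l * A i l * A h l)
     - r i * (g l * A h l * A j l) + r i * r j * (g l * A h l * A h l))"
    by (intro sum.cong refl) (simp add: assms, simp add: algebra_simps)
  then show ?thesis by (simp add: sum.distrib sum_subtractf sum_distrib_left)
qed

lemma lll_inv_row_operation:
  assumes inv: "lll_inv d w e V \<mu> c" and ij: "h < i" "i \<le> d" and r: "r \<in> \<int>"
    and V': "\<And>j l. j \<le> d \<Longrightarrow> l \<le> d \<Longrightarrow> V' j l = V j l - (if j = i then r else 0) * V h l"
    and \<mu>': "\<And>j l. j \<le> d \<Longrightarrow> l \<le> d \<Longrightarrow> \<mu>' j l = \<mu> j l - (if j = i then r else 0) * \<mu> h l"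
  shows "lll_inv d w e V' \<mu>' c"
proof -
  have h: "h \<le> d" using ij by simp
  have "(\<Sum>l\<le>d. weight d e l * V' j l * V' j' l) = (\<Sum>l\<le>d. c l * \<mu>' j l * \<mu>' j' l)"
    if j: "j \<le> d" "j' \<le> d" for j j'
    using gram_row_operation[where A = V and A' = V' and h = h and i = j and j = j' and g = "weight d e" and
        r = "\<lambda>j. if j = i then r else 0", OF V' V', OF j(1) _ j(2)]
      gram_row_operation[where A = \<mu> and A' = \<mu>' and h = h and i = j and j = j' and g = c and
        r = "\<lambda>j. if j = i then r else 0", OF \<mu>' \<mu>', OF j(1) _ j(2)]
      inv j h by (simp add: lll_inv_def)
  moreover have "V' j d \<in> \<int> \<and> (\<forall>l<d. V' j d * w l - V' j l \<in> \<int>)" if j: "j \<le> d" for j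
  proof -
    have V: "V j d \<in> \<int>" "V h d \<in> \<int>" "\<And>l. l < d \<Longrightarrow> V j d * w l - V j l \<in> \<int>"
      "\<And>l. l < d \<Longrightarrow> V h d * w l - V h l \<in> \<int>" using inv j h by (simp_all add: lll_inv_def)
    let ?r = "if j = i then r else 0"
    have r': "?r \<in> \<int>" using r by simp
    have "V' j d \<in> \<int>" unfolding V'[OF j order_refl] by (rule Ints_diff[OF V(1) Ints_mult[OF r' V(2)]])
    moreover have "V' j d * w l - V' j l \<in> \<int>" if l: "l < d" for l
    proof -
      have "V' j d * w l - V' j l = (V j d * w l - V j l) - ?r * (V h d * w l - V h l)"
        unfolding V'[OF j order_refl] V'[OF j less_imp_le[OF l]] by (simp add: algebra_simps)
      then show ?thesis by (simp only: Ints_diff[OF V(3)[OF l] Ints_mult[OF r' V(4)[OF l]]])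
    qed
    ultimately show ?thesis by blast
  qed
  moreover have "\<mu>' j j = 1 \<and> (\<forall>l\<le>d. j < l \<longrightarrow> \<mu>' j l = 0)" if "j \<le> d" for j
    using inv that \<mu>' ij h by (auto simp: lll_inv_def)
  ultimately show ?thesis using inv by (simp add: lll_inv_def)
qed

definition swap_rows :: "nat \<Rightarrow> nat \<Rightarrow> nat" where
  "swap_rows k i = (if i = k then Suc k else if i = Suc k then k else i)"

text \<open>Let \<open>b\<close>, \<open>b'\<close> be the orthogonalised vectors \<open>k\<close>
  and \<open>k + 1\<close>. After the exchange they are \<open>a b + b'\<close>, of squared norm
  \<open>C\<close>, and \<open>(c (Suc k) b - a c k b') / C\<close>, of squared norm
  \<open>c k * c (Suc k) / C\<close>. The formulas are the coefficients of row \<open>i\<close> with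
  respect to these two; the rows themselves are permuted separately by
  \<open>swap_rows\<close>.\<close>

definition swap_mu :: "nat \<Rightarrow> (nat \<Rightarrow> nat \<Rightarrow> real) \<Rightarrow> (nat \<Rightarrow> real) \<Rightarrow> real \<Rightarrow> real \<Rightarrow> nat \<Rightarrow> nat \<Rightarrow> real" where
  "swap_mu k \<mu> c a C i l =
     (if l = k then (a * c k * \<mu> i k + c (Suc k) * \<mu> i (Suc k)) / C
      else if l = Suc k then \<mu> i k - a * \<mu> i (Suc k) else \<mu> i l)"

lemma sum_split_pair:
  fixes f :: "nat \<Rightarrow> real"
  assumes "k < d"
  shows "(\<Sum>l\<le>d. f l) = f k + f (Suc k) + (\<Sum>l\<in>{..d} - {k, Suc k}. f l)"
proof -
  have "(\<Sum>l\<le>d. f l) = (\<Sum>l\<in>{k, Suc k}. f l) + (\<Sum>l\<in>{..d} - {k, Suc k}. f l)"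
    using assms by (subst sum.subset_diff[of "{k, Suc k}"]) auto
  then show ?thesis by simp
qed

lemma prod_split_pair:
  fixes f :: "nat \<Rightarrow> real"
  assumes "k < d"
  shows "(\<Prod>l\<le>d. f l) = f k * f (Suc k) * (\<Prod>l\<in>{..d} - {k, Suc k}. f l)"
proof -
  have "(\<Prod>l\<le>d. f l) = (\<Prod>l\<in>{k, Suc k}. f l) * (\<Prod>l\<in>{..d} - {k, Suc k}. f l)"
    using assms by (subst prod.subset_diff[of "{k, Suc k}"]) auto
  then show ?thesis by simp
qed

text \<open>The product of the Gram determinants of all leading sets of rows: \<open>c i\<close> is
  a factor of those with more than \<open>i\<close> rows, of which there are
  \<open>Suc d - i\<close>.\<close>

definition potential :: "nat \<Rightarrow> (nat \<Rightarrow> real) \<Rightarrow> real" where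
  "potential d c = (\<Prod>i\<le>d. c i ^ (Suc d - i))"

text \<open>The new norms \<open>C\<close> and \<open>c k * c (Suc k) / C\<close> lie between
  \<open>c (Suc k)\<close> and \<open>c k\<close>, so the range of \<open>c\<close> is kept, and
  their product is the old one. In the potential the exponents at \<open>k\<close> and
  \<open>k + 1\<close> differ by one, so it changes by the factor \<open>C / c k\<close>, at most
  \<open>1 / 2 + 1 / 4\<close>. The last claim costs a division by \<open>C \<ge> e\<close>; it is
  the a priori bound for later rounding.\<close>

lemma lll_swap:
  assumes inv: "lll_inv d w e V \<mu> c" and e: "0 < e" "e \<le> 1 / 2" and k: "k < d"
    and a: "a = \<mu> (Suc k) k" "\<bar>a\<bar> \<le> 1 / 2" and C: "C = c (Suc k) + a * a * c k"
    and swap: "2 * c (Suc k) < c k"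
    and V': "\<And>i l. i \<le> d \<Longrightarrow> l \<le> d \<Longrightarrow> V' i l = V (swap_rows k i) l"
    and \<mu>': "\<And>i l. i \<le> d \<Longrightarrow> l \<le> d \<Longrightarrow> \<mu>' i l = swap_mu k \<mu> c a C (swap_rows k i) l"
    and c': "\<And>i. i \<le> d \<Longrightarrow> c' i = (if i = k then C else if i = Suc k then c k * c (Suc k) / C else c i)"
  shows "lll_inv d w e V' \<mu>' c'" "potential d c' \<le> 3 / 4 * potential d c"
    "(\<And>i l. i \<le> d \<Longrightarrow> l \<le> d \<Longrightarrow> \<bar>\<mu> i l\<bar> \<le> 1) \<Longrightarrow> i \<le> d \<Longrightarrow> l \<le> d \<Longrightarrow> \<bar>\<mu>' i l\<bar> \<le> 1 / e"
proof -
  have ck: "e \<le> c k" "c k \<le> 1" "e \<le> c (Suc k)" using inv k by (auto simp: lll_inv_def)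
  then have pos: "0 < c k" "0 < c (Suc k)" using e by auto
  have "\<bar>a\<bar> * \<bar>a\<bar> \<le> 1 / 2 * (1 / 2)" using a(2) by (intro mult_mono) auto
  then have aa: "0 \<le> a * a" "a * a \<le> 1 / 4" by (auto simp: abs_mult[symmetric])
  then have "a * a * c k \<le> 1 / 4 * c k" using pos by (intro mult_right_mono) auto
  then have C4: "C \<le> 3 / 4 * c k" using swap C by linarith
  have Cge: "c (Suc k) \<le> C" using C aa pos by simp
  have Cpos: "0 < C" using Cge pos by linarith
  have sr: "swap_rows k i \<le> d" if "i \<le> d" for i using that k by (auto simp: swap_rows_def)

  have gram: "(\<Sum>l\<le>d. c' l * swap_mu k \<mu> c a C i l * swap_mu k \<mu> c a C j l) = (\<Sum>l\<le>d. c l * \<mu> i l * \<mu> j l)" for i j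
  proof -
    \<comment> \<open>Change of orthogonal basis in a plane: \<open>p\<close> and \<open>q\<close>
      are the old squared norms, \<open>(x, y)\<close> and \<open>(x', y')\<close> the old
      coordinates of two vectors.\<close>
    have id: "C * ((a * p * x + q * y) / C) * ((a * p * x' + q * y') / C) + p * q / C * (x - a * y) * (x' - a * y')
        = p * x * x' + q * y * y'" if "C = q + a * a * p" for x y x' y' p q
    proof -
      have "C * ((a * p * x + q * y) / C) * ((a * p * x' + q * y') / C) + p * q / C * (x - a * y) * (x' - a * y')
        = ((a * p * x + q * y) * (a * p * x' + q * y') + p * q * (x - a * y) * (x' - a * y')) / C"
        using Cpos by (simp add: field_simps)
      also have "(a * p * x + q * y) * (a * p * x' + q * y') + p * q * (x - a * y) * (x' - a * y')
        = C * (p * x * x' + q * y * y')" unfolding that by (simp add: algebra_simps)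
      finally show ?thesis using Cpos by simp
    qed
    have "(\<Sum>l\<in>{..d} - {k, Suc k}. c' l * swap_mu k \<mu> c a C i l * swap_mu k \<mu> c a C j l)
        = (\<Sum>l\<in>{..d} - {k, Suc k}. c l * \<mu> i l * \<mu> j l)"
      by (intro sum.cong) (auto simp: swap_mu_def c')
    then show ?thesis
      using id[OF C, of "\<mu> i k" "\<mu> i (Suc k)" "\<mu> j k" "\<mu> j (Suc k)"] k
      by (simp add: sum_split_pair[OF k] swap_mu_def c')
  qed
  have tri: "\<mu>' i i = 1 \<and> (\<forall>l\<le>d. i < l \<longrightarrow> \<mu>' i l = 0)" if i: "i \<le> d" for i
  proof -
    have m: "\<mu> j j = 1" "\<And>l. l \<le> d \<Longrightarrow> j < l \<Longrightarrow> \<mu> j l = 0" if "j \<le> d" for j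
      using inv that by (auto simp: lll_inv_def)
    have "a * c k * a + c (Suc k) = C" using C by (simp add: algebra_simps)
    then show ?thesis using m k i Cpos \<mu>' a(1) by (auto simp: swap_mu_def swap_rows_def)
  qed
  have bounds: "e \<le> c' i \<and> c' i \<le> 1" if "i \<le> d" for i
  proof -
    have "c (Suc k) * C \<le> c k * c (Suc k)" using pos C4 by (simp add: mult.commute)
    then have "c (Suc k) \<le> c k * c (Suc k) / C" using Cpos by (simp add: pos_le_divide_eq)
    moreover have "c k * c (Suc k) / C \<le> c k"
      using Cpos Cge pos by (simp add: pos_divide_le_eq mult_left_mono)
    ultimately have "e \<le> c k * c (Suc k) / C" "c k * c (Suc k) / C \<le> 1" "e \<le> C" "C \<le> 1"
      using ck Cge C4 pos by linarith+
    moreover have "e \<le> c i" "c i \<le> 1" using inv that by (simp_all add: lll_inv_def)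
    ultimately show ?thesis using c'[OF that] by simp
  qed
  have "c' k * c' (Suc k) = c k * c (Suc k)" using Cpos k by (simp add: c')
  moreover have "(\<Prod>l\<in>{..d} - {k, Suc k}. c' l) = (\<Prod>l\<in>{..d} - {k, Suc k}. c l)"
    by (intro prod.cong) (auto simp: c')
  ultimately have "(\<Prod>i\<le>d. c' i) = (\<Prod>i\<le>d. c i)" by (simp add: prod_split_pair[OF k])
  then show "lll_inv d w e V' \<mu>' c'"
    using inv V' \<mu>' tri bounds gram sr by (simp add: lll_inv_def)

  have cc: "c' k * c' (Suc k) = c k * c (Suc k)" by fact
  have "potential d c' = c' k ^ (Suc d - k) * c' (Suc k) ^ (Suc d - Suc k) *
      (\<Prod>l\<in>{..d} - {k, Suc k}. c l ^ (Suc d - l))"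
    unfolding potential_def prod_split_pair[OF k]
    by (intro arg_cong2[where f = "(*)"] prod.cong) (auto simp: c')
  also have "c' k ^ (Suc d - k) * c' (Suc k) ^ (Suc d - Suc k) = C * (c' k * c' (Suc k)) ^ (Suc d - Suc k)"
    using k c'[of k] by (simp add: Suc_diff_le power_mult_distrib)
  also have "\<dots> = C / c k * (c k ^ (Suc d - k) * c (Suc k) ^ (Suc d - Suc k))"
    unfolding cc using k pos by (simp add: Suc_diff_le power_mult_distrib)
  also have "\<dots> * (\<Prod>l\<in>{..d} - {k, Suc k}. c l ^ (Suc d - l)) = C / c k * potential d c"
    unfolding potential_def prod_split_pair[OF k] by simp
  finally have "potential d c' = C / c k * potential d c" .
  moreover have "0 \<le> potential d c"
    unfolding potential_def using inv e by (intro prod_nonneg zero_le_power) (auto simp: lll_inv_def intro: order_trans)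
  moreover have "C / c k \<le> 3 / 4" using C4 pos by (simp add: pos_divide_le_eq)
  ultimately show "potential d c' \<le> 3 / 4 * potential d c" by (simp only: mult_right_mono)

  assume \<mu>1: "\<And>i l. i \<le> d \<Longrightarrow> l \<le> d \<Longrightarrow> \<bar>\<mu> i l\<bar> \<le> 1" and il: "i \<le> d" "l \<le> d"
  have e2: "2 \<le> 1 / e" using e by (simp add: pos_le_divide_eq)
  have "\<bar>swap_mu k \<mu> c a C j l\<bar> \<le> 1 / e" if j: "j \<le> d" for j
  proof -
    have x: "\<bar>\<mu> j k\<bar> \<le> 1" and y: "\<bar>\<mu> j (Suc k)\<bar> \<le> 1" using \<mu>1 j k by auto
    have ay: "\<bar>a * \<mu> j (Suc k)\<bar> \<le> 1 / 2 * 1" unfolding abs_mult using a y by (intro mult_mono) auto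
    have "\<bar>a * c k * \<mu> j k\<bar> \<le> 1 / 2 * 1 * 1"
      unfolding abs_mult using a x ck pos by (intro mult_mono) auto
    moreover have "\<bar>c (Suc k) * \<mu> j (Suc k)\<bar> \<le> C * 1"
      unfolding abs_mult using y Cge pos by (intro mult_mono) auto
    ultimately have "\<bar>a * c k * \<mu> j k + c (Suc k) * \<mu> j (Suc k)\<bar> \<le> 1 / 2 + C" by linarith
    then have "\<bar>(a * c k * \<mu> j k + c (Suc k) * \<mu> j (Suc k)) / C\<bar> \<le> (1 / 2 + C) / C"
      using Cpos by (simp add: divide_right_mono)
    also have "\<dots> = 1 / 2 * (1 / C) + 1" using Cpos by (simp add: field_simps)
    also have "\<dots> \<le> 1 / 2 * (1 / e) + 1" using Cge ck(3) e Cpos by (simp add: frac_le)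
    also have "\<dots> \<le> 1 / e" using e2 by linarith
    finally have "\<bar>(a * c k * \<mu> j k + c (Suc k) * \<mu> j (Suc k)) / C\<bar> \<le> 1 / e" .
    moreover have "\<bar>\<mu> j k - a * \<mu> j (Suc k)\<bar> \<le> 1 / e" using ay x e2 by linarith
    moreover have "\<bar>\<mu> j l\<bar> \<le> 1 / e" using \<mu>1[OF j il(2)] e2 by linarith
    ultimately show ?thesis by (simp add: swap_mu_def)
  qed
  then show "\<bar>\<mu>' i l\<bar> \<le> 1 / e" using \<mu>' il sr by simp
qed

lemma potential_le_1: "lll_inv d w e V \<mu> c \<Longrightarrow> 0 < e \<Longrightarrow> potential d c \<le> 1"
  unfolding potential_def by (intro prod_le_1 conjI power_le_one zero_le_power) (auto simp: lll_inv_def intro: order_trans less_imp_le)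

text \<open>As no \<open>c i\<close> exceeds 1, raising all exponents to \<open>Suc d\<close> only
  decreases the product, which then is a power of the full Gram determinant
  \<open>e\<close>.\<close>

lemma potential_ge:
  assumes "lll_inv d w e V \<mu> c" "0 < e"
  shows "e ^ Suc d \<le> potential d c"
proof -
  have "e ^ Suc d = (\<Prod>i\<le>d. c i ^ Suc d)"
    using assms(1) by (simp only: lll_inv_def prod_power_distrib[symmetric])
  also have "\<dots> \<le> potential d c"
    unfolding potential_def
    using assms by (intro prod_mono conjI zero_le_power power_decreasing) (auto simp: lll_inv_def intro: order_trans less_imp_le)
  finally show ?thesis .
qed

text \<open>Norms drop at most by a factor 2 from one index to the next, so
  \<open>c 0 \<le> 2 ^ d * c i\<close> for every \<open>i\<close>; multiplying these
  \<open>d + 1\<close> inequalities brings in the Gram determinant \<open>e\<close>.\<close>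

lemma lll_first_vector:
  assumes inv: "lll_inv d w e V \<mu> c" and e: "0 < e" and red: "\<And>k. k < d \<Longrightarrow> c k \<le> 2 * c (Suc k)"
  shows "c 0 ^ Suc d \<le> (2 ^ d) ^ Suc d * e"
proof -
  have pos: "0 < c i" if "i \<le> d" for i using inv e that by (auto simp: lll_inv_def intro: less_le_trans)
  have *: "c 0 \<le> 2 ^ i * c i" if "i \<le> d" for i
    using that
  proof (induction i)
    case (Suc i)
    then have "c 0 \<le> 2 ^ i * c i" "c i \<le> 2 * c (Suc i)" using red by auto
    then have "c 0 \<le> 2 ^ i * (2 * c (Suc i))" by (meson mult_left_mono order_trans zero_le_numeral zero_le_power)
    then show ?case by (simp add: ac_simps)
  qed simp
  have "c 0 \<le> 2 ^ d * c i" if "i \<le> d" for i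
  proof -
    have "(2 :: real) ^ i * c i \<le> 2 ^ d * c i" using that pos[OF that] by (intro mult_right_mono power_increasing) auto
    with *[OF that] show ?thesis by linarith
  qed
  then have "(\<Prod>i\<le>d. c 0) \<le> (\<Prod>i\<le>d. 2 ^ d * c i)" using pos[of 0] by (intro prod_mono) auto
  also have "\<dots> = (2 ^ d) ^ Suc d * e" using inv by (simp add: lll_inv_def prod.distrib)
  finally show ?thesis by simp
qed

section \<open>Signs of products with short integer vectors\<close>

definition dot :: "nat \<Rightarrow> (nat \<Rightarrow> int) \<Rightarrow> (nat \<Rightarrow> real) \<Rightarrow> real" where
  "dot d v x = (\<Sum>l<d. of_int (v l) * x l)"

lemma dot_add: "dot d v (\<lambda>l. x l + y l) = dot d v x + dot d v y"
  by (simp add: dot_def sum.distrib algebra_simps)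

lemma dot_scale: "dot d v (\<lambda>l. r * x l) = r * dot d v x"
  by (simp add: dot_def sum_distrib_left algebra_simps)

lemma dot_cong: "(\<And>l. l < d \<Longrightarrow> x l = y l) \<Longrightarrow> dot d v x = dot d v y"
  by (simp add: dot_def)

lemma dot_bound:
  assumes "\<And>l. l < d \<Longrightarrow> \<bar>x l\<bar> \<le> B" "(\<Sum>l<d. \<bar>v l\<bar>) \<le> \<Delta>" "0 \<le> B"
  shows "\<bar>dot d v x\<bar> \<le> of_int \<Delta> * B"
proof -
  have "\<bar>dot d v x\<bar> \<le> (\<Sum>l<d. \<bar>of_int (v l)\<bar> * B)"
    unfolding dot_def using assms(1)
    by (intro order_trans[OF sum_abs] sum_mono) (auto simp: abs_mult mult_left_mono)
  also have "\<dots> = of_int (\<Sum>l<d. \<bar>v l\<bar>) * B" by (simp add: sum_distrib_right)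
  also have "\<dots> \<le> of_int \<Delta> * B" using assms(2,3) by (intro mult_right_mono) linarith+
  finally show ?thesis .
qed

lemma dot_Ints: "(\<And>l. l < d \<Longrightarrow> x l \<in> \<int>) \<Longrightarrow> dot d v x \<in> \<int>"
  unfolding dot_def by (intro Ints_sum) auto

lemma sgn_add_small:
  fixes x y :: real
  assumes "x \<in> \<int>" "x \<noteq> 0" "\<bar>y\<bar> < 1"
  shows "sgn (x + y) = sgn x"
proof -
  have "1 \<le> \<bar>x\<bar>" using assms(1,2) by (rule Ints_nonzero_abs_ge1)
  with assms(3) show ?thesis by (auto simp: sgn_if)
qed

lemma sgn_dominated:
  fixes x y M :: real
  assumes "x \<in> \<int>" "x \<noteq> 0" "\<bar>y\<bar> < M"
  shows "sgn (M * x + y) = sgn x" "M * x + y \<noteq> 0"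
proof -
  have M: "0 < M" using assms(3) by linarith
  have "sgn (M * x + y) = sgn (M * (x + y / M))" using M by (simp add: distrib_left)
  also have "\<dots> = sgn (x + y / M)" using M by (simp add: sgn_mult)
  also have "\<dots> = sgn x" using assms M by (intro sgn_add_small) (auto simp: abs_divide pos_divide_less_eq)
  finally show "sgn (M * x + y) = sgn x" .
  with assms(2) show "M * x + y \<noteq> 0" by (auto simp: sgn_if split: if_splits)
qed

text \<open>The integer vector \<open>W\<close> found so far decides the sign of \<open>w v\<close> for short \<open>v\<close> unless \<open>W v = 0\<close>, in which
  case the remainder \<open>\<rho>\<close> does.\<close>

definition reduced_to :: "nat \<Rightarrow> int \<Rightarrow> (nat \<Rightarrow> real) \<Rightarrow> (nat \<Rightarrow> real) \<Rightarrow> (nat \<Rightarrow> real) \<Rightarrow> bool" where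
  "reduced_to d \<Delta> w W \<rho> \<longleftrightarrow> (\<forall>l<d. W l \<in> \<int>) \<and>
     (\<forall>v. (\<Sum>l<d. \<bar>v l\<bar>) \<le> \<Delta> \<longrightarrow> sgn (dot d v w) = (if dot d v W = 0 then sgn (dot d v \<rho>) else sgn (dot d v W)))"

text \<open>A positive factor on the remainder changes no sign, which allows it to be scaled to
  maximum norm 1 before it is approximated.\<close>

lemma reduced_to_cong:
  assumes "reduced_to d \<Delta> w W \<rho>" "\<And>l. l < d \<Longrightarrow> W' l = W l" "\<And>l. l < d \<Longrightarrow> \<rho>' l = r * \<rho> l" "0 < r"
  shows "reduced_to d \<Delta> w W' \<rho>'"
proof -
  have "dot d v W' = dot d v W" "dot d v \<rho>' = r * dot d v \<rho>" for v
    using assms(2,3) by (simp_all add: dot_scale[symmetric] cong: dot_cong)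
  with assms show ?thesis by (simp add: reduced_to_def sgn_mult)
qed

text \<open>\<open>P\<close> is appended to \<open>W\<close> as a digit in base \<open>M\<close>.
  Since \<open>M\<close> exceeds all \<open>\<bar>P v\<bar>\<close>, the sign of \<open>W v\<close>
  prevails where it is nonzero. Elsewhere \<open>x v\<close> decides; it has the sign of
  \<open>q x v = P v + \<rho> v\<close>, and a nonzero integer \<open>P v\<close> outweighs
  \<open>\<bar>\<rho> v\<bar> < 1\<close>.\<close>

lemma reduced_to_step:
  assumes red: "reduced_to d \<Delta> w W x" and q: "0 < q"
    and P: "\<And>l. l < d \<Longrightarrow> q * x l = P l + \<rho> l" "\<And>l. l < d \<Longrightarrow> P l \<in> \<int>"
    and \<rho>: "\<And>l. l < d \<Longrightarrow> \<bar>\<rho> l\<bar> \<le> \<eta>" "of_int \<Delta> * \<eta> < 1" "0 \<le> \<eta>"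
    and PB: "\<And>l. l < d \<Longrightarrow> \<bar>P l\<bar> \<le> B" "of_int \<Delta> * B < M" "0 \<le> B" and M: "M \<in> \<int>"
    and W': "\<And>l. l < d \<Longrightarrow> W' l = M * W l + P l"
  shows "reduced_to d \<Delta> w W' \<rho>"
  unfolding reduced_to_def
proof (intro conjI allI impI)
  fix l assume "l < d"
  then show "W' l \<in> \<int>" using red P W' M by (auto simp: reduced_to_def)
next
  fix v assume v: "(\<Sum>l<d. \<bar>v l\<bar>) \<le> \<Delta>"
  have W'v: "dot d v W' = M * dot d v W + dot d v P"
    using W' by (simp add: dot_add[symmetric] dot_scale[symmetric] cong: dot_cong)
  have qx: "q * dot d v x = dot d v P + dot d v \<rho>"
    using P(1) by (simp add: dot_add[symmetric] dot_scale[symmetric] cong: dot_cong)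
  have Pv: "\<bar>dot d v P\<bar> < M" using dot_bound[of d P, OF PB(1) v PB(3)] PB(2) by linarith
  have \<rho>v: "\<bar>dot d v \<rho>\<bar> < 1" using dot_bound[of d \<rho>, OF \<rho>(1) v \<rho>(3)] \<rho>(2) by linarith
  have Wi: "dot d v W \<in> \<int>" using red by (intro dot_Ints) (auto simp: reduced_to_def)
  have Pi: "dot d v P \<in> \<int>" using P(2) by (intro dot_Ints)
  show "sgn (dot d v w) = (if dot d v W' = 0 then sgn (dot d v \<rho>) else sgn (dot d v W'))"
  proof (cases "dot d v W = 0")
    case False
    then show ?thesis using sgn_dominated[OF Wi False Pv] red v unfolding W'v by (simp add: reduced_to_def)
  next
    case True
    have "sgn (dot d v w) = sgn (q * dot d v x)" using True red v q by (simp add: reduced_to_def sgn_mult)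
    also have "\<dots> = (if dot d v P = 0 then sgn (dot d v \<rho>) else sgn (dot d v P))"
      unfolding qx using sgn_add_small[OF Pi _ \<rho>v] by simp
    finally show ?thesis unfolding W'v True by simp
  qed
qed

lemma Ints_less_1_eq_0: "(x :: real) \<in> \<int> \<Longrightarrow> \<bar>x\<bar> < 1 \<Longrightarrow> x = 0"
  using Ints_nonzero_abs_ge1 by fastforce

text \<open>One round: the first vector of a reduced basis is a simultaneous Diophantine approximation.
  The coordinates where \<open>x\<close> is \<open>0\<close> or of maximal modulus have remainder \<open>0\<close>.\<close>

lemma first_vector_approximates:
  assumes inv: "lll_inv d x (1 / (K * K)) V \<mu> c" and K: "1 \<le> K"
    and K_exp: "K = (2 ^ (2 * d + 2)) ^ Suc d"
    and red: "\<And>k. k < d \<Longrightarrow> c k \<le> 2 * c (Suc k)"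
    and x: "\<And>l. l < d \<Longrightarrow> \<bar>x l\<bar> \<le> 1"
  shows "\<And>l. l < d \<Longrightarrow> \<bar>V 0 l\<bar> \<le> 1 / 2 ^ (d + 2)" "V 0 d \<noteq> 0" "\<bar>V 0 d\<bar> \<le> K"
    "\<And>l. l < d \<Longrightarrow> V 0 d * x l - V 0 l \<in> \<int>" "\<And>l. l < d \<Longrightarrow> \<bar>V 0 d * x l - V 0 l\<bar> \<le> 2 * K"
    "\<And>l. l < d \<Longrightarrow> \<bar>x l\<bar> = 1 \<or> x l = 0 \<Longrightarrow> V 0 l = 0"
proof -
  let ?e = "1 / (K * K)"
  have e: "0 < ?e" using K by simp
  have "?e \<le> c 0" and c01: "c 0 \<le> 1" using inv unfolding lll_inv_def by blast+
  with e have c0: "0 < c 0" by linarith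
  \<comment> \<open>\<open>K\<close> is chosen as a power with exponent \<open>d + 1\<close>, so
    that the root can be taken exactly: \<open>c 0\<close> is at most
    \<open>2^d / 2^(4d+4) = 2^-(3d+4)\<close>, which is below the square of the desired
    \<open>2^-(d+2)\<close>.\<close>
  have "c 0 ^ Suc d \<le> (2 ^ d) ^ Suc d * ?e" by (rule lll_first_vector[OF inv e red])
  also have "\<dots> = (2 ^ d / (2 ^ (2 * d + 2) * 2 ^ (2 * d + 2))) ^ Suc d"
    unfolding K_exp by (simp only: power_divide power_mult_distrib) simp
  finally have "c 0 \<le> 2 ^ d / (2 ^ (2 * d + 2) * 2 ^ (2 * d + 2))"
    by (rule power_le_imp_le_base) simp
  also have "(2 :: real) ^ d / (2 ^ (2 * d + 2) * 2 ^ (2 * d + 2)) = 1 / 2 ^ (3 * d + 4)"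
  proof -
    have "(2 :: real) ^ (2 * d + 2) * 2 ^ (2 * d + 2) = 2 ^ d * 2 ^ (3 * d + 4)"
      by (simp only: power_add[symmetric]) (rule arg_cong[where f = "power 2"], simp)
    then show ?thesis by simp
  qed
  also have "(1 :: real) / 2 ^ (3 * d + 4) \<le> 1 / 2 ^ (2 * (d + 2))"
    by (intro divide_left_mono power_increasing) auto
  also have "(1 :: real) / 2 ^ (2 * (d + 2)) = (1 / 2 ^ (d + 2))\<^sup>2"
    by (simp only: power_divide power_one power_mult[symmetric] mult.commute)
  finally have c0': "c 0 \<le> (1 / 2 ^ (d + 2))\<^sup>2" .
  \<comment> \<open>Row 0 of \<open>\<mu>\<close> is a unit vector, so \<open>c 0\<close> is the
    weighted squared length of the first basis vector itself.\<close>
  have "(\<Sum>l\<le>d. weight d ?e l * V 0 l * V 0 l) = (\<Sum>l\<le>d. c l * \<mu> 0 l * \<mu> 0 l)"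
    using inv by (simp add: lll_inv_def)
  also have "\<dots> = (\<Sum>l\<in>{0}. c l * \<mu> 0 l * \<mu> 0 l)"
    using inv by (intro sum.mono_neutral_right) (auto simp: lll_inv_def)
  also have "\<dots> = c 0" using inv by (simp add: lll_inv_def)
  finally have norm: "(\<Sum>l<d. (V 0 l)\<^sup>2) + ?e * (V 0 d)\<^sup>2 = c 0"
    by (simp add: lessThan_Suc_atMost[symmetric] weight_def power2_eq_square)
  have sq: "(V 0 l)\<^sup>2 \<le> c 0" if "l < d" for l
  proof -
    have "(V 0 l)\<^sup>2 \<le> (\<Sum>l<d. (V 0 l)\<^sup>2)" using that by (intro member_le_sum) auto
    moreover have "0 \<le> ?e * (V 0 d)\<^sup>2" using e by simp
    ultimately show ?thesis using norm by linarith
  qed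
  show small: "\<bar>V 0 l\<bar> \<le> 1 / 2 ^ (d + 2)" if "l < d" for l
    using order_trans[OF sq[OF that] c0'] by (simp add: abs_le_square_iff[symmetric])
  have "(1 :: real) / 2 ^ (d + 2) < 1" using one_less_power[of "2 :: real" "d + 2"] by (simp only: divide_less_eq) simp
  with small have small1: "\<bar>V 0 l\<bar> < 1" if "l < d" for l using order_le_less_trans[OF small[OF that]] by blast
  show int: "V 0 d * x l - V 0 l \<in> \<int>" if "l < d" for l using inv that by (simp add: lll_inv_def)
  have q: "V 0 d \<in> \<int>" using inv by (simp add: lll_inv_def)
  show "V 0 d \<noteq> 0"
  proof
    assume 0: "V 0 d = 0"
    \<comment> \<open>With multiplier 0 the remaining coordinates would be integers of modulus less
      than 1, so the whole first vector would vanish, against \<open>0 < c 0\<close>.\<close>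
    have "V 0 l = 0" if "l < d" for l using int[OF that] small1[OF that] 0 by (intro Ints_less_1_eq_0) auto
    with 0 norm c0 show False by simp
  qed
  have "?e * (V 0 d)\<^sup>2 \<le> c 0" using norm sum_nonneg[of "{..<d}" "\<lambda>l. (V 0 l)\<^sup>2"] by simp
  then have "?e * (V 0 d)\<^sup>2 \<le> 1" using c01 by linarith
  then have "(V 0 d)\<^sup>2 \<le> K\<^sup>2" using K
    by (simp add: pos_divide_le_eq power2_eq_square)
  then show qK: "\<bar>V 0 d\<bar> \<le> K" using K by (simp add: abs_le_square_iff[symmetric])
  show "\<bar>V 0 d * x l - V 0 l\<bar> \<le> 2 * K" if "l < d" for l
  proof -
    have "\<bar>V 0 d * x l\<bar> \<le> K * 1" unfolding abs_mult using qK x[OF that] K by (intro mult_mono) auto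
    then show ?thesis using small1[OF that] K by linarith
  qed
  show "V 0 l = 0" if l: "l < d" and xl: "\<bar>x l\<bar> = 1 \<or> x l = 0" for l
  proof -
    \<comment> \<open>For integral \<open>x l\<close> the entry \<open>V 0 l\<close> differs from an
      integer by an integer; being smaller than 1 in modulus, it is 0.\<close>
    have "x l \<in> \<int>" using xl by (auto simp: abs_if split: if_splits)
    then have "V 0 d * x l - (V 0 d * x l - V 0 l) \<in> \<int>" using Ints_diff[OF Ints_mult[OF q] int[OF l]] by blast
    then have "V 0 l \<in> \<int>" by (simp only: diff_diff_eq2 add_diff_cancel_left')
    then show ?thesis using small1[OF l] by (rule Ints_less_1_eq_0)
  qed
qed

section \<open>Small solutions of sign conditions\<close>

text \<open>The Leibniz expansion has \<open>d!\<close> terms, each a signed product of entries of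
  modulus at most 1.\<close>

lemma abs_det_le_fact:
  fixes A :: "real mat"
  assumes A: "A \<in> carrier_mat d d" and entries: "\<And>i j. i < d \<Longrightarrow> j < d \<Longrightarrow> \<bar>A $$ (i, j)\<bar> \<le> 1"
  shows "\<bar>det A\<bar> \<le> fact d"
proof -
  have "\<bar>det A\<bar> \<le> (\<Sum>p | p permutes {0..<d}. \<bar>signof p * (\<Prod>i = 0..<d. A $$ (i, p i))\<bar>)"
    unfolding det_def'[OF A] by (rule sum_abs)
  also have "\<dots> \<le> (\<Sum>p | p permutes {0..<d}. 1)"
  proof (rule sum_mono)
    fix p assume "p \<in> {p. p permutes {0..<d}}"
    then have "\<And>i. i < d \<Longrightarrow> p i < d" by (metis atLeastLessThan_iff mem_Collect_eq permutes_in_image zero_le)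
    then have "(\<Prod>i = 0..<d. \<bar>A $$ (i, p i)\<bar>) \<le> 1" using entries by (intro prod_le_1) auto
    then show "\<bar>signof p * (\<Prod>i = 0..<d. A $$ (i, p i))\<bar> \<le> 1"
      by (simp add: abs_mult abs_prod sign_def)
  qed
  also have "\<dots> = fact d" by (simp add: card_permutations)
  finally show ?thesis .
qed

lemma det_Ints:
  assumes A: "A \<in> carrier_mat d d" and "\<And>i j. i < d \<Longrightarrow> j < d \<Longrightarrow> (A $$ (i, j) :: real) \<in> \<int>"
  shows "det A \<in> \<int>"
  unfolding det_def'[OF A]
proof (intro Ints_sum Ints_mult Ints_prod)
  fix p i assume "p \<in> {p. p permutes {0..<d}}" "i \<in> {0..<d}"
  then have "p i < d" by (metis atLeastLessThan_iff mem_Collect_eq permutes_in_image)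
  with \<open>i \<in> {0..<d}\<close> assms(2) show "A $$ (i, p i) \<in> \<int>" by simp
qed (simp add: sign_def)

definition row_dot :: "nat \<Rightarrow> (nat \<Rightarrow> real) \<Rightarrow> (nat \<Rightarrow> real) \<Rightarrow> real" where
  "row_dot d a x = (\<Sum>l<d. a l * x l)"

definition row_matrix :: "nat \<Rightarrow> (nat \<Rightarrow> nat \<Rightarrow> real) \<Rightarrow> real mat" where
  "row_matrix d r = mat d d (\<lambda>(i, j). r i j)"

lemma row_matrix_carrier [simp]: "row_matrix d r \<in> carrier_mat d d"
  by (simp add: row_matrix_def)

lemma row_matrix_mult: "i < d \<Longrightarrow> (row_matrix d r *\<^sub>v vec d x) $ i = row_dot d (r i) x"
  by (simp add: row_matrix_def row_dot_def scalar_prod_def atLeast0LessThan)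

lemma det_row_matrix_eq_0_iff:
  "det (row_matrix d r) = 0 \<longleftrightarrow> (\<exists>x. (\<exists>l<d. x l \<noteq> 0) \<and> (\<forall>i<d. row_dot d (r i) x = 0))"
proof -
  have "det (row_matrix d r) = 0 \<longleftrightarrow> (\<exists>v. v \<in> carrier_vec d \<and> v \<noteq> 0\<^sub>v d \<and> row_matrix d r *\<^sub>v v = 0\<^sub>v d)"
    by (rule det_0_iff_vec_prod_zero) simp
  also have "\<dots> \<longleftrightarrow> (\<exists>x. (\<exists>l<d. x l \<noteq> 0) \<and> (\<forall>i<d. row_dot d (r i) x = 0))"
  proof
    assume "\<exists>v. v \<in> carrier_vec d \<and> v \<noteq> 0\<^sub>v d \<and> row_matrix d r *\<^sub>v v = 0\<^sub>v d"
    then obtain v where v: "v \<in> carrier_vec d" "v \<noteq> 0\<^sub>v d" "row_matrix d r *\<^sub>v v = 0\<^sub>v d" by blast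
    have vv: "vec d (\<lambda>l. v $ l) = v" using v(1) by auto
    have "\<exists>l<d. v $ l \<noteq> 0" using v(1,2) by (metis carrier_vecD eq_vecI index_zero_vec)
    moreover have "row_dot d (r i) (\<lambda>l. v $ l) = 0" if "i < d" for i
      using row_matrix_mult[OF that, of r "\<lambda>l. v $ l"] v(3) that unfolding vv by simp
    ultimately show "\<exists>x. (\<exists>l<d. x l \<noteq> 0) \<and> (\<forall>i<d. row_dot d (r i) x = 0)" by blast
  next
    assume "\<exists>x. (\<exists>l<d. x l \<noteq> 0) \<and> (\<forall>i<d. row_dot d (r i) x = 0)"
    then obtain x l where x: "l < d" "x l \<noteq> 0" "\<And>i. i < d \<Longrightarrow> row_dot d (r i) x = 0" by blast
    have "vec d x \<noteq> 0\<^sub>v d" using x(1,2) by (metis index_vec index_zero_vec(1))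
    moreover have "row_matrix d r *\<^sub>v vec d x = 0\<^sub>v d"
    proof (rule eq_vecI)
      fix i assume "i < dim_vec (0\<^sub>v d :: real vec)"
      then show "(row_matrix d r *\<^sub>v vec d x) $ i = 0\<^sub>v d $ i" using row_matrix_mult[of i d r x] x(3) by simp
    qed (simp add: row_matrix_def)
    ultimately show "\<exists>v. v \<in> carrier_vec d \<and> v \<noteq> 0\<^sub>v d \<and> row_matrix d r *\<^sub>v v = 0\<^sub>v d"
      by (intro exI[of _ "vec d x"]) simp
  qed
  finally show ?thesis .
qed

lemma row_matrix_solvable:
  assumes "det (row_matrix d r) \<noteq> 0"
  obtains x where "\<And>i. i < d \<Longrightarrow> row_dot d (r i) x = b i"
proof -
  let ?A = "row_matrix d r"
  let ?v = "(1 / det ?A) \<cdot>\<^sub>v (adj_mat ?A *\<^sub>v vec d b)"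
  have adj: "adj_mat ?A \<in> carrier_mat d d" "?A * adj_mat ?A = det ?A \<cdot>\<^sub>m 1\<^sub>m d"
    using adj_mat[OF row_matrix_carrier] by blast+
  have scalar: "(t \<cdot>\<^sub>m 1\<^sub>m d) *\<^sub>v v = t \<cdot>\<^sub>v v" if "v \<in> carrier_vec d" for t :: real and v
    using that by (intro eq_vecI) auto
  have "?A *\<^sub>v (adj_mat ?A *\<^sub>v vec d b) = det ?A \<cdot>\<^sub>v vec d b"
    using adj scalar by (simp add: assoc_mult_mat_vec[symmetric, of _ d d _ d])
  then have "?A *\<^sub>v ?v = vec d b"
    using assms adj by (simp add: mult_mat_vec[of _ d d] smult_smult_assoc)
  moreover have "vec d (\<lambda>l. ?v $ l) = ?v" using adj by auto
  ultimately have "row_dot d (r i) (\<lambda>l. ?v $ l) = b i" if "i < d" for i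
    using row_matrix_mult[OF that, of r "\<lambda>l. ?v $ l"] that by simp
  then show ?thesis by (rule that)
qed

text \<open>Steinitz exchange: starting from the unit matrix, the rows are replaced one by one.\<close>

lemma nonsingular_rows:
  assumes "\<And>x. (\<And>a. a \<in> T \<Longrightarrow> row_dot d a x = 0) \<Longrightarrow> \<forall>l<d. x l = 0"
  shows "\<exists>r. (\<forall>i<d. r i \<in> T) \<and> det (row_matrix d r) \<noteq> 0"
proof -
  have "\<exists>r. (\<forall>i<k. r i \<in> T) \<and> det (row_matrix d r) \<noteq> 0" if "k \<le> d" for k
    using that
  proof (induction k)
    case 0
    have "row_matrix d (\<lambda>i j. if i = j then 1 else 0) = 1\<^sub>m d" by (auto simp: row_matrix_def)
    then show ?case by (intro exI[of _ "\<lambda>i j. if i = j then 1 else 0"]) simp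
  next
    case (Suc k)
    then obtain r where r: "\<forall>i<k. r i \<in> T" "det (row_matrix d r) \<noteq> 0" by auto
    \<comment> \<open>\<open>u\<close> is column \<open>k\<close> of the inverse matrix, orthogonal
      to every row except row \<open>k\<close>. Any row of \<open>T\<close> not orthogonal to
      \<open>u\<close> may take the place of row \<open>k\<close>.\<close>
    obtain u where u: "\<And>i. i < d \<Longrightarrow> row_dot d (r i) u = (if i = k then 1 else 0)"
      using row_matrix_solvable[OF r(2), where b = "\<lambda>i. if i = k then 1 else 0"] by metis
    have "\<not> (\<forall>l<d. u l = 0)" using u[of k] Suc.prems sum.neutral[of "{..<d}" "\<lambda>l. r k l * u l"] by (auto simp: row_dot_def)
    then obtain a where a: "a \<in> T" "row_dot d a u \<noteq> 0" using assms[of u] by blast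
    have "det (row_matrix d (r(k := a))) \<noteq> 0"
    proof
      assume "det (row_matrix d (r(k := a))) = 0"
      then obtain x l where x: "l < d" "x l \<noteq> 0" "\<And>i. i < d \<Longrightarrow> row_dot d ((r(k := a)) i) x = 0"
        unfolding det_row_matrix_eq_0_iff by blast
      \<comment> \<open>The old matrix annihilates \<open>x - t u\<close>, so
        \<open>x = t u\<close>. Then \<open>a x = 0\<close> and \<open>a u \<noteq> 0\<close> force
        \<open>t = 0\<close>, hence \<open>x = 0\<close>.\<close>
      define t where "t = row_dot d (r k) x"
      have row_dot_diff: "row_dot d b (\<lambda>l. x l - t * u l) = row_dot d b x - t * row_dot d b u" for b
        by (simp add: row_dot_def sum_subtractf sum_distrib_left algebra_simps)
      have "row_dot d (r i) (\<lambda>l. x l - t * u l) = 0" if "i < d" for i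
        using u[OF that] x(3)[OF that] unfolding row_dot_diff by (cases "i = k") (auto simp: t_def)
      then have "x l - t * u l = 0" if "l < d" for l
        using r(2) that unfolding det_row_matrix_eq_0_iff by meson
      then have xu: "x l = t * u l" if "l < d" for l using that by simp
      then have "row_dot d a x = t * row_dot d a u" by (simp add: row_dot_def sum_distrib_left algebra_simps)
      moreover have "row_dot d a x = 0" using x(3)[of k] Suc.prems by simp
      ultimately have "t = 0" using a by simp
      with xu x show False by simp
    qed
    moreover have "\<forall>i<Suc k. (r(k := a)) i \<in> T" using r(1) a(1) by (auto simp: less_Suc_eq)
    ultimately show ?case by blast
  qed
  from this[OF order_refl] show ?thesis .
qed

text \<open>Among the \<open>y\<close> that satisfy the sign conditions with slack 1, one with the most tight conditions is a
  vertex. Its coordinates are quotients of determinants with entries of modulus at most 1.\<close>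

lemma small_integer_solution:
  fixes A :: "(nat \<Rightarrow> real) set"
  assumes fin: "finite A" and entries: "\<And>a l. a \<in> A \<Longrightarrow> a l \<in> {-1, 0, 1}"
    and nonneg: "\<And>a. a \<in> A \<Longrightarrow> 0 \<le> row_dot d a w"
    and spans: "\<And>x. (\<And>a. a \<in> A \<Longrightarrow> row_dot d a x = 0) \<Longrightarrow> \<forall>l<d. x l = 0"
  obtains z where "\<And>l. l < d \<Longrightarrow> z l \<in> \<int>" "\<And>l. l < d \<Longrightarrow> \<bar>z l\<bar> \<le> fact d"
    "\<And>a. a \<in> A \<Longrightarrow> sgn (row_dot d a z) = sgn (row_dot d a w)"
proof -
  define rhs where "rhs a = (if row_dot d a w = 0 then 0 else 1 :: real)" for a
  define feas where "feas y \<longleftrightarrow> (\<forall>a\<in>A. if row_dot d a w = 0 then row_dot d a y = 0 else 1 \<le> row_dot d a y)" for y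
  define tight where "tight y = {a \<in> A. row_dot d a y = rhs a}" for y
  have row_dot_scale: "row_dot d a (\<lambda>l. s * x l) = s * row_dot d a x" for a s x
    by (simp add: row_dot_def sum_distrib_left algebra_simps)
  have row_dot_add: "row_dot d a (\<lambda>l. x l + s * y l) = row_dot d a x + s * row_dot d a y" for a s x y
    by (simp add: row_dot_def sum.distrib sum_distrib_left algebra_simps)
  have ex: "\<exists>y. feas y"
  proof -
    define S where "S = {row_dot d a w | a. a \<in> A \<and> row_dot d a w \<noteq> 0}"
    define s where "s = Min (insert 1 S)"
    have fS: "finite S" using fin by (simp add: S_def)
    have "0 < x" if "x \<in> insert 1 S" for x using that nonneg by (auto simp: S_def less_le)
    then have s: "0 < s" unfolding s_def using fS by (subst Min_gr_iff) auto
    have "s \<le> row_dot d a w" if "a \<in> A" "row_dot d a w \<noteq> 0" for a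
      unfolding s_def using fS that by (intro Min_le) (auto simp: S_def)
    \<comment> \<open>Dividing \<open>w\<close> by its smallest positive product raises all positive
      products to at least 1 and keeps the zeros.\<close>
    then have "feas (\<lambda>l. (1 / s) * w l)" using s unfolding feas_def row_dot_scale by (auto simp: pos_le_divide_eq)
    then show ?thesis by blast
  qed
  have "\<exists>y. feas y \<and> (\<forall>y'. feas y' \<longrightarrow> card (tight y') \<le> card (tight y))"
  proof -
    have "card (tight y) < Suc (card A)" for y
      unfolding less_Suc_eq_le using fin by (intro card_mono) (auto simp: tight_def)
    moreover obtain y0 where "feas y0" using ex by blast
    ultimately show ?thesis
      by (intro Lattices_Big.ex_has_greatest_nat[of feas y0 "\<lambda>y. card (tight y)" "Suc (card A)"]) auto
  qed
  then obtain y where y: "feas y" "\<And>y'. feas y' \<Longrightarrow> card (tight y') \<le> card (tight y)" by blast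
  \<comment> \<open>The tight rows must determine the vertex. Otherwise \<open>y\<close> can be
    moved along \<open>u\<close> or \<open>-u\<close> without disturbing the tight rows, until a
    further row becomes tight, contrary to the choice of \<open>y\<close>.\<close>
  have "\<forall>l<d. u l = 0" if u: "\<And>a. a \<in> tight y \<Longrightarrow> row_dot d a u = 0" for u
  proof (rule spans, rule ccontr)
    fix a assume a: "a \<in> A" "row_dot d a u \<noteq> 0"
    define u' where "u' = (if row_dot d a u < 0 then u else (\<lambda>l. -1 * u l))"
    have u': "row_dot d a u' < 0" "\<And>b. b \<in> tight y \<Longrightarrow> row_dot d b u' = 0"
      using a u row_dot_scale[of _ "-1" u] by (auto simp: u'_def)
    define F where "F = {b \<in> A. row_dot d b u' < 0}"
    have slack: "1 < row_dot d b y" "row_dot d b w \<noteq> 0" if "b \<in> F" for b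
    proof -
      have b: "b \<in> A" "b \<notin> tight y" using that u' by (auto simp: F_def)
      show "row_dot d b w \<noteq> 0" using b y(1) by (auto simp: feas_def tight_def rhs_def)
      with b y(1) show "1 < row_dot d b y" by (fastforce simp: feas_def tight_def rhs_def)
    qed
    define g where "g b = (row_dot d b y - 1) / - row_dot d b u'" for b
    have F: "finite F" "a \<in> F" using fin a u' by (auto simp: F_def)
    \<comment> \<open>The longest admissible step: at \<open>s\<close> the first of the decreasing
      rows in \<open>F\<close> reaches 1.\<close>
    define s where "s = Min (g ` F)"
    have "s \<in> g ` F" unfolding s_def using F by (intro Min_in) auto
    then obtain b where b: "b \<in> F" "s = g b" by blast
    have s_le: "s \<le> g b'" if "b' \<in> F" for b' unfolding s_def using F that by simp
    have s: "0 < s" using slack[OF b(1)] b unfolding g_def by (auto simp: F_def divide_pos_neg)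
    define y' where "y' = (\<lambda>l. y l + s * u' l)"
    have iy': "row_dot d c y' = row_dot d c y + s * row_dot d c u'" for c by (simp add: y'_def row_dot_add)
    have "feas y'"
      unfolding feas_def
    proof
      fix c assume c: "c \<in> A"
      show "if row_dot d c w = 0 then row_dot d c y' = 0 else 1 \<le> row_dot d c y'"
      proof (cases "row_dot d c w = 0")
        case True
        then have "c \<in> tight y" using c y(1) by (auto simp: feas_def tight_def rhs_def)
        then show ?thesis using True u'(2) c y(1) by (auto simp: iy' feas_def)
      next
        case False
        then have 1: "1 \<le> row_dot d c y" using c y(1) by (auto simp: feas_def)
        show ?thesis
        proof (cases "c \<in> F")
          case True
          then have "s * - row_dot d c u' \<le> row_dot d c y - 1"
            using s_le[OF True] True unfolding g_def by (subst (asm) pos_le_divide_eq) (auto simp: F_def)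
          then show ?thesis using False by (simp add: iy')
        next
          assume "c \<notin> F"
          then have "0 \<le> s * row_dot d c u'" using s c by (simp add: F_def)
          then show ?thesis using False 1 by (simp add: iy')
        qed
      qed
    qed
    moreover have "tight y \<subset> tight y'"
    proof
      show "tight y \<subseteq> tight y'" using u'(2) by (auto simp: tight_def iy')
      have bu: "row_dot d b u' < 0" and bA: "b \<in> A" using b by (auto simp: F_def)
      have "s * row_dot d b u' = 1 - row_dot d b y" unfolding b(2) g_def using bu by (simp add: field_simps)
      then have "row_dot d b y' = 1" by (simp add: iy')
      then have "b \<in> tight y'" using bA slack[OF b(1)] by (simp add: tight_def rhs_def)
      moreover have "b \<notin> tight y" using slack[OF b(1)] by (auto simp: tight_def rhs_def)
      ultimately show "tight y \<noteq> tight y'" by blast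
    qed
    then have "card (tight y) < card (tight y')" using fin by (intro psubset_card_mono) (auto simp: tight_def)
    ultimately show False using y(2)[of y'] by simp
  qed
  then have "\<exists>r. (\<forall>i<d. r i \<in> tight y) \<and> det (row_matrix d r) \<noteq> 0"
    by (rule nonsingular_rows)
  then obtain r where r: "\<And>i. i < d \<Longrightarrow> r i \<in> tight y" "det (row_matrix d r) \<noteq> 0" by blast
  let ?M = "row_matrix d r"
  have rA: "r i \<in> A" if "i < d" for i using r(1)[OF that] by (simp add: tight_def)
  have ry: "?M *\<^sub>v vec d y = vec d (\<lambda>i. rhs (r i))"
  proof (rule eq_vecI)
    fix i assume "i < dim_vec (vec d (\<lambda>i. rhs (r i)))"
    then show "(?M *\<^sub>v vec d y) $ i = vec d (\<lambda>i. rhs (r i)) $ i"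
      using row_matrix_mult[of i d r y] r(1)[of i] by (simp add: tight_def)
  qed (simp add: row_matrix_def)
  \<comment> \<open>Clearing denominators with the modulus of the determinant, not the determinant
    itself, keeps all signs.\<close>
  define z where "z l = \<bar>det ?M\<bar> * y l" for l
  have cramer: "det (replace_col ?M (vec d (\<lambda>i. rhs (r i))) l) = y l * det ?M" if "l < d" for l
    using cramer_lemma_mat[OF row_matrix_carrier, of "vec d y" d l r] that by (simp add: ry)
  have carrier: "replace_col ?M (vec d (\<lambda>i. rhs (r i))) l \<in> carrier_mat d d" for l
    by (simp add: replace_col_def row_matrix_def)
  \<comment> \<open>The right-hand side of the tight system consists of zeros and ones, so replacing
    a column by it keeps the entries in the range that the determinant bound requires.\<close>
  have entry: "replace_col ?M (vec d (\<lambda>i. rhs (r i))) l $$ (i, j) \<in> {-1, 0, 1}" if "i < d" "j < d" for i j l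
    using that entries[OF rA] by (auto simp: replace_col_def row_matrix_def rhs_def)
  show ?thesis
  proof (rule that[of z])
    fix l assume l: "l < d"
    have abs_z: "\<bar>z l\<bar> = \<bar>y l * det ?M\<bar>" by (simp add: z_def abs_mult)
    have e1: "\<bar>replace_col ?M (vec d (\<lambda>i. rhs (r i))) l $$ (i, j)\<bar> \<le> 1" if "i < d" "j < d" for i j
      using entry[OF that, of l] by auto
    show "\<bar>z l\<bar> \<le> fact d"
      unfolding abs_z cramer[OF l, symmetric] by (rule abs_det_le_fact[OF carrier e1])
    have e2: "replace_col ?M (vec d (\<lambda>i. rhs (r i))) l $$ (i, j) \<in> \<int>" if "i < d" "j < d" for i j
      using entry[OF that, of l] by auto
    have "y l * det ?M \<in> \<int>" unfolding cramer[OF l, symmetric] by (rule det_Ints[OF carrier e2])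
    then show "z l \<in> \<int>" by (simp add: z_def abs_if mult.commute)
  next
    fix a assume a: "a \<in> A"
    have "if row_dot d a w = 0 then row_dot d a y = 0 else 1 \<le> row_dot d a y"
      using y(1) a unfolding feas_def by blast
    then have "sgn (row_dot d a y) = sgn (row_dot d a w)"
      using nonneg[OF a] by (cases "row_dot d a w = 0") (simp_all add: sgn_if)
    then show "sgn (row_dot d a z) = sgn (row_dot d a w)"
      using r(2) unfolding z_def row_dot_scale by (simp add: sgn_mult)
  qed
qed

section \<open>Tables of separable convex functions\<close>

lemma sum_blocks:
  fixes h :: "nat \<Rightarrow> 'a :: comm_monoid_add"
  shows "(\<Sum>k<n * L. h k) = (\<Sum>i<n. \<Sum>j<L. h (i * L + j))"
proof -
  have "(\<Sum>k<n * L. h k) = (\<Sum>i<n. sum h {i * L..<i * L + L})" by (rule sum.nat_group[symmetric])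
  also have "\<dots> = (\<Sum>i<n. \<Sum>j<L. h (i * L + j))"
    by (rule sum.cong[OF refl], subst sum.atLeastLessThan_shift_0) (simp add: atLeast0LessThan)
  finally show ?thesis .
qed

lemma block_index_less: "i < n \<Longrightarrow> m < L \<Longrightarrow> i * L + m < n * (L :: nat)"
proof -
  assume "i < n" "m < L"
  then have "i * L + m < Suc i * L" by simp
  also have "\<dots> \<le> n * L" using \<open>i < n\<close> by (intro mult_right_mono) auto
  finally show ?thesis .
qed

text \<open>Piecewise linear interpolation written with hinge functions at the interior grid points
  \<open>1 - N\<close> to \<open>N - 1\<close>. Their coefficients are the second differences of the
  table, so that convexity on the whole line is just nonnegativity of these. For
  \<open>N = 0\<close> truncated subtraction leaves no hinge, and the function is affine.\<close>

definition interpolate :: "nat \<Rightarrow> (nat \<Rightarrow> real) \<Rightarrow> real \<Rightarrow> real" where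
  "interpolate N G x = G 0 + (G 1 - G 0) * (x + real N) +
     (\<Sum>j<2 * N - 1. (G (j + 2) - 2 * G (j + 1) + G j) * max 0 (x + real N - (real j + 1)))"

lemma interpolate_at: "m \<le> 2 * N \<Longrightarrow> interpolate N G (real m - real N) = G m"
proof (induction m)
  case 0
  have "max 0 (- real j - 1) = 0" for j by simp
  then show ?case by (simp add: interpolate_def)
next
  case (Suc m)
  let ?D = "\<lambda>j. G (j + 2) - 2 * G (j + 1) + G j"
  have tel: "(\<Sum>j<k. ?D j) = (G (Suc k) - G k) - (G 1 - G 0)" for k
    by (induction k) (simp_all add: numeral_2_eq_2)
  \<comment> \<open>From grid point \<open>m\<close> to the next one, hinge \<open>j\<close> grows
    by 1 if \<open>j < m\<close> and stays 0 otherwise. The second differences below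
    \<open>m\<close> then telescope to the slope of the table at \<open>m\<close>.\<close>
  have "interpolate N G (real (Suc m) - real N) - interpolate N G (real m - real N) =
      (G 1 - G 0) + (\<Sum>j<2 * N - 1. ?D j * (max 0 (real m - real j) - max 0 (real m - (real j + 1))))"
  proof -
    have "(\<Sum>j<2 * N - 1. ?D j * (max 0 (real m - real j) - max 0 (real m - (real j + 1)))) =
        (\<Sum>j<2 * N - 1. ?D j * max 0 (real m - real j)) - (\<Sum>j<2 * N - 1. ?D j * max 0 (real m - (real j + 1)))"
      by (simp only: sum_subtractf[symmetric] right_diff_distrib)
    moreover have "interpolate N G (real (Suc m) - real N) =
        G 0 + (G 1 - G 0) * (real m + 1) + (\<Sum>j<2 * N - 1. ?D j * max 0 (real m - real j))"
      unfolding interpolate_def by simp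
    moreover have "interpolate N G (real m - real N) =
        G 0 + (G 1 - G 0) * real m + (\<Sum>j<2 * N - 1. ?D j * max 0 (real m - (real j + 1)))"
      unfolding interpolate_def by (simp add: add.commute)
    moreover have "(G 1 - G 0) * (real m + 1) = (G 1 - G 0) * real m + (G 1 - G 0)" by (simp add: distrib_left)
    ultimately show ?thesis by linarith
  qed
  also have "(\<Sum>j<2 * N - 1. ?D j * (max 0 (real m - real j) - max 0 (real m - (real j + 1)))) =
      (\<Sum>j<2 * N - 1. if j < m then ?D j else 0)"
  proof (rule sum.cong)
    fix j
    have "max 0 (real m - real j) - max 0 (real m - (real j + 1)) = (if j < m then 1 else 0)" by auto
    then show "?D j * (max 0 (real m - real j) - max 0 (real m - (real j + 1))) = (if j < m then ?D j else 0)" by simp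
  qed simp
  also have "\<dots> = (\<Sum>j<m. if j < m then ?D j else 0)"
    using Suc.prems by (intro sum.mono_neutral_right) auto
  also have "\<dots> = (\<Sum>j<m. ?D j)" by simp
  finally show ?case using Suc tel[of m] by simp
qed

lemma interpolate_convex:
  assumes "\<And>j. j + 2 \<le> 2 * N \<Longrightarrow> 0 \<le> G (j + 2) - 2 * G (j + 1) + G j"
  shows "convex_on UNIV (interpolate N G)"
proof -
  have affine: "convex_on UNIV (\<lambda>x :: real. r + s * (x + t))" for r s t
  proof (rule convex_onI)
    fix u x y :: real
    have "r + s * (((1 - u) *\<^sub>R x + u *\<^sub>R y) + t) = (1 - u) * (r + s * (x + t)) + u * (r + s * (y + t))"
      by (simp add: algebra_simps)
    then show "r + s * (((1 - u) *\<^sub>R x + u *\<^sub>R y) + t) \<le> (1 - u) * (r + s * (x + t)) + u * (r + s * (y + t))"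
      by simp
  qed simp
  have max_le: "r = a + b \<Longrightarrow> a \<le> a' \<Longrightarrow> 0 \<le> a' \<Longrightarrow> b \<le> b' \<Longrightarrow> 0 \<le> b' \<Longrightarrow> max 0 r \<le> a' + b'"
    for r a b a' b' :: real by (auto simp: max_def)
  have hinge: "convex_on UNIV (\<lambda>x :: real. max 0 (x + t - s))" for s t
  proof (rule convex_onI)
    fix u x y :: real assume u: "0 < u" "u < 1"
    have "(1 - u) *\<^sub>R x + u *\<^sub>R y + t - s = (1 - u) * (x + t - s) + u * (y + t - s)" by (simp add: algebra_simps)
    moreover have "(1 - u) * (x + t - s) \<le> (1 - u) * max 0 (x + t - s)" "0 \<le> (1 - u) * max 0 (x + t - s)"
      "u * (y + t - s) \<le> u * max 0 (y + t - s)" "0 \<le> u * max 0 (y + t - s)"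
      using u by (intro mult_left_mono mult_nonneg_nonneg; simp)+
    ultimately show "max 0 ((1 - u) *\<^sub>R x + u *\<^sub>R y + t - s) \<le> (1 - u) * max 0 (x + t - s) + u * max 0 (y + t - s)"
      by (rule max_le)
  qed simp
  have "convex_on UNIV (\<lambda>x. \<Sum>j<k. (G (j + 2) - 2 * G (j + 1) + G j) * max 0 (x + real N - (real j + 1)))"
    if "k \<le> 2 * N - 1" for k
    using that
  proof (induction k)
    case 0
    show ?case by (simp add: convex_on_const)
  next
    case (Suc k)
    have "0 \<le> G (k + 2) - 2 * G (k + 1) + G k" using Suc.prems by (intro assms) simp
    then have "convex_on UNIV (\<lambda>x. (G (k + 2) - 2 * G (k + 1) + G k) * max 0 (x + real N - (real k + 1)))"
      by (rule convex_on_cmul[OF _ hinge])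
    moreover have "convex_on UNIV (\<lambda>x. \<Sum>j<k. (G (j + 2) - 2 * G (j + 1) + G j) * max 0 (x + real N - (real j + 1)))"
      using Suc.prems by (intro Suc.IH) simp
    ultimately show ?case unfolding sum.lessThan_Suc by (rule convex_on_add[rotated])
  qed
  then have "convex_on UNIV (\<lambda>x. \<Sum>j<2 * N - 1. (G (j + 2) - 2 * G (j + 1) + G j) * max 0 (x + real N - (real j + 1)))"
    by blast
  from convex_on_add[OF affine[of "G 0" "G 1 - G 0" "real N"] this] show ?thesis
    by (simp only: interpolate_def[abs_def])
qed

lemma int_box_points:
  assumes "x \<in> int_box n N"
  obtains p where "\<And>i. i < n \<Longrightarrow> p i \<le> 2 * N" "\<And>i. i < n \<Longrightarrow> x i = real (p i) - real N"
proof -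
  have "\<exists>m \<le> 2 * N. x i = real m - real N" if "i < n" for i
  proof -
    have "x i \<in> real_of_int ` {- int N..int N}" using assms that unfolding int_box_def by (auto dest: PiE_mem)
    then obtain z where "z \<in> {- int N..int N}" "x i = real_of_int z" by blast
    then show ?thesis by (intro exI[of _ "nat (z + int N)"]) auto
  qed
  then obtain p where "\<And>i. i < n \<Longrightarrow> p i \<le> 2 * N \<and> x i = real (p i) - real N" by metis
  then show ?thesis using that by blast
qed

lemma int_box_subset_Rn: "int_box n N \<subseteq> Rn n"
  unfolding int_box_def by (auto simp: PiE_iff)

lemma finite_int_box: "finite (int_box n N)"
  unfolding int_box_def by (intro finite_PiE) auto

lemma int_box_nonempty: "int_box n N \<noteq> {}"
  unfolding int_box_def by (auto simp: PiE_eq_empty_iff)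

lemma convex_second_difference:
  assumes "convex_on UNIV (h :: real \<Rightarrow> real)"
  shows "0 \<le> h (x + 2) - 2 * h (x + 1) + h x"
proof -
  have "h ((1 - 1 / 2) *\<^sub>R x + (1 / 2) *\<^sub>R (x + 2)) \<le> (1 - 1 / 2) * h x + (1 / 2) * h (x + 2)"
    by (rule convex_onD[OF assms]) auto
  moreover have "(1 - 1 / 2) *\<^sub>R x + (1 / 2) *\<^sub>R (x + 2) = x + 1" by (simp add: field_simps)
  ultimately show ?thesis by simp
qed

definition table :: "nat \<Rightarrow> (nat \<Rightarrow> real \<Rightarrow> real) \<Rightarrow> nat \<Rightarrow> nat \<Rightarrow> real" where
  "table N fs i m = fs i (real m - real N)"

lemma table_second_difference:
  assumes "convex_on UNIV (fs i)"
  shows "0 \<le> table N fs i (j + 2) - 2 * table N fs i (j + 1) + table N fs i j"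
proof -
  have "real (j + 2) - real N = (real j - real N) + 2" "real (j + 1) - real N = (real j - real N) + 1" by simp_all
  then show ?thesis unfolding table_def using convex_second_difference[OF assms, of "real j - real N"] by (simp only:)
qed

text \<open>The common interface of both constructions. Points of the box appear as index vectors
  \<open>p\<close> and \<open>q\<close>, and \<open>B\<close> bounds differences of sums instead of
  single entries, as \<open>max_diff\<close> does.\<close>

definition reduces_table :: "nat \<Rightarrow> nat \<Rightarrow> (nat \<Rightarrow> nat \<Rightarrow> real) \<Rightarrow> (nat \<Rightarrow> nat \<Rightarrow> real) \<Rightarrow> real \<Rightarrow> bool" where
  "reduces_table n N F G B \<longleftrightarrow> (\<forall>i<n. \<forall>m\<le>2 * N. G i m \<in> \<int>) \<and>
     (\<forall>i<n. \<forall>j. j + 2 \<le> 2 * N \<longrightarrow> 0 \<le> G i (j + 2) - 2 * G i (j + 1) + G i j) \<and>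
     (\<forall>p q. (\<forall>i<n. p i \<le> 2 * N) \<longrightarrow> (\<forall>i<n. q i \<le> 2 * N) \<longrightarrow>
       sgn ((\<Sum>i<n. G i (p i)) - (\<Sum>i<n. G i (q i))) = sgn ((\<Sum>i<n. F i (p i)) - (\<Sum>i<n. F i (q i))) \<and>
       \<bar>(\<Sum>i<n. G i (p i)) - (\<Sum>i<n. G i (q i))\<bar> \<le> B)"

lemma equivalent_from_table:
  fixes G :: "nat \<Rightarrow> nat \<Rightarrow> real" and n N :: nat
  defines "gs \<equiv> \<lambda>i. interpolate N (G i)"
  defines "g \<equiv> \<lambda>x. \<Sum>i<n. gs i (x i)"
  assumes f: "separable_convex_by n fs f"
    and red: "reduces_table n N (table N fs) G B"
  shows "separable_convex_by n gs g" "equivalent_on (int_box n N) f g" "\<forall>x\<in>int_box n N. g x \<in> \<int>"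
    "max_diff g (int_box n N) \<le> B" "\<And>i m. m < 2 * N + 1 \<Longrightarrow> gs i (real m - real N) = G i m"
proof -
  have int: "G i m \<in> \<int>" if "i < n" "m \<le> 2 * N" for i m using red that by (simp add: reduces_table_def)
  have convex: "0 \<le> G i (j + 2) - 2 * G i (j + 1) + G i j" if "i < n" "j + 2 \<le> 2 * N" for i j
    using red[unfolded reduces_table_def, THEN conjunct2, THEN conjunct1] that by blast
  have sums: "sgn ((\<Sum>i<n. G i (p i)) - (\<Sum>i<n. G i (q i))) =
      sgn ((\<Sum>i<n. table N fs i (p i)) - (\<Sum>i<n. table N fs i (q i)))"
    "\<bar>(\<Sum>i<n. G i (p i)) - (\<Sum>i<n. G i (q i))\<bar> \<le> B" if "\<forall>i<n. p i \<le> 2 * N" "\<forall>i<n. q i \<le> 2 * N" for p q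
    using red[unfolded reduces_table_def, THEN conjunct2, THEN conjunct2, THEN spec, of p, THEN spec, of q,
      THEN mp, OF that(1), THEN mp, OF that(2)] by simp_all
  show gs: "gs i (real m - real N) = G i m" if "m < 2 * N + 1" for i m
    unfolding gs_def using that by (intro interpolate_at) simp
  show "separable_convex_by n gs g"
    using interpolate_convex[of N "G _"] convex by (auto simp: separable_convex_by_def g_def gs_def)
  have fx: "f x = (\<Sum>i<n. table N fs i (p i))" if "x \<in> int_box n N" "\<And>i. i < n \<Longrightarrow> x i = real (p i) - real N" for x p
    using f int_box_subset_Rn that by (force simp: separable_convex_by_def table_def)
  have gx: "g x = (\<Sum>i<n. G i (p i))"
    if "\<And>i. i < n \<Longrightarrow> p i \<le> 2 * N" "\<And>i. i < n \<Longrightarrow> x i = real (p i) - real N" for x p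
    unfolding g_def using that gs by (intro sum.cong) (auto simp: less_Suc_eq_le)
  show "equivalent_on (int_box n N) f g"
    unfolding equivalent_on_def
  proof (intro ballI)
    fix x y assume x: "x \<in> int_box n N" and y: "y \<in> int_box n N"
    obtain p where p: "\<And>i. i < n \<Longrightarrow> p i \<le> 2 * N" "\<And>i. i < n \<Longrightarrow> x i = real (p i) - real N"
      using int_box_points[OF x] by blast
    obtain q where q: "\<And>i. i < n \<Longrightarrow> q i \<le> 2 * N" "\<And>i. i < n \<Longrightarrow> y i = real (q i) - real N"
      using int_box_points[OF y] by blast
    have "sgn (g x - g y) = sgn (f x - f y)"
      using sums(1)[of p q] p(1) q(1) fx[of x p, OF x p(2)] fx[of y q, OF y q(2)] gx[of p x, OF p] gx[of q y, OF q] by simp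
    then show "f y \<le> f x \<longleftrightarrow> g y \<le> g x" by (auto simp: sgn_if split: if_splits)
  qed
  show "\<forall>x\<in>int_box n N. g x \<in> \<int>"
  proof
    fix x assume x: "x \<in> int_box n N"
    obtain p where p: "\<And>i. i < n \<Longrightarrow> p i \<le> 2 * N" "\<And>i. i < n \<Longrightarrow> x i = real (p i) - real N"
      using int_box_points[OF x] by blast
    have "g x = (\<Sum>i<n. G i (p i))" using p by (rule gx)
    then show "g x \<in> \<int>" using int p(1) by (auto intro!: Ints_sum)
  qed
  have "\<bar>g x - g y\<bar> \<le> B" if x: "x \<in> int_box n N" and y: "y \<in> int_box n N" for x y
  proof -
    obtain p where p: "\<And>i. i < n \<Longrightarrow> p i \<le> 2 * N" "\<And>i. i < n \<Longrightarrow> x i = real (p i) - real N"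
      using int_box_points[OF x] by blast
    obtain q where q: "\<And>i. i < n \<Longrightarrow> q i \<le> 2 * N" "\<And>i. i < n \<Longrightarrow> y i = real (q i) - real N"
      using int_box_points[OF y] by blast
    show ?thesis using sums(2)[of p q] p(1) q(1) gx[of p x, OF p] gx[of q y, OF q] by simp
  qed
  then show "max_diff g (int_box n N) \<le> B"
    unfolding max_diff_def using finite_int_box int_box_nonempty by (subst Max_le_iff) auto
qed

section \<open>The existential bound\<close>

lemma abs_row_dot_le:
  assumes "\<And>l. l < d \<Longrightarrow> \<bar>a l\<bar> \<le> 1" "\<And>l. l < d \<Longrightarrow> \<bar>z l\<bar> \<le> B"
  shows "\<bar>row_dot d a z\<bar> \<le> d * B"
proof -
  have "\<bar>row_dot d a z\<bar> \<le> (\<Sum>l<d. \<bar>a l * z l\<bar>)" unfolding row_dot_def by (rule sum_abs)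
  also have "\<dots> \<le> (\<Sum>l<d. 1 * B)"
    unfolding abs_mult using assms by (intro sum_mono mult_mono) auto
  finally show ?thesis by simp
qed

text \<open>For every sign vector \<open>a\<close>, either \<open>a\<close> or \<open>-a\<close> has
  a nonnegative product with \<open>u\<close>, so keeping only the nonnegative ones loses no
  condition. Unit vectors, up to sign, are among them and supply the spanning property. Fixing the
  value 0 outside the first \<open>d\<close> coordinates makes the set finite.\<close>

lemma small_integer_weights:
  obtains z where "\<And>l. l < d \<Longrightarrow> z l \<in> \<int>" "\<And>l. l < d \<Longrightarrow> \<bar>z l\<bar> \<le> fact d"
    "\<And>a. (\<And>l. l < d \<Longrightarrow> a l \<in> {-1, 0, 1}) \<Longrightarrow> sgn (row_dot d a z) = sgn (row_dot d a u)"
proof -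
  define S where "S = {a :: nat \<Rightarrow> real. \<forall>l. (l \<in> {..<d} \<longrightarrow> a l \<in> {-1, 0, 1}) \<and> (l \<notin> {..<d} \<longrightarrow> a l = 0)}"
  define A where "A = {a \<in> S. 0 \<le> row_dot d a u}"
  have "finite S" unfolding S_def by (rule finite_set_of_finite_funs) auto
  then have "finite A" by (simp add: A_def)
  have neg: "row_dot d (\<lambda>l. - a l) x = - row_dot d a x" for a x by (simp add: row_dot_def sum_negf)
  have A_or: "a \<in> A \<or> (\<lambda>l. - a l) \<in> A" if "a \<in> S" for a
    using that by (auto simp: A_def neg S_def)
  have "\<forall>l<d. x l = 0" if x: "\<And>a. a \<in> A \<Longrightarrow> row_dot d a x = 0" for x
  proof (intro allI impI)
    fix l assume l: "l < d"
    have "(\<lambda>k. if k = l then 1 else 0) \<in> S" using l by (auto simp: S_def)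
    from A_or[OF this] have "row_dot d (\<lambda>k. if k = l then 1 else 0) x = 0"
      using x[of "\<lambda>k. if k = l then 1 else 0"] x[of "\<lambda>k. - (if k = l then 1 else 0)"] unfolding neg by auto
    then show "x l = 0" using l by (simp add: row_dot_def if_distrib[of "\<lambda>t. t * _"] cong: if_cong)
  qed
  moreover have "a l \<in> {-1, 0, 1}" if "a \<in> A" for a l using that by (cases "l < d") (auto simp: A_def S_def)
  moreover have "0 \<le> row_dot d a u" if "a \<in> A" for a using that by (simp add: A_def)
  ultimately obtain z where z: "\<And>l. l < d \<Longrightarrow> z l \<in> \<int>" "\<And>l. l < d \<Longrightarrow> \<bar>z l\<bar> \<le> fact d"
    "\<And>a. a \<in> A \<Longrightarrow> sgn (row_dot d a z) = sgn (row_dot d a u)"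
    using small_integer_solution[OF \<open>finite A\<close>, of d u] by blast
  show ?thesis
  proof (rule that[OF z(1,2)])
    fix a :: "nat \<Rightarrow> real" assume a: "\<And>l. l < d \<Longrightarrow> a l \<in> {-1, 0, 1}"
    define a' where "a' l = (if l < d then a l else 0)" for l
    have eq: "row_dot d a' x = row_dot d a x" for x by (simp add: row_dot_def a'_def)
    have "a' \<in> S" using a by (auto simp: S_def a'_def)
    from A_or[OF this] show "sgn (row_dot d a z) = sgn (row_dot d a u)"
      using z(3)[of a'] z(3)[of "\<lambda>l. - a' l"] by (auto simp: neg eq sgn_minus)
  qed
qed

text \<open>In terms of the \<open>d = 2nN\<close> slopes, a difference between two points is a
  difference of prefix sums, with coefficients in \<open>{-1, 0, 1}\<close>, and convexity compares
  neighbouring slopes, again with such coefficients. The resulting values differ by at most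
  \<open>d * d!\<close>, which is at most \<open>d ^ Suc d\<close>.\<close>

lemma small_table:
  fixes F :: "nat \<Rightarrow> nat \<Rightarrow> real"
  assumes F: "\<And>i j. i < n \<Longrightarrow> 0 \<le> F i (j + 2) - 2 * F i (j + 1) + F i j" and nN: "2 \<le> n" "1 \<le> N"
  shows "\<exists>G. reduces_table n N F G (real ((n\<^sup>2 * N) ^ (n * (2 * N + 1) + 1)))"
proof -
  define L where "L = 2 * N"
  have L: "0 < L" using nN by (simp add: L_def)
  define d where "d = n * L"
  define u where "u k = F (k div L) (Suc (k mod L)) - F (k div L) (k mod L)" for k
  obtain z where z: "\<And>l. l < d \<Longrightarrow> z l \<in> \<int>" "\<And>l. l < d \<Longrightarrow> \<bar>z l\<bar> \<le> fact d"
    "\<And>a. (\<And>l. l < d \<Longrightarrow> a l \<in> {-1, 0, 1}) \<Longrightarrow> sgn (row_dot d a z) = sgn (row_dot d a u)"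
    using small_integer_weights[of d u] by blast
  define G where "G i m = (\<Sum>j<m. z (i * L + j))" for i m
  have index: "i * L + j < d" if "i < n" "j < L" for i j unfolding d_def using that by (rule block_index_less)
  define step where "step p q k = (if k mod L < p (k div L) then 1 else 0) - (if k mod L < q (k div L) then 1 else 0 :: real)"
    for p q :: "nat \<Rightarrow> nat" and k
  have prefix: "(\<Sum>j<L. (if j < m then 1 else 0) * x j) = (\<Sum>j<m. x j)" if "m \<le> L" for m and x :: "nat \<Rightarrow> real"
  proof -
    have "(\<Sum>j<L. (if j < m then 1 else 0) * x j) = (\<Sum>j<m. (if j < m then 1 else 0) * x j)"
      using that by (intro sum.mono_neutral_right) auto
    then show ?thesis by simp
  qed
  have row_step: "row_dot d (step p q) x = (\<Sum>i<n. (\<Sum>j<p i. x (i * L + j)) - (\<Sum>j<q i. x (i * L + j)))"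
    if "\<And>i. i < n \<Longrightarrow> p i \<le> L" "\<And>i. i < n \<Longrightarrow> q i \<le> L" for p q x
  proof -
    have "row_dot d (step p q) x = (\<Sum>i<n. \<Sum>j<L. step p q (i * L + j) * x (i * L + j))"
      unfolding row_dot_def d_def by (rule sum_blocks)
    also have "\<dots> = (\<Sum>i<n. (\<Sum>j<L. (if j < p i then 1 else 0) * x (i * L + j)) - (\<Sum>j<L. (if j < q i then 1 else 0) * x (i * L + j)))"
    proof (rule sum.cong)
      fix i assume "i \<in> {..<n}"
      have "(\<Sum>j<L. step p q (i * L + j) * x (i * L + j)) =
          (\<Sum>j<L. (if j < p i then 1 else 0) * x (i * L + j) - (if j < q i then 1 else 0) * x (i * L + j))"
        by (rule sum.cong) (auto simp: step_def)
      then show "(\<Sum>j<L. step p q (i * L + j) * x (i * L + j)) =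
          (\<Sum>j<L. (if j < p i then 1 else 0) * x (i * L + j)) - (\<Sum>j<L. (if j < q i then 1 else 0) * x (i * L + j))"
        by (simp only: sum_subtractf)
    qed simp
    also have "\<dots> = (\<Sum>i<n. (\<Sum>j<p i. x (i * L + j)) - (\<Sum>j<q i. x (i * L + j)))"
    proof (rule sum.cong)
      fix i assume "i \<in> {..<n}"
      then have "p i \<le> L" "q i \<le> L" using that by auto
      then show "(\<Sum>j<L. (if j < p i then 1 else 0) * x (i * L + j)) - (\<Sum>j<L. (if j < q i then 1 else 0) * x (i * L + j))
          = (\<Sum>j<p i. x (i * L + j)) - (\<Sum>j<q i. x (i * L + j))" by (simp only: prefix)
    qed simp
    finally show ?thesis .
  qed
  have Fu: "(\<Sum>j<m. u (i * L + j)) = F i m - F i 0" if "m \<le> L" for i m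
    using that
  proof (induction m)
    case (Suc m)
    then have "(i * L + m) div L = i" "(i * L + m) mod L = m" by simp_all
    then show ?case using Suc by (simp add: u_def)
  qed simp
  have step_values: "step p q l \<in> {-1, 0, 1}" for p q l by (simp add: step_def)
  have Gd: "(\<Sum>i<n. G i (p i)) - (\<Sum>i<n. G i (q i)) = row_dot d (step p q) z"
    and Fd: "(\<Sum>i<n. F i (p i)) - (\<Sum>i<n. F i (q i)) = row_dot d (step p q) u"
    if "\<forall>i<n. p i \<le> 2 * N" "\<forall>i<n. q i \<le> 2 * N" for p q
  proof -
    have pq: "\<And>i. i < n \<Longrightarrow> p i \<le> L" "\<And>i. i < n \<Longrightarrow> q i \<le> L" unfolding L_def using that by blast+
    show "(\<Sum>i<n. G i (p i)) - (\<Sum>i<n. G i (q i)) = row_dot d (step p q) z"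
    proof -
      have "row_dot d (step p q) z = (\<Sum>i<n. (\<Sum>j<p i. z (i * L + j)) - (\<Sum>j<q i. z (i * L + j)))"
        using pq by (rule row_step)
      then show ?thesis unfolding G_def by (simp only: sum_subtractf)
    qed
    show "(\<Sum>i<n. F i (p i)) - (\<Sum>i<n. F i (q i)) = row_dot d (step p q) u"
    proof -
      have "(\<Sum>i<n. F i (p i) - F i (q i)) = (\<Sum>i<n. (\<Sum>j<p i. u (i * L + j)) - (\<Sum>j<q i. u (i * L + j)))"
      proof (rule sum.cong)
        fix i assume "i \<in> {..<n}"
        then have "p i \<le> L" "q i \<le> L" using pq by auto
        then show "F i (p i) - F i (q i) = (\<Sum>j<p i. u (i * L + j)) - (\<Sum>j<q i. u (i * L + j))"
          by (simp only: Fu)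
      qed simp
      moreover have "row_dot d (step p q) u = (\<Sum>i<n. (\<Sum>j<p i. u (i * L + j)) - (\<Sum>j<q i. u (i * L + j)))"
        using pq by (rule row_step)
      ultimately show ?thesis by (simp only: sum_subtractf)
    qed
  qed
  have "reduces_table n N F G (real ((n\<^sup>2 * N) ^ (n * (2 * N + 1) + 1)))"
    unfolding reduces_table_def
  proof (intro conjI allI impI)
    fix i m assume "i < n" "m \<le> 2 * N"
    then have "i * L + j < d" if "j < m" for j using that by (intro index) (simp_all add: L_def)
    then show "G i m \<in> \<int>" unfolding G_def by (intro Ints_sum z(1)) simp
  next
    fix p q :: "nat \<Rightarrow> nat" assume pq: "\<forall>i<n. p i \<le> 2 * N" "\<forall>i<n. q i \<le> 2 * N"
    show "sgn ((\<Sum>i<n. G i (p i)) - (\<Sum>i<n. G i (q i))) = sgn ((\<Sum>i<n. F i (p i)) - (\<Sum>i<n. F i (q i)))"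
      using z(3)[of "step p q", OF step_values] by (simp only: Gd[of p q, OF pq] Fd[of p q, OF pq])
    have "\<bar>row_dot d (step p q) z\<bar> \<le> real d * fact d"
      using z(2) by (intro abs_row_dot_le) (auto simp: step_def)
    also have "\<dots> \<le> real (d ^ Suc d)" using fact_le_power[of d, where 'a = real] by (simp add: mult_left_mono)
    also have "d ^ Suc d \<le> (n\<^sup>2 * N) ^ (n * (2 * N + 1) + 1)"
    proof -
      \<comment> \<open>Here \<open>2 \<le> n\<close> enters: \<open>2nN\<close> is at most
        \<open>n * n * N\<close>. One variable therefore gets a construction of its own.\<close>
      have "d \<le> n\<^sup>2 * N" using nN by (simp add: d_def L_def power2_eq_square)
      then have "d ^ Suc d \<le> (n\<^sup>2 * N) ^ Suc d" by (rule power_mono) simp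
      also have "\<dots> \<le> (n\<^sup>2 * N) ^ (n * (2 * N + 1) + 1)"
        using nN by (intro power_increasing) (auto simp: d_def L_def)
      finally show ?thesis .
    qed
    finally show "\<bar>(\<Sum>i<n. G i (p i)) - (\<Sum>i<n. G i (q i))\<bar> \<le> real ((n\<^sup>2 * N) ^ (n * (2 * N + 1) + 1))"
      by (simp only: Gd[of p q, OF pq])
  next
    fix i j assume i: "i < n" and j: "j + 2 \<le> 2 * N"
    define a where "a k = (if k = i * L + Suc j then 1 else if k = i * L + j then -1 else 0 :: real)" for k
    have k: "i * L + j < d" "i * L + Suc j < d" using index[OF i, of j] index[OF i, of "Suc j"] j by (simp_all add: L_def)
    have a: "row_dot d a x = x (i * L + Suc j) - x (i * L + j)" for x
    proof -
      have "row_dot d a x = (\<Sum>k\<in>{i * L + j, i * L + Suc j}. a k * x k)"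
        unfolding row_dot_def using k by (intro sum.mono_neutral_right) (auto simp: a_def)
      then show ?thesis by (simp add: a_def)
    qed
    have jL: "j < L" "Suc j < L" using j by (auto simp: L_def)
    have "row_dot d a u = F i (j + 2) - 2 * F i (j + 1) + F i j"
    proof -
      have "(i * L + t) div L = i" "(i * L + t) mod L = t" if "t < L" for t using that by simp_all
      from this[OF jL(1)] this[OF jL(2)] show ?thesis unfolding a u_def by simp
    qed
    then have "0 \<le> row_dot d a u" using F[OF i, of j] by linarith
    moreover have "sgn (row_dot d a z) = sgn (row_dot d a u)" by (rule z(3)) (simp add: a_def)
    ultimately have "0 \<le> row_dot d a z" by (metis sgn_less linorder_not_less)
    then show "0 \<le> G i (j + 2) - 2 * G i (j + 1) + G i j"
      unfolding a by (simp add: G_def)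
  qed
  then show ?thesis by blast
qed

text \<open>The rank of a value is the number of distinct smaller values in the table. With powers
  of 2, a strictly larger \<open>F\<close> means an at least doubled \<open>G\<close>, so one larger
  neighbour already makes the second difference of \<open>G\<close> nonnegative.\<close>

lemma univariate_table:
  fixes F :: "nat \<Rightarrow> real"
  assumes F: "\<And>j. 0 \<le> F (j + 2) - 2 * F (j + 1) + F j"
  obtains G :: "nat \<Rightarrow> real" where "\<And>m. G m \<in> \<int>"
    "\<And>p q. p \<le> 2 * N \<Longrightarrow> q \<le> 2 * N \<Longrightarrow> sgn (G p - G q) = sgn (F p - F q)"
    "\<And>j. j + 2 \<le> 2 * N \<Longrightarrow> 0 \<le> G (j + 2) - 2 * G (j + 1) + G j"
    "\<And>p q. p \<le> 2 * N \<Longrightarrow> q \<le> 2 * N \<Longrightarrow> \<bar>G p - G q\<bar> \<le> 2 ^ (2 * N)"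
proof -
  define R where "R m = {v \<in> F ` {..2 * N}. v < F m}" for m
  define G where "G m = (2 :: real) ^ card (R m)" for m
  have fin: "finite (R m)" for m by (simp add: R_def)
  have less: "card (R p) < card (R q)" if "F p < F q" "p \<le> 2 * N" for p q
    using that by (intro psubset_card_mono fin) (force simp: R_def)
  have eq: "R p = R q" if "F p = F q" for p q using that by (simp add: R_def)
  have card_le: "card (R m) \<le> 2 * N" if "m \<le> 2 * N" for m
  proof -
    have "card (R m) < card (F ` {..2 * N})" using that by (intro psubset_card_mono) (auto simp: R_def)
    also have "\<dots> \<le> Suc (2 * N)" using card_image_le[of "{..2 * N}" F] by simp
    finally show ?thesis by simp
  qed
  have double: "2 * G p \<le> G q" if "F p < F q" "p \<le> 2 * N" for p q
  proof -
    have "2 * G p = 2 ^ Suc (card (R p))" by (simp add: G_def)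
    also have "\<dots> \<le> G q" unfolding G_def using less[OF that] by (intro power_increasing) auto
    finally show ?thesis .
  qed
  have pos: "0 < G m" for m by (simp add: G_def)
  show ?thesis
  proof (rule that[of G])
    show "G m \<in> \<int>" for m by (simp add: G_def)
    show "sgn (G p - G q) = sgn (F p - F q)" if "p \<le> 2 * N" "q \<le> 2 * N" for p q
    proof (cases "F p" "F q" rule: linorder_cases)
      case equal
      then show ?thesis using eq[OF equal] by (simp add: G_def)
    next
      case less
      then show ?thesis using double[OF less that(1)] pos[of p] by simp
    next
      case greater
      then show ?thesis using double[OF greater that(2)] pos[of q] by simp
    qed
    show "0 \<le> G (j + 2) - 2 * G (j + 1) + G j" if j: "j + 2 \<le> 2 * N" for j
    proof -
      \<comment> \<open>The two increments away from the middle value have a nonnegative sum, so one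
        of them is positive or both are 0.\<close>
      consider "F (j + 1) < F (j + 2)" | "F (j + 1) < F j" | "F (j + 2) = F (j + 1)" "F j = F (j + 1)"
        using F[of j] by linarith
      then show ?thesis
      proof cases
        case 1
        then show ?thesis using double[OF 1] j pos[of j] by simp
      next
        case 2
        then show ?thesis using double[OF 2] j pos[of "j + 2"] by simp
      next
        case 3
        then have "R (j + 2) = R (j + 1)" "R j = R (j + 1)" using eq[OF 3(1)] eq[OF 3(2)] by simp_all
        then show ?thesis by (simp add: G_def)
      qed
    qed
    show "\<bar>G p - G q\<bar> \<le> 2 ^ (2 * N)" if "p \<le> 2 * N" "q \<le> 2 * N" for p q
    proof -
      have "G m \<le> 2 ^ (2 * N)" if "m \<le> 2 * N" for m
        unfolding G_def using card_le[OF that] by (intro power_increasing) auto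
      from this[OF that(1)] this[OF that(2)] show ?thesis using pos[of p] pos[of q] by linarith
    qed
  qed
qed

lemma exists_small_equivalent:
  assumes f: "separable_convex_by n fs f"
  shows "\<exists>g. separable_convex n g \<and> equivalent_on (int_box n N) f g \<and> (\<forall>x\<in>int_box n N. g x \<in> \<int>) \<and>
    ((n, N) \<noteq> (1, 1) \<longrightarrow> max_diff g (int_box n N) \<le> real ((n\<^sup>2 * N) ^ (n * (2 * N + 1) + 1)))"
proof -
  have conv: "0 \<le> table N fs i (j + 2) - 2 * table N fs i (j + 1) + table N fs i j" if "i < n" for i j
    using f that by (intro table_second_difference) (auto simp: separable_convex_by_def)
  let ?B = "real ((n\<^sup>2 * N) ^ (n * (2 * N + 1) + 1))"
  have "\<exists>G B. reduces_table n N (table N fs) G B \<and> ((n, N) \<noteq> (1, 1) \<longrightarrow> B \<le> ?B)"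
  proof -
    \<comment> \<open>In the first case the box is a single point and a zero table does. For
      \<open>n = 1\<close> the bound is \<open>N ^ (2 * N + 2)\<close>, which majorises
      \<open>2 ^ (2 * N)\<close> once \<open>2 \<le> N\<close>; for \<open>n = N = 1\<close> the
      same table is used, without the estimate.\<close>
    consider "n = 0 \<or> N = 0" | "n = 1" "1 \<le> N" | "2 \<le> n" "1 \<le> N" by linarith
    then show ?thesis
    proof cases
      case 1
      have "reduces_table n N (table N fs) (\<lambda>_ _. 0) 0"
        unfolding reduces_table_def
      proof (intro conjI allI impI)
        fix p q :: "nat \<Rightarrow> nat" assume "\<forall>i<n. p i \<le> 2 * N" "\<forall>i<n. q i \<le> 2 * N"
        then have "p i = q i" if "i < n" for i using 1 that by auto
        then have "(\<Sum>i<n. table N fs i (p i)) = (\<Sum>i<n. table N fs i (q i))" by (intro sum.cong) auto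
        then show "sgn ((\<Sum>i<n. 0 :: real) - (\<Sum>i<n. 0)) = sgn ((\<Sum>i<n. table N fs i (p i)) - (\<Sum>i<n. table N fs i (q i)))"
          by (simp only: diff_self)
      qed simp_all
      then show ?thesis by (intro exI[of _ "\<lambda>_ _. 0"] exI[of _ 0]) simp
    next
      case 2
      obtain G :: "nat \<Rightarrow> real" where G: "\<And>m. G m \<in> \<int>"
        "\<And>p q. p \<le> 2 * N \<Longrightarrow> q \<le> 2 * N \<Longrightarrow> sgn (G p - G q) = sgn (table N fs 0 p - table N fs 0 q)"
        "\<And>j. j + 2 \<le> 2 * N \<Longrightarrow> 0 \<le> G (j + 2) - 2 * G (j + 1) + G j"
        "\<And>p q. p \<le> 2 * N \<Longrightarrow> q \<le> 2 * N \<Longrightarrow> \<bar>G p - G q\<bar> \<le> 2 ^ (2 * N)"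
        using univariate_table[of "table N fs 0" N] conv[of 0] 2 by auto
      have "(2 :: real) ^ (2 * N) \<le> ?B" if "(n, N) \<noteq> (1, 1)"
      proof -
        have N: "2 \<le> N" using that 2 by auto
        have "(2 :: nat) ^ (2 * N) \<le> N ^ (2 * N)" using N by (rule power_mono) simp
        also have "\<dots> \<le> N ^ (2 * N + 2)" using N by (intro power_increasing) auto
        finally have "(2 :: nat) ^ (2 * N) \<le> (n\<^sup>2 * N) ^ (n * (2 * N + 1) + 1)" using 2 by simp
        then have "real (2 ^ (2 * N)) \<le> ?B" by (rule of_nat_mono)
        then show ?thesis by simp
      qed
      moreover have "reduces_table n N (table N fs) (\<lambda>_. G) (2 ^ (2 * N))"
        unfolding reduces_table_def 2(1) using G by simp
      ultimately show ?thesis by (intro exI[of _ "\<lambda>_. G"] exI[of _ "2 ^ (2 * N)"] conjI impI)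
    next
      case 3
      have "\<exists>G. reduces_table n N (table N fs) G ?B" by (rule small_table[OF conv 3])
      then obtain G where "reduces_table n N (table N fs) G ?B" ..
      then show ?thesis by (intro exI[of _ G] exI[of _ ?B]) simp
    qed
  qed
  then obtain G B where G: "reduces_table n N (table N fs) G B" "(n, N) \<noteq> (1, 1) \<longrightarrow> B \<le> ?B" by blast
  let ?g = "\<lambda>x. \<Sum>i<n. interpolate N (G i) (x i)"
  note eq = equivalent_from_table(1-4)[OF f G(1)]
  show ?thesis
  proof (intro exI[of _ ?g] conjI impI)
    show "separable_convex n ?g" unfolding separable_convex_def by (rule exI[of _ "\<lambda>i. interpolate N (G i)"], rule eq(1))
    show "max_diff ?g (int_box n N) \<le> ?B" if "(n, N) \<noteq> (1, 1)" using order_trans[OF eq(4)] G(2) that by blast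
  qed (rule eq(2,3))+
qed

section \<open>The reduction program\<close>

lemma iterate_invariant:
  assumes "P 0 x" "\<And>k y. k < n \<Longrightarrow> P k y \<Longrightarrow> P (Suc k) (f k y)"
  shows "P n (iterate f n x)"
proof -
  have "P k (iterate f k x)" if "k \<le> n" for k using that by (induction k) (auto intro: assms)
  then show ?thesis by blast
qed

text \<open>The input area counts as array 0, so that a set of array numbers describes everything a
  command may change. This coarse frame suffices because each array has its own purpose.\<close>

fun array_of :: "addr \<Rightarrow> nat" where
  "array_of (Direct l) = 0"
| "array_of (Cell a i j) = a"

fun writes :: "cmd \<Rightarrow> nat set" where
  "writes (CSet (LDirect e) r) = {0}"
| "writes (CSet (LCell a e e') r) = {a}"
| "writes (c ;; c') = writes c \<union> writes c'"
| "writes (CIf a b c) = writes c"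
| "writes (CFor v e c) = writes c"

lemma run_frame: "array_of x \<notin> writes c \<Longrightarrow> run c env M x = M x"
proof (induction c arbitrary: env M)
  case (CSet l e)
  then show ?case by (cases l; cases x) auto
next
  case (CFor v e c)
  then have "iterate (\<lambda>i. run c (env(v := i))) n M x = M x" for n by (induction n) auto
  then show ?case by simp
qed auto

text \<open>Iterations over \<open>Suc d\<close> rounds must stay folded to match the conclusion of
  \<open>iterate_invariant\<close>.\<close>

declare iterate.simps(2) [simp del]

text \<open>Array 1 collects the integer vector, array 2 holds the current remainder, arrays 3, 4 and 5 hold \<open>V\<close>, \<open>\<mu>\<close>
  and \<open>c\<close>, array 6 holds constants (\<open>K\<close>, \<open>1 / K\<^sup>2\<close>, the base of the positional system, and a power of 2 that
  exceeds every number to be rounded), and array 7 is scratch space.\<close>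

abbreviation cnst :: "nat \<Rightarrow> loc" where "cnst s \<equiv> LCell 6 (NC s) (NC 0)"
abbreviation work :: "nat \<Rightarrow> loc" where "work s \<equiv> LCell 7 (NC s) (NC 0)"
abbreviation radd :: "rexp \<Rightarrow> rexp \<Rightarrow> rexp" where "radd \<equiv> ROp Add"
abbreviation rsub :: "rexp \<Rightarrow> rexp \<Rightarrow> rexp" where "rsub \<equiv> ROp Sub"
abbreviation rmul :: "rexp \<Rightarrow> rexp \<Rightarrow> rexp" where "rmul \<equiv> ROp Mul"
abbreviation rdiv :: "rexp \<Rightarrow> rexp \<Rightarrow> rexp" where "rdiv \<equiv> ROp Div"

section \<open>Rounding\<close>

definition bits_exp :: nexp where
  "bits_exp = NTimes (NPlus (NTimes (NC 2) dim_exp) (NC 2)) (NPlus dim_exp (NC 1))"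

text \<open>The exponent in \<open>K = 2 ^ bits d\<close>, the same \<open>K\<close> as in
  \<open>first_vector_approximates\<close>.\<close>

definition bits :: "nat \<Rightarrow> nat" where
  "bits d = (2 * d + 2) * (d + 1)"

lemma nval_bits_exp [simp]: "nval bits_exp env = bits (nval dim_exp env)"
  by (simp add: bits_exp_def bits_def)

lemma nval_dim_exp_upd [simp]: "2 \<le> v \<Longrightarrow> nval dim_exp (env(v := i)) = nval dim_exp env"
  by (simp add: dim_exp_def)

text \<open>Rounding by binary search: the residue is halved in every step.\<close>

definition round_step :: cmd where
  "round_step =
     CSet (work 3) (rdiv (RL (work 2)) (RC 2)) ;;
     CIf (RL (work 3)) (RL (work 0))
       (CSet (work 0) (rsub (RL (work 0)) (RL (work 2))) ;; CSet (work 1) (radd (RL (work 1)) (RL (work 2)))) ;;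
     CIf (RL (work 0)) (rsub (RC 0) (RL (work 3)))
       (CSet (work 0) (radd (RL (work 0)) (RL (work 2))) ;; CSet (work 1) (rsub (RL (work 1)) (RL (work 2)))) ;;
     CSet (work 2) (RL (work 3))"

text \<open>Work cells 0, 1 and 2 hold the residue, the integer found and the current power of 2.
  With \<open>2 ^ R\<close> in constant 3, the loop runs \<open>R + 1\<close> times: it subtracts or
  adds \<open>2 ^ R\<close> down to 1, all integers, and brings the residue from at most
  \<open>2 ^ R\<close> to at most \<open>1 / 2\<close>.\<close>

definition round_to :: "loc \<Rightarrow> cmd" where
  "round_to l =
     CSet (work 0) (RL l) ;; CSet (work 1) (RC 0) ;; CSet (work 2) (RL (cnst 3)) ;;
     CFor 8 (NPlus (NPlus (NTimes (NC 2) bits_exp) dim_exp) (NC 2)) round_step"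

lemma round_to_correct:
  assumes Z: "M (Cell 6 3 0) = 2 ^ (2 * bits (nval dim_exp env) + nval dim_exp env + 1)"
    and l: "array_of (lval l env) \<noteq> 7" "\<bar>M (lval l env)\<bar> \<le> M (Cell 6 3 0)"
  shows "run (round_to l) env M (Cell 7 1 0) \<in> \<int>"
    "\<bar>M (lval l env) - run (round_to l) env M (Cell 7 1 0)\<bar> \<le> 1 / 2"
proof -
  define R where "R = 2 * bits (nval dim_exp env) + nval dim_exp env + 1"
  let ?m = "M (lval l env)"
  define P where "P s M' \<longleftrightarrow> M' (Cell 7 2 0) = 2 ^ R / 2 ^ s \<and> \<bar>M' (Cell 7 0 0)\<bar> \<le> 2 ^ R / 2 ^ s \<and>
    M' (Cell 7 0 0) + M' (Cell 7 1 0) = ?m \<and> M' (Cell 7 1 0) \<in> \<int>" for s and M' :: "addr \<Rightarrow> real"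
  let ?M0 = "M(Cell 7 0 0 := ?m, Cell 7 1 0 := 0, Cell 7 2 0 := M (Cell 6 3 0))"
  have "P (Suc R) (iterate (\<lambda>i. run round_step (env(8 := i))) (Suc R) ?M0)"
  proof (rule iterate_invariant[where P = P])
    show "P 0 ?M0" unfolding P_def using Z l(2) by (simp add: R_def)
  next
    fix s M' assume s: "s < Suc R" and P: "P s M'"
    define z where "z = M' (Cell 7 2 0)"
    have z: "z = 2 ^ R / 2 ^ s" using P by (simp add: P_def z_def)
    have "(2 :: real) ^ R = 2 ^ (R - s) * 2 ^ s" using s by (simp flip: power_add)
    then have zi: "z \<in> \<int>" unfolding z by simp
    have z2: "2 ^ R / 2 ^ Suc s = z / 2" unfolding z by simp
    have z0: "0 < z" unfolding z by simp
    have t: "\<bar>M' (Cell 7 0 0)\<bar> \<le> z" "M' (Cell 7 0 0) + M' (Cell 7 1 0) = ?m" "M' (Cell 7 1 0) \<in> \<int>"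
      using P by (simp_all add: P_def z)
    define u where "u = M' (Cell 7 0 0)"
    define v where "v = M' (Cell 7 1 0)"
    \<comment> \<open>The second test sees the residue as changed by the first conditional. After a
      subtraction it lies above \<open>- z / 2\<close>, so at most one of the two corrections takes
      place.\<close>
    consider "z / 2 < u" "\<not> u - z < 0 - z / 2" | "\<not> z / 2 < u" "u < 0 - z / 2" | "\<not> z / 2 < u" "\<not> u < 0 - z / 2"
      using z0 by linarith
    then show "P (Suc s) (run round_step (env(8 := s)) M')"
    proof cases
      case 1
      then have "run round_step (env(8 := s)) M' = M'(Cell 7 3 0 := z / 2, Cell 7 0 0 := u - z, Cell 7 1 0 := v + z, Cell 7 2 0 := z / 2)"
        by (simp add: round_step_def u_def v_def z_def)
      then show ?thesis unfolding P_def z2 using 1 t zi z0 by (simp add: u_def v_def)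
    next
      case 2
      then have "run round_step (env(8 := s)) M' = M'(Cell 7 3 0 := z / 2, Cell 7 0 0 := u + z, Cell 7 1 0 := v - z, Cell 7 2 0 := z / 2)"
        by (simp add: round_step_def u_def v_def z_def)
      then show ?thesis unfolding P_def z2 using 2 t zi z0 by (simp add: u_def v_def)
    next
      case 3
      then have "run round_step (env(8 := s)) M' = M'(Cell 7 3 0 := z / 2, Cell 7 2 0 := z / 2)"
        by (simp add: round_step_def u_def v_def z_def)
      then show ?thesis unfolding P_def z2 using 3 t zi z0 by (simp add: u_def v_def)
    qed
  qed
  moreover have "run (round_to l) env M = iterate (\<lambda>i. run round_step (env(8 := i))) (Suc R) ?M0"
  proof -
    have "nval (NPlus (NPlus (NTimes (NC 2) bits_exp) dim_exp) (NC 2)) env = Suc R" by (simp add: R_def)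
    moreover have "lval (work s) env' = Cell 7 s 0" "lval (cnst s) env' = Cell 6 s 0" for s env' by simp_all
    ultimately show ?thesis unfolding round_to_def run.simps rval.simps by simp
  qed
  ultimately have P: "P (Suc R) (run (round_to l) env M)" by simp
  then show "run (round_to l) env M (Cell 7 1 0) \<in> \<int>" by (simp add: P_def)
  have "(2 :: real) ^ R / 2 ^ Suc R = 1 / 2" by simp
  with P show "\<bar>M (lval l env) - run (round_to l) env M (Cell 7 1 0)\<bar> \<le> 1 / 2"
    unfolding P_def by linarith
qed

section \<open>Size reduction\<close>

abbreviation size_exp :: nexp where "size_exp \<equiv> NPlus dim_exp (NC 1)"

definition row_operation :: "nexp \<Rightarrow> nexp \<Rightarrow> cmd" where
  "row_operation i j = CFor 7 size_exp
     (CSet (LCell 3 i (NV 7)) (rsub (RL (LCell 3 i (NV 7))) (rmul (RL (work 1)) (RL (LCell 3 j (NV 7))))) ;;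
      CSet (LCell 4 i (NV 7)) (rsub (RL (LCell 4 i (NV 7))) (rmul (RL (work 1)) (RL (LCell 4 j (NV 7))))))"

lemma row_operation_correct:
  assumes "7 \<notin> nvars i" "7 \<notin> nvars j" "nval i env \<noteq> nval j env" "a = 3 \<or> a = 4" "l \<le> nval dim_exp env"
  shows "run (row_operation i j) env M (Cell a h l) =
    M (Cell a h l) - (if h = nval i env then M (Cell 7 1 0) else 0) * M (Cell a (nval j env) l)"
proof -
  let ?i = "nval i env" and ?j = "nval j env" and ?r = "M (Cell 7 1 0)"
  have i: "nval i (env(7 := s)) = ?i" and j: "nval j (env(7 := s)) = ?j" for s
    using assms by (auto intro!: nval_cong)
  define P where "P s M' \<longleftrightarrow> M' (Cell 7 1 0) = ?r \<and> (\<forall>h l. \<forall>a\<in>{3, 4}. M' (Cell a h l) =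
    M (Cell a h l) - (if h = ?i \<and> l < s then ?r else 0) * M (Cell a ?j l))" for s M'
  let ?body = "CSet (LCell 3 i (NV 7)) (rsub (RL (LCell 3 i (NV 7))) (rmul (RL (work 1)) (RL (LCell 3 j (NV 7))))) ;;
      CSet (LCell 4 i (NV 7)) (rsub (RL (LCell 4 i (NV 7))) (rmul (RL (work 1)) (RL (LCell 4 j (NV 7)))))"
  have "P (Suc (nval dim_exp env)) (iterate (\<lambda>s. run ?body (env(7 := s))) (Suc (nval dim_exp env)) M)"
    by (rule iterate_invariant[where P = P]) (use assms(3) in \<open>auto simp: P_def i j less_Suc_eq\<close>)
  moreover have "run (row_operation i j) env M = iterate (\<lambda>s. run ?body (env(7 := s))) (Suc (nval dim_exp env)) M"
    unfolding row_operation_def by (simp only: run.simps(4) nval.simps Suc_eq_plus1)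
  ultimately have "P (Suc (nval dim_exp env)) (run (row_operation i j) env M)" by (simp only:)
  then show ?thesis using assms(4,5) by (auto simp: P_def less_Suc_eq_le)
qed

definition lll_state :: "nat \<Rightarrow> (nat \<Rightarrow> real) \<Rightarrow> real \<Rightarrow> (addr \<Rightarrow> real) \<Rightarrow> bool" where
  "lll_state d x e M \<longleftrightarrow>
     lll_inv d x e (\<lambda>i l. M (Cell 3 i l)) (\<lambda>i l. M (Cell 4 i l)) (\<lambda>i. M (Cell 5 i 0))"

text \<open>Subtracting row \<open>j\<close> changes only coefficients up to column
  \<open>j\<close>, because \<open>\<mu>\<close> is lower triangular. The columns are therefore
  treated from right to left, and \<open>j\<close> is computed from an upward counter.\<close>

definition reduce_row :: cmd where
  "reduce_row = (let j = NMinus (NMinus (NV 5) (NC 1)) (NV 6) in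
     CFor 6 (NV 5) (round_to (LCell 4 (NV 5) j) ;; row_operation (NV 5) j))"

definition reduce_rows :: cmd where
  "reduce_rows = CFor 5 size_exp reduce_row"

lemma writes_reduce_rows [simp]: "writes reduce_rows = {3, 4, 7}" "writes reduce_row = {3, 4, 7}"
  "writes (round_to l) = {7}"
  by (auto simp: reduce_rows_def reduce_row_def round_to_def round_step_def row_operation_def Let_def)

text \<open>Each operation at most doubles the coefficients still waiting to its left, as the rows
  above already have coefficients of modulus at most \<open>1 / 2\<close>:
  \<open>y + (y + 1 / 2) / 2 \<le> 2 y\<close> for \<open>1 \<le> y\<close>. This explains the
  factor \<open>2 ^ Suc d\<close> in the constant that starts the rounding.\<close>

lemma reduce_row_correct:
  assumes inv: "lll_state (nval dim_exp env) x e M" and X: "1 \<le> X"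
    and Z: "M (Cell 6 3 0) = 2 ^ (2 * bits (nval dim_exp env) + nval dim_exp env + 1)"
      "M (Cell 6 3 0) = X * 2 ^ Suc (nval dim_exp env)"
    and i: "env 5 = i" "i \<le> nval dim_exp env"
    and below: "\<forall>h<i. \<forall>l<h. \<bar>M (Cell 4 h l)\<bar> \<le> 1 / 2"
    and bound: "\<forall>l<i. \<bar>M (Cell 4 i l)\<bar> \<le> X"
  shows "lll_state (nval dim_exp env) x e (run reduce_row env M)"
    "\<And>l. l < i \<Longrightarrow> \<bar>run reduce_row env M (Cell 4 i l)\<bar> \<le> 1 / 2"
    "\<And>h l. h \<noteq> i \<Longrightarrow> l \<le> nval dim_exp env \<Longrightarrow> run reduce_row env M (Cell 4 h l) = M (Cell 4 h l)"
proof -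
  define d where "d = nval dim_exp env"
  let ?j = "NMinus (NMinus (NV 5) (NC 1)) (NV 6)"
  let ?round = "round_to (LCell 4 (NV 5) ?j)"
  let ?body = "?round ;; row_operation (NV 5) ?j"
  define P where "P s M' \<longleftrightarrow> lll_state d x e M' \<and> M' (Cell 6 3 0) = M (Cell 6 3 0) \<and>
    (\<forall>l<i. \<bar>M' (Cell 4 i l)\<bar> \<le> (if l < i - s then X * 2 ^ s else 1 / 2)) \<and>
    (\<forall>h l. h \<noteq> i \<longrightarrow> l \<le> d \<longrightarrow> M' (Cell 4 h l) = M (Cell 4 h l))" for s M'
  have "P i (iterate (\<lambda>s. run ?body (env(6 := s))) i M)"
  proof (rule iterate_invariant[where P = P])
    show "P 0 M" using inv bound by (auto simp: P_def d_def)
  next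
    fix s M' assume s: "s < i" and P: "P s M'"
    define j where "j = i - 1 - s"
    have j: "j < i" "j < i - s" "i - Suc s = j" using s by (auto simp: j_def)
    let ?env = "env(6 := s)"
    define M1 where "M1 = run ?round ?env M'"
    define r where "r = M1 (Cell 7 1 0)"
    have jv: "nval ?j ?env = j" using i by (simp add: j_def)
    have bnd: "\<bar>M' (Cell 4 i l)\<bar> \<le> (if l < i - s then X * 2 ^ s else 1 / 2)" if "l < i" for l
      using P that unfolding P_def by blast
    have Xs: "1 \<le> X * 2 ^ s" using X mult_mono[of 1 X 1 "2 ^ s"] by simp
    have "X * 2 ^ s \<le> X * 2 ^ Suc d"
      using X s i by (intro mult_left_mono power_increasing) (auto simp: d_def)
    then have "\<bar>M' (Cell 4 i j)\<bar> \<le> M' (Cell 6 3 0)" using P j Z by (auto simp: P_def d_def intro: order_trans)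
    then have r: "r \<in> \<int>" "\<bar>M' (Cell 4 i j) - r\<bar> \<le> 1 / 2"
      using round_to_correct[of M' ?env "LCell 4 (NV 5) ?j"] P Z(1) i jv by (auto simp: P_def r_def M1_def d_def)
    have M1: "M1 y = M' y" if "array_of y \<noteq> 7" for y
      unfolding M1_def by (rule run_frame) (use that in simp)
    define M2 where "M2 = run (row_operation (NV 5) ?j) ?env M1"
    have M2: "M2 (Cell a h l) = M' (Cell a h l) - (if h = i then r else 0) * M' (Cell a j l)"
      if "a = 3 \<or> a = 4" "l \<le> d" for a h l
      using row_operation_correct[of "NV 5" ?j ?env a l M1 h] that i jv j
      unfolding M2_def r_def[symmetric] by (auto simp: M1 d_def)
    have M2': "M2 y = M' y" if "array_of y \<noteq> 3" "array_of y \<noteq> 4" "array_of y \<noteq> 7" for y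
      unfolding M2_def using that M1 by (subst run_frame) (auto simp: row_operation_def)
    have id: "i \<le> d" using i by (simp add: d_def)
    have "lll_state d x e M2"
      unfolding lll_state_def
    proof (rule lll_inv_row_operation[where i = i and h = j and r = r])
      show "lll_inv d x e (\<lambda>i l. M' (Cell 3 i l)) (\<lambda>i l. M' (Cell 4 i l)) (\<lambda>i. M2 (Cell 5 i 0))"
        using P by (simp add: P_def lll_state_def M2')
    qed (use j id r M2 in auto)
    moreover have "\<bar>M2 (Cell 4 i l)\<bar> \<le> (if l < i - Suc s then X * 2 ^ Suc s else 1 / 2)" if l: "l < i" for l
    proof -
      have tri: "M' (Cell 4 j j) = 1" "\<And>l. l \<le> d \<Longrightarrow> j < l \<Longrightarrow> M' (Cell 4 j l) = 0"
        using P j id by (auto simp: P_def lll_state_def lll_inv_def)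
      have eq: "M2 (Cell 4 i l) = M' (Cell 4 i l) - r * M' (Cell 4 j l)" using M2[of 4 l i] l id by simp
      consider "l < j" | "l = j" | "j < l" by linarith
      then show ?thesis
      proof cases
        case 1
        have "\<bar>M' (Cell 4 j l)\<bar> \<le> 1 / 2" using P j 1 below l id by (auto simp: P_def)
        moreover have "\<bar>M' (Cell 4 i j)\<bar> \<le> X * 2 ^ s" using bnd[of j] j by simp
        then have "\<bar>r\<bar> \<le> X * 2 ^ s + 1 / 2" using r(2) by linarith
        ultimately have "\<bar>r * M' (Cell 4 j l)\<bar> \<le> (X * 2 ^ s + 1 / 2) * (1 / 2)"
          unfolding abs_mult using Xs by (intro mult_mono) auto
        moreover have "\<bar>M' (Cell 4 i l)\<bar> \<le> X * 2 ^ s" using bnd[OF l] 1 j by simp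
        ultimately have "\<bar>M2 (Cell 4 i l)\<bar> \<le> X * 2 ^ Suc s" unfolding eq using Xs by simp
        then show ?thesis using 1 j by simp
      next
        case 2
        then have "M2 (Cell 4 i l) = M' (Cell 4 i j) - r" unfolding eq using tri by simp
        then show ?thesis using 2 r(2) j by simp
      next
        case 3
        then have "\<not> l < i - s" using j by linarith
        then have "\<bar>M2 (Cell 4 i l)\<bar> \<le> 1 / 2" unfolding eq using bnd[OF l] tri(2)[of l] 3 l id by simp
        then show ?thesis using 3 j by simp
      qed
    qed
    moreover have "M2 (Cell 4 h l) = M (Cell 4 h l)" if "h \<noteq> i" "l \<le> d" for h l
      using M2[of 4 l h] that P by (simp add: P_def)
    ultimately have "P (Suc s) M2" using M2' P by (auto simp: P_def)
    then show "P (Suc s) (run ?body ?env M')" by (simp add: M2_def M1_def)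
  qed
  then have "P i (run reduce_row env M)" using i by (simp add: reduce_row_def Let_def)
  then show "lll_state (nval dim_exp env) x e (run reduce_row env M)"
    "\<And>l. l < i \<Longrightarrow> \<bar>run reduce_row env M (Cell 4 i l)\<bar> \<le> 1 / 2"
    "\<And>h l. h \<noteq> i \<Longrightarrow> l \<le> nval dim_exp env \<Longrightarrow> run reduce_row env M (Cell 4 h l) = M (Cell 4 h l)"
    by (auto simp: P_def d_def)
qed

text \<open>Only the row in hand changes, so later rows still obey the initial bound
  \<open>X\<close> when their turn comes; growth does not accumulate from row to row.\<close>

lemma reduce_rows_correct:
  assumes inv: "lll_state (nval dim_exp env) x e M" and X: "1 \<le> X"
    and Z: "M (Cell 6 3 0) = 2 ^ (2 * bits (nval dim_exp env) + nval dim_exp env + 1)"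
      "M (Cell 6 3 0) = X * 2 ^ Suc (nval dim_exp env)"
    and bound: "\<And>i l. i \<le> nval dim_exp env \<Longrightarrow> l \<le> nval dim_exp env \<Longrightarrow> \<bar>M (Cell 4 i l)\<bar> \<le> X"
  shows "lll_state (nval dim_exp env) x e (run reduce_rows env M)"
    "\<And>i l. i \<le> nval dim_exp env \<Longrightarrow> l < i \<Longrightarrow> \<bar>run reduce_rows env M (Cell 4 i l)\<bar> \<le> 1 / 2"
proof -
  define d where "d = nval dim_exp env"
  define P where "P s M' \<longleftrightarrow> lll_state d x e M' \<and> M' (Cell 6 3 0) = M (Cell 6 3 0) \<and>
    (\<forall>h<s. \<forall>l<h. \<bar>M' (Cell 4 h l)\<bar> \<le> 1 / 2) \<and>
    (\<forall>h l. s \<le> h \<longrightarrow> h \<le> d \<longrightarrow> l \<le> d \<longrightarrow> M' (Cell 4 h l) = M (Cell 4 h l))" for s M'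
  have "P (Suc d) (iterate (\<lambda>s. run reduce_row (env(5 := s))) (Suc d) M)"
  proof (rule iterate_invariant[where P = P])
    show "P 0 M" using inv by (simp add: P_def d_def)
  next
    fix s M' assume s: "s < Suc d" and P: "P s M'"
    let ?env = "env(5 := s)"
    have dim: "nval dim_exp ?env = d" by (simp add: d_def)
    have Z': "M' (Cell 6 3 0) = M (Cell 6 3 0)" using P by (simp add: P_def)
    have "\<forall>l<s. \<bar>M' (Cell 4 s l)\<bar> \<le> X"
    proof (intro allI impI)
      fix l assume "l < s"
      then have "M' (Cell 4 s l) = M (Cell 4 s l)" using P s unfolding P_def by simp
      then show "\<bar>M' (Cell 4 s l)\<bar> \<le> X" using bound[of s l] s \<open>l < s\<close> by (simp add: d_def)
    qed
    moreover have "lll_state d x e M'" "\<forall>h<s. \<forall>l<h. \<bar>M' (Cell 4 h l)\<bar> \<le> 1 / 2"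
      using P unfolding P_def by blast+
    moreover have "?env 5 = s" "s \<le> d" using s by simp_all
    ultimately have *: "lll_state d x e (run reduce_row ?env M')"
      "\<And>l. l < s \<Longrightarrow> \<bar>run reduce_row ?env M' (Cell 4 s l)\<bar> \<le> 1 / 2"
      "\<And>h l. h \<noteq> s \<Longrightarrow> l \<le> d \<Longrightarrow> run reduce_row ?env M' (Cell 4 h l) = M' (Cell 4 h l)"
      using reduce_row_correct[of ?env x e M' X s] X Z unfolding dim Z' d_def[symmetric] by blast+
    moreover have "run reduce_row ?env M' (Cell 6 3 0) = M' (Cell 6 3 0)" by (rule run_frame) simp
    moreover have "\<bar>run reduce_row ?env M' (Cell 4 h l)\<bar> \<le> 1 / 2" if "h < Suc s" "l < h" for h l
    proof (cases "h = s")
      case False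
      then have "\<bar>M' (Cell 4 h l)\<bar> \<le> 1 / 2" "l \<le> d" using P that s unfolding P_def by auto
      then show ?thesis using *(3)[OF False] by simp
    qed (use that * in simp)
    moreover have "run reduce_row ?env M' (Cell 4 h l) = M (Cell 4 h l)" if "Suc s \<le> h" "h \<le> d" "l \<le> d" for h l
      using *(3)[of h l] P that unfolding P_def by simp
    ultimately show "P (Suc s) (run reduce_row ?env M')" using P unfolding P_def by metis
  qed
  then have P: "P (Suc d) (run reduce_rows env M)" by (simp add: reduce_rows_def d_def)
  from P show "lll_state (nval dim_exp env) x e (run reduce_rows env M)"
    "\<And>i l. i \<le> nval dim_exp env \<Longrightarrow> l < i \<Longrightarrow> \<bar>run reduce_rows env M (Cell 4 i l)\<bar> \<le> 1 / 2"
    by (auto simp: P_def d_def)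
qed

section \<open>Exchange of neighbouring basis vectors\<close>

abbreviation next_exp :: nexp where "next_exp \<equiv> NPlus (NV 4) (NC 1)"

definition swap_column_step :: cmd where
  "swap_column_step =
     CSet (work 0) (RL (LCell 4 (NV 5) (NV 4))) ;;
     CSet (LCell 4 (NV 5) (NV 4))
       (rdiv (radd (rmul (rmul (RL (work 3)) (RL (LCell 5 (NV 4) (NC 0)))) (RL (work 0)))
          (rmul (RL (LCell 5 next_exp (NC 0))) (RL (LCell 4 (NV 5) next_exp)))) (RL (work 4))) ;;
     CSet (LCell 4 (NV 5) next_exp) (rsub (RL (work 0)) (rmul (RL (work 3)) (RL (LCell 4 (NV 5) next_exp))))"

definition swap_columns :: cmd where
  "swap_columns = CFor 5 size_exp swap_column_step"

definition swap_cells :: "nat \<Rightarrow> cmd" where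
  "swap_cells a =
     CSet (work 0) (RL (LCell a (NV 4) (NV 7))) ;;
     CSet (LCell a (NV 4) (NV 7)) (RL (LCell a next_exp (NV 7))) ;;
     CSet (LCell a next_exp (NV 7)) (RL (work 0))"

definition swap_lines :: cmd where
  "swap_lines = CFor 7 size_exp (swap_cells 3 ;; swap_cells 4)"

text \<open>The order matters: \<open>a\<close> and \<open>C\<close> are saved first, the columns of
  \<open>\<mu>\<close> are recombined with the old \<open>c\<close>, and \<open>c\<close> at
  \<open>k + 1\<close> is overwritten before \<open>c\<close> at \<open>k\<close>, whose old value
  it needs.\<close>

definition swap_basis :: cmd where
  "swap_basis =
     CSet (work 3) (RL (LCell 4 next_exp (NV 4))) ;;
     CSet (work 4) (radd (RL (LCell 5 next_exp (NC 0)))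
       (rmul (rmul (RL (work 3)) (RL (work 3))) (RL (LCell 5 (NV 4) (NC 0))))) ;;
     swap_columns ;;
     swap_lines ;;
     CSet (LCell 5 next_exp (NC 0))
       (rdiv (rmul (RL (LCell 5 (NV 4) (NC 0))) (RL (LCell 5 next_exp (NC 0)))) (RL (work 4))) ;;
     CSet (LCell 5 (NV 4) (NC 0)) (RL (work 4))"

lemma swap_columns_correct:
  fixes env :: "nat \<Rightarrow> nat" and M
  defines "mu \<equiv> swap_mu (env 4) (\<lambda>i l. M (Cell 4 i l)) (\<lambda>i. M (Cell 5 i 0)) (M (Cell 7 3 0)) (M (Cell 7 4 0))"
  shows "i \<le> nval dim_exp env \<Longrightarrow> run swap_columns env M (Cell 4 i l) = mu i l"
    "run swap_columns env M (Cell 7 4 0) = M (Cell 7 4 0)"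
proof -
  define d where "d = nval dim_exp env"
  define P where "P s M' \<longleftrightarrow> (\<forall>i l. M' (Cell 4 i l) = (if i < s then mu i l else M (Cell 4 i l))) \<and>
    (\<forall>i. M' (Cell 5 i 0) = M (Cell 5 i 0)) \<and> M' (Cell 7 3 0) = M (Cell 7 3 0) \<and> M' (Cell 7 4 0) = M (Cell 7 4 0)"
    for s M'
  have "P (Suc d) (iterate (\<lambda>s. run swap_column_step (env(5 := s))) (Suc d) M)"
  proof (rule iterate_invariant[where P = P])
    show "P 0 M" by (simp add: P_def)
  next
    fix s M' assume P: "P s M'"
    have M': "M' (Cell 4 s l) = M (Cell 4 s l)" "M' (Cell 5 i 0) = M (Cell 5 i 0)"
      "M' (Cell 7 3 0) = M (Cell 7 3 0)" "M' (Cell 7 4 0) = M (Cell 7 4 0)" for i l using P by (simp_all add: P_def)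
    have "run swap_column_step (env(5 := s)) M' = M'(Cell 7 0 0 := M (Cell 4 s (env 4)),
        Cell 4 s (env 4) := mu s (env 4), Cell 4 s (Suc (env 4)) := mu s (Suc (env 4)))"
      by (simp add: swap_column_step_def M' mu_def swap_mu_def)
    moreover have "mu s l = M (Cell 4 s l)" if "l \<noteq> env 4" "l \<noteq> Suc (env 4)" for l
      using that by (simp add: mu_def swap_mu_def)
    ultimately show "P (Suc s) (run swap_column_step (env(5 := s)) M')"
      using P by (simp add: P_def less_Suc_eq)
  qed
  then have P: "P (Suc d) (run swap_columns env M)" by (simp add: swap_columns_def d_def)
  then show "i \<le> nval dim_exp env \<Longrightarrow> run swap_columns env M (Cell 4 i l) = mu i l"
    by (simp add: P_def d_def less_Suc_eq_le)
  from P show "run swap_columns env M (Cell 7 4 0) = M (Cell 7 4 0)" by (simp add: P_def)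
qed

lemma swap_lines_correct:
  assumes "a = 3 \<or> a = 4" "l \<le> nval dim_exp env"
  shows "run swap_lines env M (Cell a i l) = M (Cell a (swap_rows (env 4) i) l)"
    "run swap_lines env M (Cell 7 4 0) = M (Cell 7 4 0)"
proof -
  define d where "d = nval dim_exp env"
  define P where "P s M' \<longleftrightarrow> (\<forall>a\<in>{3, 4}. \<forall>i l. M' (Cell a i l) =
    M (Cell a (if l < s then swap_rows (env 4) i else i) l)) \<and> M' (Cell 7 4 0) = M (Cell 7 4 0)" for s M'
  have "P (Suc d) (iterate (\<lambda>s. run (swap_cells 3 ;; swap_cells 4) (env(7 := s))) (Suc d) M)"
  proof (rule iterate_invariant[where P = P])
    show "P 0 M" by (simp add: P_def)
  next
    fix s M' assume P: "P s M'"
    have M': "M' (Cell 3 i s) = M (Cell 3 i s)" "M' (Cell 4 i s) = M (Cell 4 i s)" for i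
      using P by (simp_all add: P_def)
    have "run (swap_cells 3 ;; swap_cells 4) (env(7 := s)) M' = M'(
        Cell 7 0 0 := M (Cell 4 (env 4) s),
        Cell 3 (env 4) s := M (Cell 3 (Suc (env 4)) s), Cell 3 (Suc (env 4)) s := M (Cell 3 (env 4) s),
        Cell 4 (env 4) s := M (Cell 4 (Suc (env 4)) s), Cell 4 (Suc (env 4)) s := M (Cell 4 (env 4) s))"
      by (rule ext) (simp add: swap_cells_def M')
    moreover have "swap_rows (env 4) i = i" if "i \<noteq> env 4" "i \<noteq> Suc (env 4)" for i
      using that by (simp add: swap_rows_def)
    moreover have "swap_rows (env 4) (env 4) = Suc (env 4)" "swap_rows (env 4) (Suc (env 4)) = env 4"
      by (simp_all add: swap_rows_def)
    ultimately show "P (Suc s) (run (swap_cells 3 ;; swap_cells 4) (env(7 := s)) M')"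
      using P by (simp add: P_def less_Suc_eq)
  qed
  then have P: "P (Suc d) (run swap_lines env M)" by (simp add: swap_lines_def d_def)
  then show "run swap_lines env M (Cell a i l) = M (Cell a (swap_rows (env 4) i) l)"
    using assms by (auto simp add: P_def d_def less_Suc_eq_le)
  from P show "run swap_lines env M (Cell 7 4 0) = M (Cell 7 4 0)" by (simp add: P_def)
qed

lemma writes_swap [simp]: "writes swap_columns = {4, 7}" "writes swap_lines = {3, 4, 7}" "writes swap_basis = {3, 4, 5, 7}"
  by (auto simp: swap_columns_def swap_column_step_def swap_lines_def swap_cells_def swap_basis_def)

lemma swap_basis_correct:
  fixes env M
  defines "k \<equiv> env 4" and "a \<equiv> M (Cell 4 (Suc (env 4)) (env 4))"
  defines "C \<equiv> M (Cell 5 (Suc k) 0) + a * a * M (Cell 5 k 0)"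
  defines "M' \<equiv> run swap_basis env M"
  assumes k: "k < nval dim_exp env"
  shows "l \<le> nval dim_exp env \<Longrightarrow> M' (Cell 3 i l) = M (Cell 3 (swap_rows k i) l)"
    "i \<le> nval dim_exp env \<Longrightarrow> l \<le> nval dim_exp env \<Longrightarrow> M' (Cell 4 i l) =
       swap_mu k (\<lambda>i l. M (Cell 4 i l)) (\<lambda>i. M (Cell 5 i 0)) a C (swap_rows k i) l"
    "M' (Cell 5 i 0) = (if i = k then C else if i = Suc k then M (Cell 5 k 0) * M (Cell 5 (Suc k) 0) / C else M (Cell 5 i 0))"
proof -
  define M1 where "M1 = M(Cell 7 3 0 := a, Cell 7 4 0 := C)"
  define M2 where "M2 = run swap_columns env M1"
  define M3 where "M3 = run swap_lines env M2"
  have M3_C: "M3 (Cell 7 4 0) = C"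
    unfolding M3_def M2_def
    by (simp only: swap_lines_correct(2)[of 3 0 env, simplified] swap_columns_correct(2)) (simp add: M1_def)
  have M3_5: "M3 (Cell 5 i 0) = M (Cell 5 i 0)" for i
    unfolding M3_def M2_def by (simp add: run_frame M1_def)
  have M': "M' = M3(Cell 5 (Suc k) 0 := M (Cell 5 k 0) * M (Cell 5 (Suc k) 0) / C, Cell 5 k 0 := C)"
  proof -
    have "M' = run (swap_columns ;; swap_lines ;; CSet (LCell 5 next_exp (NC 0))
       (rdiv (rmul (RL (LCell 5 (NV 4) (NC 0))) (RL (LCell 5 next_exp (NC 0)))) (RL (work 4))) ;;
     CSet (LCell 5 (NV 4) (NC 0)) (RL (work 4))) env M1"
      unfolding M'_def swap_basis_def run.simps(2)[of "CSet _ _"] by (simp add: M1_def a_def C_def k_def)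
    then show ?thesis using M3_C M3_5 by (simp add: M2_def[symmetric] M3_def[symmetric] k_def)
  qed
  show "M' (Cell 5 i 0) = (if i = k then C else if i = Suc k then M (Cell 5 k 0) * M (Cell 5 (Suc k) 0) / C else M (Cell 5 i 0))"
    using M3_5 by (simp add: M')
  show "M' (Cell 3 i l) = M (Cell 3 (swap_rows k i) l)" if l: "l \<le> nval dim_exp env"
  proof -
    have "M' (Cell 3 i l) = M2 (Cell 3 (swap_rows k i) l)"
      unfolding M' M3_def k_def by (simp add: swap_lines_correct(1)[OF _ l])
    also have "\<dots> = M (Cell 3 (swap_rows k i) l)" unfolding M2_def by (simp add: run_frame M1_def)
    finally show ?thesis .
  qed
  show "M' (Cell 4 i l) = swap_mu k (\<lambda>i l. M (Cell 4 i l)) (\<lambda>i. M (Cell 5 i 0)) a C (swap_rows k i) l"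
    if i: "i \<le> nval dim_exp env" and l: "l \<le> nval dim_exp env"
  proof -
    have si: "swap_rows k i \<le> nval dim_exp env" using i k by (auto simp: swap_rows_def)
    have "M' (Cell 4 i l) = M2 (Cell 4 (swap_rows k i) l)"
      unfolding M' M3_def k_def by (simp add: swap_lines_correct(1)[OF _ l])
    also have "\<dots> = swap_mu k (\<lambda>i l. M1 (Cell 4 i l)) (\<lambda>i. M1 (Cell 5 i 0)) a C (swap_rows k i) l"
      unfolding M2_def swap_columns_correct(1)[OF si] by (simp add: M1_def k_def)
    finally show ?thesis by (simp add: M1_def)
  qed
qed

section \<open>Sweeps and the number of swaps\<close>

definition sweep_step :: cmd where
  "sweep_step = CIf (radd (RL (LCell 5 next_exp (NC 0))) (RL (LCell 5 next_exp (NC 0)))) (RL (LCell 5 (NV 4) (NC 0)))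
     (reduce_rows ;; swap_basis)"

definition sweep :: cmd where
  "sweep = CFor 4 dim_exp sweep_step"

definition reduced :: "nat \<Rightarrow> (addr \<Rightarrow> real) \<Rightarrow> bool" where
  "reduced d M \<longleftrightarrow> (\<forall>k<d. M (Cell 5 k 0) \<le> 2 * M (Cell 5 (Suc k) 0))"

text \<open>The bound \<open>K * K\<close> on the coefficients is the reciprocal of the weight,
  exactly what a swap leaves behind. Constant 3 exceeds it by the factor by which size reduction may
  enlarge a coefficient.\<close>

definition lll_ready :: "nat \<Rightarrow> (nat \<Rightarrow> real) \<Rightarrow> real \<Rightarrow> (addr \<Rightarrow> real) \<Rightarrow> bool" where
  "lll_ready d x K M \<longleftrightarrow> K = 2 ^ bits d \<and> lll_state d x (1 / (K * K)) M \<and>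
     M (Cell 6 3 0) = K * K * 2 ^ Suc d \<and> (\<forall>i\<le>d. \<forall>l\<le>d. \<bar>M (Cell 4 i l)\<bar> \<le> K * K)"

abbreviation energy :: "nat \<Rightarrow> (addr \<Rightarrow> real) \<Rightarrow> real" where
  "energy d M \<equiv> potential d (\<lambda>i. M (Cell 5 i 0))"

lemma bits_ge: "1 \<le> bits d"
  by (simp add: bits_def)

lemma lll_ready_K:
  assumes "lll_ready d x K M"
  shows "2 \<le> K" "0 < 1 / (K * K)" "1 / (K * K) \<le> 1 / 2" "2 * 2 \<le> K * K"
proof -
  have "(2 :: real) ^ 1 \<le> 2 ^ bits d" using bits_ge by (intro power_increasing) auto
  then show 2: "2 \<le> K" using assms by (simp add: lll_ready_def)
  then show 4: "2 * 2 \<le> K * K" by (intro mult_mono) auto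
  then show "0 < 1 / (K * K)" by simp
  show "1 / (K * K) \<le> 1 / 2" using 4 by (intro divide_left_mono) auto
qed

lemma writes_sweep [simp]: "writes sweep_step = {3, 4, 5, 7}" "writes sweep = {3, 4, 5, 7}"
  by (auto simp: sweep_def sweep_step_def)

lemma energy_nonneg:
  assumes "lll_ready d x K M"
  shows "0 \<le> energy d M"
proof -
  have "0 \<le> (1 / (K * K)) ^ Suc d" using lll_ready_K(2)[OF assms] by simp
  also have "\<dots> \<le> energy d M"
    using assms lll_ready_K(2)[OF assms] unfolding lll_ready_def lll_state_def by (intro potential_ge) blast+
  finally show ?thesis .
qed

text \<open>Size reduction is done right before a swap. It leaves \<open>c\<close> alone, makes the
  coefficient \<open>a\<close> small enough for the potential to drop, and brings all coefficients
  down to modulus at most 1, so that the swap cannot push them beyond \<open>K * K\<close>.\<close>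

lemma sweep_step_correct:
  assumes d: "d = nval dim_exp env" and ready: "lll_ready d x K M" and k: "env 4 = k" "k < d"
  shows "lll_ready d x K (run sweep_step env M) \<and>
    ((run sweep_step env M = M \<and> M (Cell 5 k 0) \<le> 2 * M (Cell 5 (Suc k) 0)) \<or>
     (\<not> M (Cell 5 k 0) \<le> 2 * M (Cell 5 (Suc k) 0) \<and> energy d (run sweep_step env M) \<le> 3 / 4 * energy d M))"
proof -
  have K: "K = 2 ^ bits d" and st: "lll_state d x (1 / (K * K)) M" and Z: "M (Cell 6 3 0) = K * K * 2 ^ Suc d"
    and mu: "\<forall>i\<le>d. \<forall>l\<le>d. \<bar>M (Cell 4 i l)\<bar> \<le> K * K" using ready unfolding lll_ready_def by blast+
  note K2 = lll_ready_K[OF ready]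
  show ?thesis
  proof (cases "2 * M (Cell 5 (Suc k) 0) < M (Cell 5 k 0)")
    case False
    then have "run sweep_step env M = M" by (simp add: sweep_step_def k)
    then show ?thesis using ready False by simp
  next
    case True
    define M1 where "M1 = run reduce_rows env M"
    define M2 where "M2 = run swap_basis env M1"
    have run: "run sweep_step env M = M2" using True by (simp add: sweep_step_def k M1_def M2_def)
    have Z': "M (Cell 6 3 0) = 2 ^ (2 * bits d + d + 1)"
    proof -
      have "2 * bits d + d + 1 = bits d + bits d + Suc d" by simp
      then show ?thesis unfolding Z K by (simp only: power_add)
    qed
    have "1 \<le> K * K" using K2(4) by simp
    have st1: "lll_state d x (1 / (K * K)) M1"
      unfolding M1_def d using \<open>1 \<le> K * K\<close> st Z Z' mu unfolding d by (intro reduce_rows_correct(1)[where X = "K * K"]) blast+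
    have half: "\<bar>M1 (Cell 4 i l)\<bar> \<le> 1 / 2" if "i \<le> d" "l < i" for i l
      using that unfolding M1_def d using \<open>1 \<le> K * K\<close> st Z Z' mu unfolding d
      by (intro reduce_rows_correct(2)[where X = "K * K" and x = x and e = "1 / (K * K)"]) blast+
    have M1_5: "M1 (Cell 5 i 0) = M (Cell 5 i 0)" for i unfolding M1_def by (simp add: run_frame)
    have mu1: "\<bar>M1 (Cell 4 i l)\<bar> \<le> 1" if "i \<le> d" "l \<le> d" for i l
    proof -
      have "M1 (Cell 4 i i) = 1" "i < l \<Longrightarrow> M1 (Cell 4 i l) = 0"
        using st1 that unfolding lll_state_def lll_inv_def by blast+
      then show ?thesis using half[of i l] that by (cases i l rule: linorder_cases) auto
    qed
    define a where "a = M1 (Cell 4 (Suc k) k)"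
    define C where "C = M1 (Cell 5 (Suc k) 0) + a * a * M1 (Cell 5 k 0)"
    have a: "\<bar>a\<bar> \<le> 1 / 2" unfolding a_def using k by (intro half) auto
    have sw: "2 * M1 (Cell 5 (Suc k) 0) < M1 (Cell 5 k 0)" using True by (simp add: M1_5)
    have kd: "env 4 < nval dim_exp env" using k d by simp
    have V2: "M2 (Cell 3 i l) = M1 (Cell 3 (swap_rows k i) l)" if "i \<le> d" "l \<le> d" for i l
      using swap_basis_correct(1)[OF kd, of l M1 i] that d k by (simp add: M2_def)
    have mu2: "M2 (Cell 4 i l) = swap_mu k (\<lambda>i l. M1 (Cell 4 i l)) (\<lambda>i. M1 (Cell 5 i 0)) a C (swap_rows k i) l"
      if "i \<le> d" "l \<le> d" for i l
      using swap_basis_correct(2)[OF kd, of i l M1] that d k by (simp add: M2_def a_def C_def)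
    have c2: "M2 (Cell 5 i 0) = (if i = k then C else if i = Suc k then M1 (Cell 5 k 0) * M1 (Cell 5 (Suc k) 0) / C else M1 (Cell 5 i 0))"
      if "i \<le> d" for i
      using swap_basis_correct(3)[OF kd, of M1 i] that d k by (simp add: M2_def a_def C_def)
    note swap = lll_swap[where d = d and w = x and e = "1 / (K * K)" and V = "\<lambda>i l. M1 (Cell 3 i l)" and
        \<mu> = "\<lambda>i l. M1 (Cell 4 i l)" and c = "\<lambda>i. M1 (Cell 5 i 0)" and k = k and a = a and C = C,
        OF st1[unfolded lll_state_def] K2(2,3) k(2) a_def a C_def sw]
    have "lll_state d x (1 / (K * K)) M2" unfolding lll_state_def
      by (rule swap(1)) (rule V2 mu2 c2; assumption)+
    moreover have "energy d M2 \<le> 3 / 4 * energy d M1"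
      by (rule swap(2)[where V' = "\<lambda>i l. M2 (Cell 3 i l)" and \<mu>' = "\<lambda>i l. M2 (Cell 4 i l)"]) (rule V2 mu2 c2; assumption)+
    then have "energy d M2 \<le> 3 / 4 * energy d M" by (simp only: M1_5)
    moreover have "\<bar>M2 (Cell 4 i l)\<bar> \<le> 1 / (1 / (K * K))" if "i \<le> d" "l \<le> d" for i l
      by (rule swap(3)[where V' = "\<lambda>i l. M2 (Cell 3 i l)" and \<mu>' = "\<lambda>i l. M2 (Cell 4 i l)" and c' = "\<lambda>i. M2 (Cell 5 i 0)"])
        (rule V2 mu2 c2 mu1 that; assumption?)+
    then have "\<bar>M2 (Cell 4 i l)\<bar> \<le> K * K" if "i \<le> d" "l \<le> d" for i l using that by simp
    moreover have "M2 (Cell 6 3 0) = M (Cell 6 3 0)" unfolding M2_def M1_def by (simp add: run_frame)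
    ultimately show ?thesis
      unfolding run lll_ready_def using K Z True by simp
  qed
qed

text \<open>The first violated index triggers a swap and the loss of a quarter of the energy; later
  steps of the sweep never increase it. Without a violated index nothing happens at all.\<close>

lemma sweep_correct:
  assumes d: "d = nval dim_exp env" and ready: "lll_ready d x K M"
  shows "lll_ready d x K (run sweep env M)"
    "(run sweep env M = M \<and> reduced d M) \<or> (\<not> reduced d M \<and> energy d (run sweep env M) \<le> 3 / 4 * energy d M)"
proof -
  define P where "P s M' \<longleftrightarrow> lll_ready d x K M' \<and>
    ((M' = M \<and> (\<forall>k<s. M (Cell 5 k 0) \<le> 2 * M (Cell 5 (Suc k) 0))) \<or>
     (\<not> reduced d M \<and> energy d M' \<le> 3 / 4 * energy d M))" for s M'
  have "P d (iterate (\<lambda>s. run sweep_step (env(4 := s))) d M)"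
  proof (rule iterate_invariant[where P = P])
    show "P 0 M" using ready by (simp add: P_def)
  next
    fix s M' assume s: "s < d" and P: "P s M'"
    then have ready': "lll_ready d x K M'" by (simp add: P_def)
    have dim: "d = nval dim_exp (env(4 := s))" by (simp add: d)
    have 4: "(env(4 := s)) 4 = s" by simp
    define M'' where "M'' = run sweep_step (env(4 := s)) M'"
    note step = sweep_step_correct[OF dim ready' 4 s, folded M''_def, THEN conjunct1]
      sweep_step_correct[OF dim ready' 4 s, folded M''_def, THEN conjunct2]
    have nonneg: "0 \<le> energy d M'" by (rule energy_nonneg[OF ready'])
    have "(M'' = M \<and> (\<forall>k<Suc s. M (Cell 5 k 0) \<le> 2 * M (Cell 5 (Suc k) 0))) \<or>
       (\<not> reduced d M \<and> energy d M'' \<le> 3 / 4 * energy d M)"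
    proof (cases "M' = M \<and> (\<forall>k<s. M (Cell 5 k 0) \<le> 2 * M (Cell 5 (Suc k) 0))")
      case True
      then show ?thesis using step(2) s unfolding reduced_def less_Suc_eq by blast
    next
      case False
      then have "\<not> reduced d M" "energy d M' \<le> 3 / 4 * energy d M" using P unfolding P_def by blast+
      moreover have "energy d M'' \<le> energy d M'" using step(2) nonneg by auto
      ultimately show ?thesis by linarith
    qed
    with step(1) show "P (Suc s) (run sweep_step (env(4 := s)) M')" unfolding P_def M''_def[symmetric] by blast
  qed
  then have P: "P d (run sweep env M)" by (simp add: sweep_def d)
  then show "lll_ready d x K (run sweep env M)" by (simp add: P_def)
  from P show "(run sweep env M = M \<and> reduced d M) \<or> (\<not> reduced d M \<and> energy d (run sweep env M) \<le> 3 / 4 * energy d M)"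
    unfolding P_def reduced_def by blast
qed

definition sweeps_exp :: nexp where
  "sweeps_exp = NPlus (NTimes (NC 6) (NTimes bits_exp size_exp)) (NC 1)"

definition reduce_basis :: cmd where
  "reduce_basis = CFor 3 sweeps_exp sweep"

lemma writes_reduce_basis [simp]: "writes reduce_basis = {3, 4, 5, 7}"
  by (simp add: reduce_basis_def)

text \<open>As \<open>(3/4)^3 = 27/64\<close> is less than \<open>1 / 2\<close>, three sweeps gain
  one bit, and the least possible energy is \<open>2 * b * m\<close> bits below 1. The additional
  sweep makes the inequality strict.\<close>

lemma sweeps_enough: "(3 / 4 :: real) ^ (6 * (b * m) + 1) < (1 / (2 ^ b * 2 ^ b)) ^ m"
proof -
  have "(3 / 4 :: real) ^ (6 * (b * m) + 1) = 3 / 4 * ((3 / 4) ^ 3) ^ (2 * (b * m))"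
    by (simp add: power_mult[symmetric])
  also have "\<dots> \<le> 3 / 4 * (1 / 2) ^ (2 * (b * m))"
    by (intro mult_left_mono power_mono) (simp_all add: power3_eq_cube)
  also have "\<dots> < (1 / 2) ^ (2 * (b * m))" by simp
  also have "\<dots> = (1 / (2 ^ b * 2 ^ b)) ^ m"
  proof -
    have "2 * (b * m) = (b + b) * m" by simp
    then have "(1 / 2 :: real) ^ (2 * (b * m)) = ((1 / 2) ^ (b + b)) ^ m" by (simp only: power_mult)
    then show ?thesis by (simp add: power_add power_divide)
  qed
  finally show ?thesis .
qed

text \<open>A reduced basis is a fixed point of \<open>sweep\<close>. A basis still unreduced after
  all sweeps would have an energy below the lower bound of \<open>potential_ge\<close>.\<close>

lemma reduce_basis_correct:
  assumes d: "d = nval dim_exp env" and ready: "lll_ready d x K M"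
  shows "lll_ready d x K (run reduce_basis env M)" "reduced d (run reduce_basis env M)"
proof -
  let ?T = "6 * (bits d * Suc d) + 1"
  define P where "P t M' \<longleftrightarrow> lll_ready d x K M' \<and> (reduced d M' \<or> energy d M' \<le> (3 / 4) ^ t)" for t M'
  have st: "lll_inv d x (1 / (K * K)) (\<lambda>i l. M (Cell 3 i l)) (\<lambda>i l. M (Cell 4 i l)) (\<lambda>i. M (Cell 5 i 0))"
    using ready unfolding lll_ready_def lll_state_def by blast
  have "P ?T (iterate (\<lambda>s. run sweep (env(3 := s))) ?T M)"
  proof (rule iterate_invariant[where P = P])
    show "P 0 M" using ready potential_le_1[OF st lll_ready_K(2)[OF ready]] by (simp add: P_def)
  next
    fix t M' assume P: "P t M'"
    then have ready': "lll_ready d x K M'" by (simp add: P_def)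
    have dim: "d = nval dim_exp (env(3 := t))" by (simp add: d)
    note step = sweep_correct[OF dim ready']
    have "reduced d (run sweep (env(3 := t)) M') \<or> energy d (run sweep (env(3 := t)) M') \<le> (3 / 4) ^ Suc t"
    proof (cases "reduced d M'")
      case True
      then show ?thesis using step(2) by metis
    next
      case False
      then have "energy d M' \<le> (3 / 4) ^ t" using P unfolding P_def by blast
      then show ?thesis using step(2) False by auto
    qed
    then show "P (Suc t) (run sweep (env(3 := t)) M')" using step(1) unfolding P_def by blast
  qed
  moreover have "nval sweeps_exp env = ?T" by (simp add: sweeps_exp_def d)
  ultimately have P: "P ?T (run reduce_basis env M)" by (simp only: reduce_basis_def run.simps(4))
  then show ready': "lll_ready d x K (run reduce_basis env M)" by (simp only: P_def)
  have "(1 / (K * K)) ^ Suc d \<le> energy d (run reduce_basis env M)"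
    using ready' lll_ready_K(2)[OF ready'] by (intro potential_ge) (auto simp: lll_ready_def lll_state_def)
  moreover have "(3 / 4) ^ ?T < (1 / (K * K)) ^ Suc d"
    using sweeps_enough[of "bits d" "Suc d"] ready by (simp only: lll_ready_def)
  ultimately show "reduced d (run reduce_basis env M)" using P unfolding P_def by linarith
qed

section \<open>The initial basis\<close>

definition clear_cell :: cmd where
  "clear_cell = CSet (LCell 3 (NV 5) (NV 7)) (RC 0) ;; CSet (LCell 4 (NV 5) (NV 7)) (RC 0)"

definition unit_row :: cmd where
  "unit_row = CFor 7 size_exp clear_cell ;;
     CSet (LCell 3 (NV 5) (NV 5)) (RC 1) ;; CSet (LCell 4 (NV 5) (NV 5)) (RC 1) ;; CSet (LCell 5 (NV 5) (NC 0)) (RC 1)"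

definition last_row_cell :: cmd where
  "last_row_cell = CSet (LCell 3 dim_exp (NV 7)) (RL (LCell 2 (NV 7) (NC 0))) ;;
     CSet (LCell 4 dim_exp (NV 7)) (RL (LCell 2 (NV 7) (NC 0)))"

definition init_basis :: cmd where
  "init_basis = CFor 5 size_exp unit_row ;; CFor 7 dim_exp last_row_cell ;;
     CSet (LCell 5 dim_exp (NC 0)) (RL (cnst 1))"

lemma writes_init_basis [simp]: "writes init_basis = {3, 4, 5}" "writes unit_row = {3, 4, 5}" "writes last_row_cell = {3, 4}"
  by (auto simp: init_basis_def unit_row_def clear_cell_def last_row_cell_def)

lemma unit_row_correct:
  assumes "env 5 = r"
  shows "a = 3 \<or> a = 4 \<Longrightarrow> l \<le> nval dim_exp env \<Longrightarrow>
      run unit_row env M (Cell a i l) = (if i = r then if l = r then 1 else 0 else M (Cell a i l))"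
    "run unit_row env M (Cell 5 i 0) = (if i = r then 1 else M (Cell 5 i 0))"
proof -
  define d where "d = nval dim_exp env"
  define M1 where "M1 = run (CFor 7 size_exp clear_cell) env M"
  define P where "P s M' \<longleftrightarrow> (\<forall>a\<in>{3, 4}. \<forall>i l. M' (Cell a i l) = (if i = r \<and> l < s then 0 else M (Cell a i l)))" for s M'
  have "P (Suc d) (iterate (\<lambda>s. run clear_cell (env(7 := s))) (Suc d) M)"
  proof (rule iterate_invariant[where P = P])
    show "P 0 M" by (simp add: P_def)
    fix s M' assume "P s M'"
    then show "P (Suc s) (run clear_cell (env(7 := s)) M')"
      using assms by (simp add: P_def clear_cell_def less_Suc_eq)
  qed
  then have P: "P (Suc d) M1" by (simp add: M1_def d_def)
  have M1_5: "M1 (Cell 5 i 0) = M (Cell 5 i 0)" for i unfolding M1_def by (rule run_frame) (simp add: clear_cell_def)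
  have run: "run unit_row env M = M1(Cell 3 r r := 1, Cell 4 r r := 1, Cell 5 r 0 := 1)"
    unfolding unit_row_def run.simps(2)[of "CFor _ _ _"] M1_def[symmetric] using assms by simp
  show "a = 3 \<or> a = 4 \<Longrightarrow> l \<le> nval dim_exp env \<Longrightarrow>
      run unit_row env M (Cell a i l) = (if i = r then if l = r then 1 else 0 else M (Cell a i l))"
    unfolding run using P by (auto simp: P_def d_def)
  show "run unit_row env M (Cell 5 i 0) = (if i = r then 1 else M (Cell 5 i 0))"
    unfolding run using M1_5 by simp
qed

lemma init_basis_correct:
  fixes env M
  defines "d \<equiv> nval dim_exp env"
  shows "a = 3 \<or> a = 4 \<Longrightarrow> i \<le> d \<Longrightarrow> l \<le> d \<Longrightarrow>
      run init_basis env M (Cell a i l) = (if i = l then 1 else if i = d then M (Cell 2 l 0) else 0)"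
    "i \<le> d \<Longrightarrow> run init_basis env M (Cell 5 i 0) = weight d (M (Cell 6 1 0)) i"
proof -
  define M1 where "M1 = run (CFor 5 size_exp unit_row) env M"
  define P where "P s M' \<longleftrightarrow> (\<forall>i<s. (\<forall>l\<le>d. M' (Cell 3 i l) = (if i = l then 1 else 0) \<and> M' (Cell 4 i l) = (if i = l then 1 else 0))
    \<and> M' (Cell 5 i 0) = 1)" for s and M' :: "addr \<Rightarrow> real"
  have "P (Suc d) (iterate (\<lambda>s. run unit_row (env(5 := s))) (Suc d) M)"
  proof (rule iterate_invariant[where P = P])
    show "P 0 M" by (simp add: P_def)
    fix s M' assume P: "P s M'"
    have 5: "(env(5 := s)) 5 = s" by simp
    have dim: "d = nval dim_exp (env(5 := s))" by (simp add: d_def)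
    note unit = unit_row_correct[of "env(5 := s)" s, OF 5, folded dim]
    show "P (Suc s) (run unit_row (env(5 := s)) M')"
      unfolding P_def using P by (auto simp: unit P_def less_Suc_eq)
  qed
  then have P: "P (Suc d) M1" by (simp add: M1_def d_def)
  have M1: "M1 (Cell 2 l 0) = M (Cell 2 l 0)" "M1 (Cell 6 1 0) = M (Cell 6 1 0)" for l
    unfolding M1_def by (subst run_frame; simp)+
  define M2 where "M2 = run (CFor 7 dim_exp last_row_cell) env M1"
  define Q where "Q s M' \<longleftrightarrow> (\<forall>a\<in>{3, 4}. \<forall>i l. M' (Cell a i l) =
    (if i = d \<and> l < s then M (Cell 2 l 0) else M1 (Cell a i l)))" for s M'
  have Q: "(\<lambda>s M'. Q s M' \<and> (\<forall>l. M' (Cell 2 l 0) = M (Cell 2 l 0))) d (iterate (\<lambda>s. run last_row_cell (env(7 := s))) d M1)"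
  proof (rule iterate_invariant[where P = "\<lambda>s M'. Q s M' \<and> (\<forall>l. M' (Cell 2 l 0) = M (Cell 2 l 0))"])
    show "Q 0 M1 \<and> (\<forall>l. M1 (Cell 2 l 0) = M (Cell 2 l 0))" using M1 by (simp add: Q_def)
    fix s M' assume "Q s M' \<and> (\<forall>l. M' (Cell 2 l 0) = M (Cell 2 l 0))"
    then show "Q (Suc s) (run last_row_cell (env(7 := s)) M') \<and> (\<forall>l. run last_row_cell (env(7 := s)) M' (Cell 2 l 0) = M (Cell 2 l 0))"
      by (simp add: Q_def last_row_cell_def less_Suc_eq d_def[symmetric])
  qed
  have Q: "Q d M2" using Q by (simp add: M2_def d_def)
  have M2: "M2 (Cell 5 i 0) = M1 (Cell 5 i 0)" "M2 (Cell 6 1 0) = M1 (Cell 6 1 0)" for i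
    unfolding M2_def by (subst run_frame; simp)+
  have run: "run init_basis env M = M2(Cell 5 d 0 := M (Cell 6 1 0))"
    unfolding init_basis_def run.simps(2) M1_def[symmetric] M2_def[symmetric] using M2(2) M1(2) by (simp add: d_def)
  show "a = 3 \<or> a = 4 \<Longrightarrow> i \<le> d \<Longrightarrow> l \<le> d \<Longrightarrow>
      run init_basis env M (Cell a i l) = (if i = l then 1 else if i = d then M (Cell 2 l 0) else 0)"
    unfolding run using P Q by (auto simp: P_def Q_def)
  show "i \<le> d \<Longrightarrow> run init_basis env M (Cell 5 i 0) = weight d (M (Cell 6 1 0)) i"
    unfolding run using P M2 by (auto simp: P_def weight_def)
qed

section \<open>Normalisation, sign of the multiplier, appending a digit\<close>

definition max_step :: cmd where
  "max_step =
     CIf (RL (work 5)) (RL (LCell 2 (NV 7) (NC 0))) (CSet (work 5) (RL (LCell 2 (NV 7) (NC 0)))) ;;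
     CIf (RL (work 5)) (rsub (RC 0) (RL (LCell 2 (NV 7) (NC 0)))) (CSet (work 5) (rsub (RC 0) (RL (LCell 2 (NV 7) (NC 0)))))"

definition max_modulus :: cmd where
  "max_modulus = CSet (work 5) (RC 0) ;; CFor 7 dim_exp max_step"

lemma writes_max_modulus [simp]: "writes max_modulus = {7}"
  by (auto simp: max_modulus_def max_step_def)

text \<open>That the maximum is attained matters: after scaling, such a coordinate has modulus 1,
  and the approximation reproduces it without remainder.\<close>

lemma max_modulus_correct:
  fixes env M
  defines "mx \<equiv> run max_modulus env M (Cell 7 5 0)" and "d \<equiv> nval dim_exp env"
  shows "0 \<le> mx" "\<forall>l<d. \<bar>M (Cell 2 l 0)\<bar> \<le> mx" "mx = 0 \<or> (\<exists>l<d. \<bar>M (Cell 2 l 0)\<bar> = mx)"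
proof -
  define P where "P s M' \<longleftrightarrow> (\<forall>l. M' (Cell 2 l 0) = M (Cell 2 l 0)) \<and> 0 \<le> M' (Cell 7 5 0) \<and>
    (\<forall>l<s. \<bar>M (Cell 2 l 0)\<bar> \<le> M' (Cell 7 5 0)) \<and>
    (M' (Cell 7 5 0) = 0 \<or> (\<exists>l<s. \<bar>M (Cell 2 l 0)\<bar> = M' (Cell 7 5 0)))" for s M'
  have "P d (iterate (\<lambda>s. run max_step (env(7 := s))) d (M(Cell 7 5 0 := 0)))"
  proof (rule iterate_invariant[where P = P])
    show "P 0 (M(Cell 7 5 0 := 0))" by (simp add: P_def)
    fix s M' assume P: "P s M'"
    define M'' where "M'' = run max_step (env(7 := s)) M'"
    define y where "y = M' (Cell 7 5 0)"
    have x: "M' (Cell 2 l 0) = M (Cell 2 l 0)" for l using P by (simp add: P_def)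
    have 1: "M'' (Cell 2 l 0) = M (Cell 2 l 0)" for l unfolding M''_def by (subst run_frame) (simp_all add: max_step_def x)
    have y: "0 \<le> y" "\<forall>l<s. \<bar>M (Cell 2 l 0)\<bar> \<le> y" "y = 0 \<or> (\<exists>l<s. \<bar>M (Cell 2 l 0)\<bar> = y)"
      using P by (simp_all add: P_def y_def)
    have 2: "M'' (Cell 7 5 0) = max y \<bar>M (Cell 2 s 0)\<bar>"
      unfolding M''_def using y(1) by (simp add: max_step_def x y_def[symmetric] max_def abs_if)
    show "P (Suc s) M''"
    proof (cases "\<bar>M (Cell 2 s 0)\<bar> \<le> y")
      case True
      then show ?thesis using 1 2 y by (auto simp: P_def less_Suc_eq)
    next
      case False
      then show ?thesis using 1 2 y unfolding P_def less_Suc_eq max_def by (auto intro: order_trans)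
    qed
  qed
  then have P: "P d (run max_modulus env M)" by (simp add: max_modulus_def d_def)
  then show "0 \<le> mx" "\<forall>l<d. \<bar>M (Cell 2 l 0)\<bar> \<le> mx" "mx = 0 \<or> (\<exists>l<d. \<bar>M (Cell 2 l 0)\<bar> = mx)"
    unfolding P_def mx_def by blast+
qed

definition scale_cell :: cmd where
  "scale_cell = CSet (LCell 2 (NV 7) (NC 0)) (rdiv (RL (LCell 2 (NV 7) (NC 0))) (RL (work 5)))"

lemma scale_correct:
  "l < nval dim_exp env \<Longrightarrow> run (CFor 7 dim_exp scale_cell) env M (Cell 2 l 0) = M (Cell 2 l 0) / M (Cell 7 5 0)"
proof -
  define P where "P s M' \<longleftrightarrow> (\<forall>l. M' (Cell 2 l 0) = (if l < s then M (Cell 2 l 0) / M (Cell 7 5 0) else M (Cell 2 l 0))) \<and>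
    M' (Cell 7 5 0) = M (Cell 7 5 0)" for s M'
  have "P (nval dim_exp env) (iterate (\<lambda>s. run scale_cell (env(7 := s))) (nval dim_exp env) M)"
    by (rule iterate_invariant[where P = P]) (auto simp: P_def scale_cell_def less_Suc_eq)
  then show "l < nval dim_exp env \<Longrightarrow> run (CFor 7 dim_exp scale_cell) env M (Cell 2 l 0) = M (Cell 2 l 0) / M (Cell 7 5 0)"
    by (simp add: P_def)
qed

definition negate_cell :: cmd where
  "negate_cell = CSet (LCell 3 (NC 0) (NV 7)) (rsub (RC 0) (RL (LCell 3 (NC 0) (NV 7))))"

text \<open>Signs survive multiplication by \<open>q\<close> only for positive \<open>q\<close>;
  negating the whole lattice vector achieves this and keeps every estimate.\<close>

definition fix_sign :: cmd where
  "fix_sign = CIf (RL (LCell 3 (NC 0) dim_exp)) (RC 0) (CFor 7 size_exp negate_cell)"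

lemma fix_sign_correct:
  assumes "l \<le> nval dim_exp env"
  shows "run fix_sign env M (Cell 3 0 l) = (if M (Cell 3 0 (nval dim_exp env)) < 0 then - M (Cell 3 0 l) else M (Cell 3 0 l))"
proof -
  define P where "P s M' \<longleftrightarrow> (\<forall>l. M' (Cell 3 0 l) = (if l < s then - M (Cell 3 0 l) else M (Cell 3 0 l)))" for s M'
  let ?n = "Suc (nval dim_exp env)"
  have "P ?n (iterate (\<lambda>s. run negate_cell (env(7 := s))) ?n M)"
    by (rule iterate_invariant[where P = P]) (auto simp: P_def negate_cell_def less_Suc_eq)
  moreover have "run (CFor 7 size_exp negate_cell) env M = iterate (\<lambda>s. run negate_cell (env(7 := s))) ?n M" by simp
  ultimately have "P ?n (run (CFor 7 size_exp negate_cell) env M)" by (simp only:)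
  then show ?thesis using assms by (simp add: fix_sign_def P_def)
qed

definition accumulate_cell :: cmd where
  "accumulate_cell =
     CSet (LCell 1 (NV 7) (NC 0)) (radd (rmul (RL (cnst 2)) (RL (LCell 1 (NV 7) (NC 0))))
       (rsub (rmul (RL (LCell 3 (NC 0) dim_exp)) (RL (LCell 2 (NV 7) (NC 0)))) (RL (LCell 3 (NC 0) (NV 7))))) ;;
     CSet (LCell 2 (NV 7) (NC 0)) (RL (LCell 3 (NC 0) (NV 7)))"

lemma accumulate_correct:
  fixes env M
  defines "M' \<equiv> run (CFor 7 dim_exp accumulate_cell) env M" and "d \<equiv> nval dim_exp env"
  assumes "l < d"
  shows "M' (Cell 1 l 0) = M (Cell 6 2 0) * M (Cell 1 l 0) + (M (Cell 3 0 d) * M (Cell 2 l 0) - M (Cell 3 0 l))"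
    "M' (Cell 2 l 0) = M (Cell 3 0 l)"
proof -
  define P where "P s M' \<longleftrightarrow> (\<forall>l. M' (Cell 1 l 0) = (if l < s then
      M (Cell 6 2 0) * M (Cell 1 l 0) + (M (Cell 3 0 d) * M (Cell 2 l 0) - M (Cell 3 0 l)) else M (Cell 1 l 0))) \<and>
    (\<forall>l. M' (Cell 2 l 0) = (if l < s then M (Cell 3 0 l) else M (Cell 2 l 0))) \<and>
    (\<forall>l. M' (Cell 3 0 l) = M (Cell 3 0 l)) \<and> M' (Cell 6 2 0) = M (Cell 6 2 0)" for s M'
  have "P d (iterate (\<lambda>s. run accumulate_cell (env(7 := s))) d M)"
  proof (rule iterate_invariant[where P = P])
    show "P 0 M" by (simp add: P_def)
    fix s M' assume "P s M'"
    then show "P (Suc s) (run accumulate_cell (env(7 := s)) M')"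
      by (simp add: P_def accumulate_cell_def less_Suc_eq d_def[symmetric])
  qed
  then have "P d M'" by (simp add: M'_def d_def)
  then show "M' (Cell 1 l 0) = M (Cell 6 2 0) * M (Cell 1 l 0) + (M (Cell 3 0 d) * M (Cell 2 l 0) - M (Cell 3 0 l))"
    "M' (Cell 2 l 0) = M (Cell 3 0 l)" using assms(3) by (simp_all add: P_def)
qed

section \<open>One round of simultaneous approximation\<close>

definition reduction_round :: cmd where
  "reduction_round = max_modulus ;;
     CIf (RC 0) (RL (work 5))
       (CFor 7 dim_exp scale_cell ;; init_basis ;; reduce_basis ;; fix_sign ;; CFor 7 dim_exp accumulate_cell)"

text \<open>Cell 2 is the base of the positional system. It exceeds \<open>2^(d+1) * 2K\<close>, the
  bound on \<open>\<bar>P v\<bar>\<close> for digits of size \<open>2K\<close> and vectors of 1-norm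
  at most \<open>2^(d+1)\<close>.\<close>

definition consts_ok :: "nat \<Rightarrow> (addr \<Rightarrow> real) \<Rightarrow> bool" where
  "consts_ok d M \<longleftrightarrow> M (Cell 6 1 0) = 1 / (2 ^ bits d * 2 ^ bits d) \<and> M (Cell 6 2 0) = 2 ^ bits d * 2 ^ (d + 3) \<and>
     M (Cell 6 3 0) = 2 ^ bits d * 2 ^ bits d * 2 ^ Suc d"

lemma writes_reduction_round: "6 \<notin> writes reduction_round"
  by (auto simp: reduction_round_def scale_cell_def fix_sign_def negate_cell_def accumulate_cell_def)

text \<open>After \<open>k\<close> rounds the remainder, kept in array 2, has at least \<open>k\<close> zero coordinates.\<close>

definition rounds_inv :: "nat \<Rightarrow> (nat \<Rightarrow> real) \<Rightarrow> nat \<Rightarrow> (addr \<Rightarrow> real) \<Rightarrow> bool" where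
  "rounds_inv d w k M \<longleftrightarrow> consts_ok d M \<and>
     reduced_to d (2 ^ (d + 1)) w (\<lambda>l. M (Cell 1 l 0)) (\<lambda>l. M (Cell 2 l 0)) \<and>
     card {l. l < d \<and> M (Cell 2 l 0) \<noteq> 0} \<le> d - k \<and>
     (\<forall>l<d. \<bar>M (Cell 1 l 0)\<bar> \<le> (2 ^ bits d * 2 ^ (d + 3)) ^ k - 1)"

lemma reduction_round_correct:
  assumes d: "d = nval dim_exp env" and inv: "rounds_inv d w k M"
  shows "rounds_inv d w (Suc k) (run reduction_round env M)"
proof -
  define K :: real where "K = 2 ^ bits d"
  define T :: real where "T = K * 2 ^ (d + 3)"
  define \<Delta> :: int where "\<Delta> = 2 ^ (d + 1)"
  have K1: "1 \<le> K" unfolding K_def by simp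
  have p1: "(1 :: real) \<le> 2 ^ d" by simp
  have "K * 1 \<le> K * 2 ^ d" using K1 p1 by (intro mult_left_mono) auto
  moreover have "T = 8 * (K * 2 ^ d)" by (simp add: T_def power_add)
  \<comment> \<open>With \<open>2 * K + 1 \<le> T\<close> the size bound \<open>T ^ k - 1\<close>
    reproduces itself: \<open>T * (T ^ k - 1) + 2 * K \<le> T ^ Suc k - 1\<close>.\<close>
  ultimately have T: "2 * K + 1 \<le> T" "1 \<le> T" using K1 by linarith+
  define M1 where "M1 = run max_modulus env M"
  define mx where "mx = M1 (Cell 7 5 0)"
  note mx = max_modulus_correct[of env M, folded M1_def, folded mx_def, folded d]
  have M1: "M1 y = M y" if "array_of y \<noteq> 7" for y unfolding M1_def using that by (subst run_frame) auto
  have cst: "consts_ok d M" and red: "reduced_to d \<Delta> w (\<lambda>l. M (Cell 1 l 0)) (\<lambda>l. M (Cell 2 l 0))"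
    and card: "card {l. l < d \<and> M (Cell 2 l 0) \<noteq> 0} \<le> d - k"
    and W: "\<forall>l<d. \<bar>M (Cell 1 l 0)\<bar> \<le> T ^ k - 1"
    using inv unfolding rounds_inv_def \<Delta>_def T_def K_def by blast+
  have cst': "consts_ok d (run reduction_round env M)"
    using cst writes_reduction_round run_frame[of "Cell 6 _ 0" reduction_round env M] by (simp add: consts_ok_def)
  have goal: "rounds_inv d w (Suc k) (run reduction_round env M)"
    if "reduced_to d \<Delta> w (\<lambda>l. run reduction_round env M (Cell 1 l 0)) (\<lambda>l. run reduction_round env M (Cell 2 l 0))"
      "card {l. l < d \<and> run reduction_round env M (Cell 2 l 0) \<noteq> 0} \<le> d - Suc k"
      "\<forall>l<d. \<bar>run reduction_round env M (Cell 1 l 0)\<bar> \<le> T ^ Suc k - 1"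
    using that cst' unfolding rounds_inv_def \<Delta>_def T_def K_def by blast
  show ?thesis
  proof (cases "0 < mx")
    case False
    then have run: "run reduction_round env M = M1" by (simp add: reduction_round_def M1_def mx_def)
    \<comment> \<open>The remainder is already 0, so the round may leave everything as it is; the
      guard also avoids the division by zero in the scaling.\<close>
    have x0: "M (Cell 2 l 0) = 0" if "l < d" for l using mx(1) mx(2)[rule_format, OF that] False by linarith
    then have "{l. l < d \<and> M (Cell 2 l 0) \<noteq> 0} = {}" by blast
    then have "card {l. l < d \<and> M (Cell 2 l 0) \<noteq> 0} \<le> d - Suc k" by (simp only: card.empty le0)
    moreover have "T ^ k \<le> T ^ Suc k" using T by (intro power_increasing) auto
    ultimately show ?thesis
      using red W M1 by (intro goal) (auto simp: run M1 intro: order_trans)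
  next
    case True
    define M2 where "M2 = run (CFor 7 dim_exp scale_cell) env M1"
    define M3 where "M3 = run init_basis env M2"
    define M4 where "M4 = run reduce_basis env M3"
    define M5 where "M5 = run fix_sign env M4"
    define M6 where "M6 = run (CFor 7 dim_exp accumulate_cell) env M5"
    have run: "run reduction_round env M = M6"
      using True by (simp add: reduction_round_def M1_def[symmetric] mx_def[symmetric]
          M2_def M3_def M4_def M5_def M6_def)
    define x where "x l = M (Cell 2 l 0) / mx" for l
    have x2: "M2 (Cell 2 l 0) = x l" if "l < d" for l
      unfolding M2_def using scale_correct[of l env M1] that by (simp add: x_def d M1 mx_def)
    have M2: "M2 y = M y" if "array_of y \<noteq> 7" "array_of y \<noteq> 2" for y
      unfolding M2_def using that M1 by (subst run_frame) (auto simp: scale_cell_def)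
    have M3: "M3 y = M2 y" if "array_of y \<notin> {3, 4, 5}" for y
      unfolding M3_def using that by (subst run_frame) auto
    have M4: "M4 y = M3 y" if "array_of y \<notin> {3, 4, 5, 7}" for y
      unfolding M4_def using that by (subst run_frame) auto
    have M5: "M5 y = M4 y" if "array_of y \<noteq> 3" for y
      unfolding M5_def using that by (subst run_frame) (auto simp: fix_sign_def negate_cell_def)
    have x1: "\<bar>x l\<bar> \<le> 1" if "l < d" for l
      using mx(2) that True by (auto simp: x_def divide_le_eq)
    have red1: "reduced_to d \<Delta> w (\<lambda>l. M (Cell 1 l 0)) x"
      using red by (rule reduced_to_cong[where r = "1 / mx"]) (use True in \<open>auto simp: x_def\<close>)
    have M2_e: "M2 (Cell 6 1 0) = 1 / (K * K)" "M2 (Cell 6 3 0) = K * K * 2 ^ Suc d"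
      using cst M2[of "Cell 6 1 0"] M2[of "Cell 6 3 0"] by (simp_all add: consts_ok_def K_def)
    have KK: "1 \<le> K * K" using mult_mono[OF K1 K1] K1 by simp
    have M3_rows: "M3 (Cell a i l) = (if i = l then 1 else if i = d then x l else 0)"
      if "a = 3 \<or> a = 4" "i \<le> d" "l \<le> d" for a i l
      using init_basis_correct(1)[of a i env l M2] that x2[of l] unfolding M3_def d[symmetric] by auto
    have "lll_inv d x (1 / (K * K)) (\<lambda>i l. M3 (Cell 3 i l)) (\<lambda>i l. M3 (Cell 4 i l)) (\<lambda>i. M3 (Cell 5 i 0))"
    proof (rule lll_inv_init)
      show "0 < 1 / (K * K)" "1 / (K * K) \<le> 1" using KK by (auto simp: divide_le_eq)
      show "M3 (Cell 5 i 0) = weight d (1 / (K * K)) i" if "i \<le> d" for i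
        using init_basis_correct(2)[of i env M2] that M2_e unfolding M3_def d[symmetric] by simp
    qed (use M3_rows in auto)
    moreover have "\<bar>M3 (Cell 4 i l)\<bar> \<le> K * K" if "i \<le> d" "l \<le> d" for i l
      using M3_rows[of 4 i l] that x1[of l] KK by auto
    moreover have "M3 (Cell 6 3 0) = K * K * 2 ^ Suc d" using M3[of "Cell 6 3 0"] M2_e by simp
    ultimately have ready: "lll_ready d x K M3" by (simp add: lll_ready_def lll_state_def K_def)
    have "lll_inv d x (1 / (K * K)) (\<lambda>i l. M4 (Cell 3 i l)) (\<lambda>i l. M4 (Cell 4 i l)) (\<lambda>i. M4 (Cell 5 i 0))"
      using reduce_basis_correct(1)[OF d ready] unfolding M4_def lll_ready_def lll_state_def by blast
    moreover have "K = (2 ^ (2 * d + 2)) ^ Suc d" unfolding K_def bits_def by (simp only: power_mult Suc_eq_plus1)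
    moreover have "M4 (Cell 5 k 0) \<le> 2 * M4 (Cell 5 (Suc k) 0)" if "k < d" for k
      using reduce_basis_correct(2)[OF d ready] that unfolding M4_def reduced_def by blast
    ultimately have fv: "\<And>l. l < d \<Longrightarrow> \<bar>M4 (Cell 3 0 l)\<bar> \<le> 1 / 2 ^ (d + 2)" "M4 (Cell 3 0 d) \<noteq> 0"
        "\<And>l. l < d \<Longrightarrow> M4 (Cell 3 0 d) * x l - M4 (Cell 3 0 l) \<in> \<int>"
        "\<And>l. l < d \<Longrightarrow> \<bar>M4 (Cell 3 0 d) * x l - M4 (Cell 3 0 l)\<bar> \<le> 2 * K"
        "\<And>l. l < d \<Longrightarrow> \<bar>x l\<bar> = 1 \<or> x l = 0 \<Longrightarrow> M4 (Cell 3 0 l) = 0"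
      using first_vector_approximates[of d x K "\<lambda>i l. M4 (Cell 3 i l)" "\<lambda>i l. M4 (Cell 4 i l)" "\<lambda>i. M4 (Cell 5 i 0)"] K1 x1
      by blast+
    define \<rho> where "\<rho> l = M5 (Cell 3 0 l)" for l
    define \<sigma> :: real where "\<sigma> = (if M4 (Cell 3 0 d) < 0 then -1 else 1)"
    have \<rho>: "\<rho> l = \<sigma> * M4 (Cell 3 0 l)" if "l \<le> d" for l
      using fix_sign_correct[of l env M4] that unfolding \<rho>_def M5_def \<sigma>_def d[symmetric] by simp
    have \<sigma>: "\<bar>\<sigma>\<bar> = 1" "\<sigma> \<in> \<int>" by (simp_all add: \<sigma>_def)
    have q: "0 < \<rho> d" using fv(2) \<rho>[of d] by (auto simp: \<sigma>_def)
    define P where "P l = \<rho> d * x l - \<rho> l" for l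
    have P: "P l = \<sigma> * (M4 (Cell 3 0 d) * x l - M4 (Cell 3 0 l))" if "l < d" for l
      using \<rho>[of d] \<rho>[of l] that by (simp add: P_def algebra_simps)
    have PB: "\<bar>P l\<bar> \<le> 2 * K" if "l < d" for l
      using fv(4)[OF that] by (simp add: P[OF that] abs_mult \<sigma>)
    have W6: "M6 (Cell 1 l 0) = T * M (Cell 1 l 0) + P l" "M6 (Cell 2 l 0) = \<rho> l" if l: "l < d" for l
    proof -
      have "M5 (Cell 6 2 0) = T" using M5[of "Cell 6 2 0"] M4[of "Cell 6 2 0"] M3[of "Cell 6 2 0"] M2[of "Cell 6 2 0"] cst
        by (simp add: consts_ok_def T_def K_def)
      moreover have "M5 (Cell 1 l 0) = M (Cell 1 l 0)"
        using M5[of "Cell 1 l 0"] M4[of "Cell 1 l 0"] M3[of "Cell 1 l 0"] M2[of "Cell 1 l 0"] by simp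
      moreover have "M5 (Cell 2 l 0) = x l" using M5[of "Cell 2 l 0"] M4[of "Cell 2 l 0"] M3[of "Cell 2 l 0"] x2[OF l] by simp
      ultimately show "M6 (Cell 1 l 0) = T * M (Cell 1 l 0) + P l" "M6 (Cell 2 l 0) = \<rho> l"
        using accumulate_correct[of l env M5] l unfolding M6_def d[symmetric] P_def \<rho>_def by simp_all
    qed
    show ?thesis
    proof (rule goal)
      have "reduced_to d \<Delta> w (\<lambda>l. M6 (Cell 1 l 0)) \<rho>"
      proof (rule reduced_to_step[OF red1 q, where P = P and \<eta> = "1 / 2 ^ (d + 2)" and B = "2 * K" and M = T])
        show "\<rho> d * x l = P l + \<rho> l" for l by (simp add: P_def)
        show "P l \<in> \<int>" if "l < d" for l unfolding P[OF that] by (intro Ints_mult \<sigma> fv(3) that)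
        show "\<bar>\<rho> l\<bar> \<le> 1 / 2 ^ (d + 2)" if "l < d" for l
          using \<rho>[of l] fv(1)[OF that] that by (simp add: abs_mult \<sigma>)
        \<comment> \<open>The product is exactly \<open>1 / 2\<close>: the exponent
          \<open>d + 2\<close> of the approximation is matched to the norm bound
          \<open>2 ^ (d + 1)\<close>.\<close>
        show "of_int \<Delta> * (1 / 2 ^ (d + 2)) < (1 :: real)" by (simp add: \<Delta>_def)
        show "of_int \<Delta> * (2 * K) < T" using K1 by (simp add: \<Delta>_def T_def power_add)
        show "T \<in> \<int>" by (simp add: T_def K_def)
      qed (use PB W6(1) K1 in auto)
      then show "reduced_to d \<Delta> w (\<lambda>l. run reduction_round env M (Cell 1 l 0)) (\<lambda>l. run reduction_round env M (Cell 2 l 0))"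
        unfolding run by (rule reduced_to_cong[where r = 1]) (use W6(2) in auto)
      \<comment> \<open>Coordinate \<open>l0\<close> has maximal modulus and becomes 0, while zero
        coordinates stay 0, so the support of the remainder shrinks strictly.\<close>
      obtain l0 where l0: "l0 < d" "\<bar>M (Cell 2 l0 0)\<bar> = mx" using mx(3) True by auto
      then have "\<bar>x l0\<bar> = 1" using True by (simp add: x_def)
      then have \<rho>0: "\<rho> l0 = 0" using fv(5)[OF l0(1)] \<rho>[of l0] l0 by simp
      have "{l. l < d \<and> \<rho> l \<noteq> 0} \<subset> {l. l < d \<and> M (Cell 2 l 0) \<noteq> 0}"
      proof
        show "{l. l < d \<and> \<rho> l \<noteq> 0} \<subseteq> {l. l < d \<and> M (Cell 2 l 0) \<noteq> 0}"
        proof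
          fix l assume l: "l \<in> {l. l < d \<and> \<rho> l \<noteq> 0}"
          then have "x l \<noteq> 0" using fv(5)[of l] \<rho>[of l] by auto
          then show "l \<in> {l. l < d \<and> M (Cell 2 l 0) \<noteq> 0}" using l by (auto simp: x_def)
        qed
        show "{l. l < d \<and> \<rho> l \<noteq> 0} \<noteq> {l. l < d \<and> M (Cell 2 l 0) \<noteq> 0}" using l0 \<rho>0 True by force
      qed
      then have "card {l. l < d \<and> \<rho> l \<noteq> 0} < card {l. l < d \<and> M (Cell 2 l 0) \<noteq> 0}"
        by (intro psubset_card_mono) auto
      moreover have "{l. l < d \<and> run reduction_round env M (Cell 2 l 0) \<noteq> 0} = {l. l < d \<and> \<rho> l \<noteq> 0}"
        using W6(2) by (auto simp: run)
      then have "card {l. l < d \<and> run reduction_round env M (Cell 2 l 0) \<noteq> 0} = card {l. l < d \<and> \<rho> l \<noteq> 0}"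
        by (simp only:)
      ultimately show "card {l. l < d \<and> run reduction_round env M (Cell 2 l 0) \<noteq> 0} \<le> d - Suc k" using card by arith
      show "\<forall>l<d. \<bar>run reduction_round env M (Cell 1 l 0)\<bar> \<le> T ^ Suc k - 1"
      proof (intro allI impI)
        fix l assume l: "l < d"
        have "\<bar>T * M (Cell 1 l 0)\<bar> \<le> T * (T ^ k - 1)"
          unfolding abs_mult using W l T by (intro mult_mono) auto
        then have "\<bar>T * M (Cell 1 l 0) + P l\<bar> \<le> T * (T ^ k - 1) + 2 * K" using PB[OF l] by linarith
        also have "\<dots> \<le> T ^ Suc k - 1" using T by (simp add: algebra_simps)
        finally show "\<bar>run reduction_round env M (Cell 1 l 0)\<bar> \<le> T ^ Suc k - 1" using W6(1)[OF l] by (simp add: run)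
      qed
    qed
  qed
qed

section \<open>Constants, input and output\<close>

definition double :: "nat \<Rightarrow> cmd" where
  "double s = CSet (cnst s) (radd (RL (cnst s)) (RL (cnst s)))"

lemma double_correct:
  "run (CFor 2 e (double s)) env M = M(Cell 6 s 0 := M (Cell 6 s 0) * 2 ^ nval e env)"
proof -
  have "iterate (\<lambda>i. run (double s) (env(2 := i))) n M = M(Cell 6 s 0 := M (Cell 6 s 0) * 2 ^ n)" for n
    by (induction n) (auto simp: iterate.simps(2) double_def fun_eq_iff mult.left_commute)
  then show ?thesis by simp
qed

definition init_constants :: cmd where
  "init_constants = CSet (cnst 0) (RC 1) ;; CFor 2 bits_exp (double 0) ;;
     CSet (cnst 1) (rdiv (RC 1) (rmul (RL (cnst 0)) (RL (cnst 0)))) ;;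
     CSet (cnst 2) (RL (cnst 0)) ;; CFor 2 (NPlus dim_exp (NC 3)) (double 2) ;;
     CSet (cnst 3) (rmul (RL (cnst 0)) (RL (cnst 0))) ;; CFor 2 size_exp (double 3)"

definition load_cell :: cmd where
  "load_cell = CSet (LCell 2 (NV 7) (NC 0)) (RL (LDirect (NV 7))) ;; CSet (LCell 1 (NV 7) (NC 0)) (RC 0)"

definition store_cell :: cmd where
  "store_cell = CSet (LDirect (NV 7)) (RL (LCell 1 (NV 7) (NC 0)))"

definition reduction :: cmd where
  "reduction = init_constants ;; CFor 7 dim_exp load_cell ;; CFor 2 dim_exp reduction_round ;; CFor 7 dim_exp store_cell"

lemma init_constants_correct:
  "consts_ok (nval dim_exp env) (run init_constants env M)" "run init_constants env M (Direct l) = M (Direct l)"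
proof -
  show "consts_ok (nval dim_exp env) (run init_constants env M)"
    unfolding init_constants_def run.simps(2) double_correct by (simp add: consts_ok_def)
  show "run init_constants env M (Direct l) = M (Direct l)"
    by (rule run_frame) (simp add: init_constants_def double_def)
qed

lemma load_correct:
  "l < nval dim_exp env \<Longrightarrow> run (CFor 7 dim_exp load_cell) env M (Cell 2 l 0) = M (Direct l)"
  "l < nval dim_exp env \<Longrightarrow> run (CFor 7 dim_exp load_cell) env M (Cell 1 l 0) = 0"
proof -
  define P where "P s M' \<longleftrightarrow> (\<forall>l. M' (Direct l) = M (Direct l)) \<and> (\<forall>l<s. M' (Cell 2 l 0) = M (Direct l) \<and> M' (Cell 1 l 0) = 0)"
    for s M'
  have "P (nval dim_exp env) (iterate (\<lambda>s. run load_cell (env(7 := s))) (nval dim_exp env) M)"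
    by (rule iterate_invariant[where P = P]) (auto simp: P_def load_cell_def less_Suc_eq)
  then show "l < nval dim_exp env \<Longrightarrow> run (CFor 7 dim_exp load_cell) env M (Cell 2 l 0) = M (Direct l)"
    "l < nval dim_exp env \<Longrightarrow> run (CFor 7 dim_exp load_cell) env M (Cell 1 l 0) = 0"
    by (simp_all add: P_def)
qed

lemma store_correct:
  "l < nval dim_exp env \<Longrightarrow> run (CFor 7 dim_exp store_cell) env M (Direct l) = M (Cell 1 l 0)"
proof -
  define P where "P s M' \<longleftrightarrow> (\<forall>l. M' (Cell 1 l 0) = M (Cell 1 l 0)) \<and> (\<forall>l<s. M' (Direct l) = M (Cell 1 l 0))"
    for s M'
  have "P (nval dim_exp env) (iterate (\<lambda>s. run store_cell (env(7 := s))) (nval dim_exp env) M)"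
    by (rule iterate_invariant[where P = P]) (auto simp: P_def store_cell_def less_Suc_eq)
  then show "l < nval dim_exp env \<Longrightarrow> run (CFor 7 dim_exp store_cell) env M (Direct l) = M (Cell 1 l 0)"
    by (simp add: P_def)
qed

text \<open>After \<open>d\<close> rounds at most \<open>d - d\<close> coordinates of the remainder
  are nonzero. It is therefore 0, and the integer vector alone decides every sign.\<close>

lemma reduction_correct:
  fixes env M
  defines "d \<equiv> nval dim_exp env"
  defines "w \<equiv> \<lambda>l. M (Direct l)" and "W \<equiv> \<lambda>l. run reduction env M (Direct l)"
  shows "\<forall>l<d. W l \<in> \<int>" "\<forall>l<d. \<bar>W l\<bar> \<le> (2 ^ bits d * 2 ^ (d + 3)) ^ d"
    "\<forall>v. (\<Sum>l<d. \<bar>v l\<bar>) \<le> 2 ^ (d + 1) \<longrightarrow> sgn (dot d v w) = sgn (dot d v W)"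
proof -
  define M1 where "M1 = run init_constants env M"
  define M2 where "M2 = run (CFor 7 dim_exp load_cell) env M1"
  define M3 where "M3 = run (CFor 2 dim_exp reduction_round) env M2"
  have W: "W l = M3 (Cell 1 l 0)" if "l < d" for l
    using store_correct[of l env M3] that unfolding W_def reduction_def run.simps(2) M1_def M2_def M3_def d_def by simp
  have M2: "M2 (Cell 2 l 0) = w l" "M2 (Cell 1 l 0) = 0" if "l < d" for l
    using load_correct[of l env M1] that unfolding M2_def d_def w_def by (simp_all add: M1_def init_constants_correct)
  have "M2 (Cell 6 i 0) = M1 (Cell 6 i 0)" for i
    unfolding M2_def by (rule run_frame) (simp add: load_cell_def)
  then have cst: "consts_ok d M2"
    using init_constants_correct(1)[of env M] unfolding M1_def[symmetric] d_def[symmetric] consts_ok_def by simp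
  have dot_zero: "dot d v y = 0" if "\<And>l. l < d \<Longrightarrow> y l = 0" for v y using that by (simp add: dot_def)
  have "reduced_to d (2 ^ (d + 1)) w (\<lambda>l. M2 (Cell 1 l 0)) (\<lambda>l. M2 (Cell 2 l 0))"
    unfolding reduced_to_def
  proof (intro conjI allI impI)
    fix v
    have "dot d v (\<lambda>l. M2 (Cell 1 l 0)) = 0" by (rule dot_zero) (rule M2(2))
    moreover have "dot d v (\<lambda>l. M2 (Cell 2 l 0)) = dot d v w" by (rule dot_cong) (rule M2(1))
    ultimately show "sgn (dot d v w) = (if dot d v (\<lambda>l. M2 (Cell 1 l 0)) = 0 then sgn (dot d v (\<lambda>l. M2 (Cell 2 l 0)))
      else sgn (dot d v (\<lambda>l. M2 (Cell 1 l 0))))" by (simp only: simp_thms if_True)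
  qed (use M2(2) in simp)
  moreover have "card {l. l < d \<and> M2 (Cell 2 l 0) \<noteq> 0} \<le> d - 0"
    using card_mono[of "{..<d}" "{l. l < d \<and> M2 (Cell 2 l 0) \<noteq> 0}"] by auto
  ultimately have "rounds_inv d w 0 M2" using cst M2(2) by (simp add: rounds_inv_def)
  then have "rounds_inv d w d (iterate (\<lambda>i. run reduction_round (env(2 := i))) d M2)"
    by (rule iterate_invariant[where P = "rounds_inv d w"]) (rule reduction_round_correct, simp_all add: d_def)
  then have inv: "rounds_inv d w d M3" by (simp add: M3_def d_def)
  have "{l. l < d \<and> M3 (Cell 2 l 0) \<noteq> 0} = {}" using inv by (simp add: rounds_inv_def)
  then have x0: "M3 (Cell 2 l 0) = 0" if "l < d" for l using that by blast
  have red: "reduced_to d (2 ^ (d + 1)) w (\<lambda>l. M3 (Cell 1 l 0)) (\<lambda>l. M3 (Cell 2 l 0))"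
    and bd: "\<forall>l<d. \<bar>M3 (Cell 1 l 0)\<bar> \<le> (2 ^ bits d * 2 ^ (d + 3)) ^ d - 1"
    using inv unfolding rounds_inv_def by blast+
  show "\<forall>l<d. W l \<in> \<int>" using red W by (simp add: reduced_to_def)
  show "\<forall>l<d. \<bar>W l\<bar> \<le> (2 ^ bits d * 2 ^ (d + 3)) ^ d" using bd W by fastforce
  show "\<forall>v. (\<Sum>l<d. \<bar>v l\<bar>) \<le> 2 ^ (d + 1) \<longrightarrow> sgn (dot d v w) = sgn (dot d v W)"
  proof (intro allI impI)
    fix v :: "nat \<Rightarrow> int" assume v: "(\<Sum>l<d. \<bar>v l\<bar>) \<le> 2 ^ (d + 1)"
    have "dot d v (\<lambda>l. M3 (Cell 2 l 0)) = 0" by (rule dot_zero) (rule x0)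
    moreover have "dot d v W = dot d v (\<lambda>l. M3 (Cell 1 l 0))" by (rule dot_cong) (rule W)
    ultimately show "sgn (dot d v w) = sgn (dot d v W)" using red v unfolding reduced_to_def by auto
  qed
qed

section \<open>From the program to the second bound\<close>

lemma nvars_dim_exp [simp]: "nvars dim_exp = {0, 1}" "nvars bits_exp = {0, 1}"
  by (auto simp: dim_exp_def bits_exp_def)

text \<open>Everything is checked by unfolding. The only condition on values concerns the direct
  addresses of the loading and storing loops, whose variable stays below
  \<open>dim_exp\<close>.\<close>

lemma ok_reduction: "ok {0, 1} env reduction"
proof -
  have c: "ok_loc S env' (LCell a e e') \<longleftrightarrow> nvars e \<union> nvars e' \<subseteq> S \<and> a < 15" for S env' a e e'
    by (simp add: ok_loc_def)
  have direct: "ok_loc S env' (LDirect e) \<longleftrightarrow> nvars e \<subseteq> S \<and> nval e env' < nval dim_exp env'" for S env' e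
    by (simp add: ok_loc_def)
  show ?thesis
    by (simp add: c direct reduction_def init_constants_def double_def load_cell_def store_cell_def reduction_round_def
        max_modulus_def max_step_def scale_cell_def init_basis_def unit_row_def clear_cell_def last_row_cell_def
        reduce_basis_def sweeps_exp_def sweep_def sweep_step_def reduce_rows_def reduce_row_def round_to_def
        round_step_def row_operation_def Let_def swap_basis_def swap_columns_def swap_column_step_def swap_lines_def
        swap_cells_def fix_sign_def negate_cell_def accumulate_cell_def)
qed

text \<open>Output is inspected at the integer points only, so any functions \<open>gs\<close>
  through the computed values count as computed. The choice of the convex interpolants can thus be
  made later.\<close>

lemma computes_table:
  assumes time: "\<forall>n N. time reduction ((\<lambda>_. 0)(0 := n, 1 := N)) \<le> T n N"
  obtains W :: "nat \<Rightarrow> real" where "\<forall>l<n * (2 * N + 1). W l \<in> \<int>"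
    "\<forall>l<n * (2 * N + 1). \<bar>W l\<bar> \<le> (2 ^ bits (n * (2 * N + 1)) * 2 ^ (n * (2 * N + 1) + 3)) ^ (n * (2 * N + 1))"
    "\<forall>v. (\<Sum>l<n * (2 * N + 1). \<bar>v l\<bar>) \<le> 2 ^ (n * (2 * N + 1) + 1) \<longrightarrow>
       sgn (dot (n * (2 * N + 1)) v (\<lambda>l. table N fs (l div (2 * N + 1)) (l mod (2 * N + 1)))) = sgn (dot (n * (2 * N + 1)) v W)"
    "\<And>gs. (\<And>i m. i < n \<Longrightarrow> m < 2 * N + 1 \<Longrightarrow> gs i (real m - real N) = W (i * (2 * N + 1) + m)) \<Longrightarrow>
       computes_within (compile reduction) (T n N) n N fs gs"
proof -
  define L where "L = 2 * N + 1"
  define d where "d = n * L"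
  define env :: "nat \<Rightarrow> nat" where "env = (\<lambda>_. 0)(0 := n, 1 := N)"
  define s where "s = input_state n N fs"
  \<comment> \<open>The abstract memory is read off the initial machine state through
    \<open>encode\<close>, so that \<open>represents\<close> holds by construction and the direct
    cells are the input table.\<close>
  define M where "M x = snd s (encode d x)" for x
  have dim: "nval dim_exp env = d" by (simp add: dim_exp_def env_def d_def L_def)
  have rep: "represents {0, 1} env M s"
    unfolding represents_def dim by (auto simp: M_def s_def input_state_def env_def)
  define W where "W l = run reduction env M (Direct l)" for l
  note red = reduction_correct[of env M, folded W_def, unfolded dim]
  have Md: "M (Direct l) = table N fs (l div L) (l mod L)" if "l < d" for l
    using that by (simp add: M_def s_def input_state_def d_def L_def table_def)
  have dotM: "dot d v (\<lambda>l. M (Direct l)) = dot d v (\<lambda>l. table N fs (l div L) (l mod L))" for v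
    by (rule dot_cong) (rule Md)
  have "runs (compile reduction) s (time reduction env) (represents {0, 1} env (run reduction env M))"
    by (rule compile_correct[OF rep ok_reduction])
  then obtain t s' where s': "exec (compile reduction) s t s'" "t \<le> time reduction env"
    "represents {0, 1} env (run reduction env M) s'" unfolding runs_def by blast
  have out: "snd s' l = W l" if "l < d" for l
    using s'(3) that unfolding represents_def dim W_def by (auto dest: spec[of _ "Direct l"])
  have index: "i * L + m < d" if "i < n" "m < L" for i m unfolding d_def using that by (rule block_index_less)
  show ?thesis
  proof (rule that[of W], fold L_def, fold d_def)
    show "\<forall>l<d. W l \<in> \<int>" by (rule red(1))
    show "\<forall>l<d. \<bar>W l\<bar> \<le> (2 ^ bits d * 2 ^ (d + 3)) ^ d" by (rule red(2))
    show "\<forall>v. (\<Sum>l<d. \<bar>v l\<bar>) \<le> 2 ^ (d + 1) \<longrightarrow>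
       sgn (dot d v (\<lambda>l. table N fs (l div L) (l mod L))) = sgn (dot d v W)"
      using red(3) unfolding dotM .
    fix gs assume gs: "\<And>i m. i < n \<Longrightarrow> m < L \<Longrightarrow> gs i (real m - real N) = W (i * L + m)"
    have "t \<le> T n N" using s'(2) time[rule_format, of n N] unfolding env_def by linarith
    moreover have "output_is n N gs s'"
      unfolding output_is_def L_def[symmetric] using gs out index by simp
    ultimately show "computes_within (compile reduction) (T n N) n N fs gs"
      unfolding computes_within_def using s'(1) unfolding s_def by blast
  qed
qed

text \<open>The exponent, including \<open>d + 1\<close> bits for the factor \<open>2 * n\<close>,
  is at most \<open>14 * d^3\<close>. With \<open>d \<le> 3 * n * N\<close> this is at most
  \<open>14 * 27 = 378\<close> times \<open>(n * N)^3\<close>, rounded up to 400.\<close>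

lemma table_bound:
  assumes "1 \<le> n" "1 \<le> N" and d: "d = n * (2 * N + 1)"
  shows "2 * real n * (2 ^ bits d * 2 ^ (d + 3)) ^ d \<le> 2 ^ (400 * (n * N) ^ 3)"
proof -
  let ?y = "n * N"
  have d1: "1 \<le> d" using assms by simp
  have "n \<le> d" unfolding d by simp
  have "d \<le> 3 * ?y"
  proof -
    have "n * (2 * N + 1) \<le> n * (3 * N)" using assms by (intro mult_left_mono) auto
    then show ?thesis unfolding d by (simp add: algebra_simps)
  qed
  then have "d ^ 3 \<le> (3 * ?y) ^ 3" by (rule power_mono) simp
  then have d3: "d ^ 3 \<le> 27 * ?y ^ 3" by (simp add: power_mult_distrib)
  have dd: "d \<le> d * d" "d * d \<le> d * d * d" using d1 by auto
  have "bits d + (d + 3) \<le> 2 * (d * d) + 4 * d + 2 + d + 3" by (simp add: bits_def algebra_simps)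
  also have "\<dots> \<le> 12 * (d * d)" using d1 dd by linarith
  finally have "(bits d + (d + 3)) * d \<le> 12 * (d * d) * d" by (rule mult_right_mono) simp
  then have "(bits d + (d + 3)) * d + (d + 1) \<le> 14 * d ^ 3" using dd d1 by (simp only: power3_eq_cube mult.assoc)
  also have "\<dots> \<le> 400 * ?y ^ 3" using d3 by simp
  finally have e: "(bits d + (d + 3)) * d + (d + 1) \<le> 400 * ?y ^ 3" .
  have "real n \<le> 2 ^ d" using \<open>n \<le> d\<close> of_nat_less_two_power[of d, where 'a = real] by (smt (verit) of_nat_mono)
  then have "2 * real n * (2 ^ bits d * 2 ^ (d + 3)) ^ d \<le> 2 ^ (d + 1) * (2 ^ bits d * 2 ^ (d + 3)) ^ d"
    by (intro mult_right_mono) auto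
  also have "\<dots> = 2 ^ ((d + 1) + (bits d + (d + 3)) * d)"
    by (simp only: power_add[symmetric] power_mult[symmetric])
  also have "\<dots> \<le> 2 ^ (400 * ?y ^ 3)" using e by (intro power_increasing) linarith+
  finally show ?thesis .
qed

text \<open>Two kinds of short vectors carry the proof: differences of the indicator vectors of two
  points, of 1-norm at most \<open>2 * n\<close>, and \<open>(1, -2, 1)\<close> within a block, of
  1-norm 4. Both norms are at most \<open>2 ^ (d + 1)\<close>, so the reduction keeps order and
  convexity at once.\<close>

lemma computable_equivalent:
  assumes time: "\<forall>n N. time reduction ((\<lambda>_. 0)(0 := n, 1 := N)) \<le> T n N"
    and f: "separable_convex_by n fs f"
  shows "\<exists>g gs. separable_convex_by n gs g \<and> equivalent_on (int_box n N) f g \<and> (\<forall>x\<in>int_box n N. g x \<in> \<int>) \<and>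
    computes_within (compile reduction) (T n N) n N fs gs \<and> max_diff g (int_box n N) \<le> 2 ^ (400 * (n * N) ^ 3)"
proof -
  define L where "L = 2 * N + 1"
  define d where "d = n * L"
  define w where "w l = table N fs (l div L) (l mod L)" for l
  obtain W :: "nat \<Rightarrow> real" where W: "\<forall>l<d. W l \<in> \<int>" "\<forall>l<d. \<bar>W l\<bar> \<le> (2 ^ bits d * 2 ^ (d + 3)) ^ d"
    "\<forall>v. (\<Sum>l<d. \<bar>v l\<bar>) \<le> 2 ^ (d + 1) \<longrightarrow> sgn (dot d v w) = sgn (dot d v W)"
    "\<And>gs. (\<And>i m. i < n \<Longrightarrow> m < L \<Longrightarrow> gs i (real m - real N) = W (i * L + m)) \<Longrightarrow>
       computes_within (compile reduction) (T n N) n N fs gs"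
    using computes_table[OF time, of n N fs] unfolding L_def[symmetric] d_def[symmetric] w_def[symmetric, abs_def] by blast
  define B :: real where "B = (2 ^ bits d * 2 ^ (d + 3)) ^ d"
  define G where "G i m = W (i * L + m)" for i m
  have index: "i * L + m < d" if "i < n" "m < L" for i m unfolding d_def using that by (rule block_index_less)
  have div_mod: "(i * L + m) div L = i" "(i * L + m) mod L = m" if "m < L" for i m using that by simp_all
  have wt: "w (i * L + m) = table N fs i m" if "m < L" for i m using div_mod[OF that] by (simp add: w_def)
  have n_d: "n \<le> d" by (simp add: d_def L_def)
  have n2: "2 * int n \<le> 2 ^ (d + 1)"
  proof -
    have "int n \<le> int d" using n_d by simp
    also have "\<dots> \<le> 2 ^ d" using of_nat_less_two_power[of d, where 'a = int] by simp
    finally show ?thesis by simp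
  qed
  \<comment> \<open>The indicator of the \<open>n\<close> table entries selected by
    \<open>p\<close>, one in each block of length \<open>L\<close>.\<close>
  define mark where "mark p k = (if k mod L = p (k div L) then 1 else 0 :: int)" for p :: "nat \<Rightarrow> nat" and k
  have block: "(\<Sum>k<d. of_int (mark p k) * y k) = (\<Sum>i<n. y (i * L + p i))"
    if "\<forall>i<n. p i < L" for p and y :: "nat \<Rightarrow> real"
  proof -
    have "(\<Sum>k<d. of_int (mark p k) * y k) = (\<Sum>i<n. \<Sum>m<L. of_int (mark p (i * L + m)) * y (i * L + m))"
      unfolding d_def by (rule sum_blocks)
    also have "\<dots> = (\<Sum>i<n. y (i * L + p i))"
    proof (rule sum.cong)
      fix i assume i: "i \<in> {..<n}"
      have "(\<Sum>m<L. of_int (mark p (i * L + m)) * y (i * L + m)) = (\<Sum>m<L. if m = p i then y (i * L + m) else 0)"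
        by (rule sum.cong) (auto simp: mark_def)
      also have "\<dots> = y (i * L + p i)" using that i by simp
      finally show "(\<Sum>m<L. of_int (mark p (i * L + m)) * y (i * L + m)) = y (i * L + p i)" .
    qed simp
    finally show ?thesis .
  qed
  have below_L: "\<forall>i<n. p i < L" if "\<And>i. i < n \<Longrightarrow> p i \<le> 2 * N" for p
    using that by (auto simp: L_def less_Suc_eq_le)
  have dot_diff: "dot d (\<lambda>k. mark p k - mark q k) y = (\<Sum>i<n. y (i * L + p i)) - (\<Sum>i<n. y (i * L + q i))"
    if "\<forall>i<n. p i < L" "\<forall>i<n. q i < L" for p q y
    unfolding dot_def block[OF that(1), symmetric] block[OF that(2), symmetric] sum_subtractf[symmetric]
    by (rule sum.cong) (simp_all add: left_diff_distrib)
  have norm: "(\<Sum>k<d. \<bar>mark p k - mark q k\<bar>) \<le> 2 ^ (d + 1)" if "\<forall>i<n. p i < L" "\<forall>i<n. q i < L" for p q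
  proof -
    have one: "(\<Sum>k<d. mark p k) = int n" if "\<forall>i<n. p i < L" for p
    proof -
      have "of_int (\<Sum>k<d. mark p k) = (real n)" using block[OF that, of "\<lambda>_. 1"] by simp
      then show ?thesis by linarith
    qed
    have "(\<Sum>k<d. \<bar>mark p k - mark q k\<bar>) \<le> (\<Sum>k<d. mark p k + mark q k)"
      by (rule sum_mono) (simp add: mark_def)
    also have "\<dots> = 2 * int n" using one[OF that(1)] one[OF that(2)] by (simp add: sum.distrib)
    finally show ?thesis using n2 by linarith
  qed
  have int: "G i m \<in> \<int>" if "i < n" "m \<le> 2 * N" for i m
    using W(1) index[of i m] that by (simp add: G_def L_def)
  have order: "sgn ((\<Sum>i<n. G i (p i)) - (\<Sum>i<n. G i (q i))) =
      sgn ((\<Sum>i<n. table N fs i (p i)) - (\<Sum>i<n. table N fs i (q i)))"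
    if pq: "\<And>i. i < n \<Longrightarrow> p i \<le> 2 * N" "\<And>i. i < n \<Longrightarrow> q i \<le> 2 * N" for p q
  proof -
    have p: "\<forall>i<n. p i < L" using pq(1) by (rule below_L)
    have q: "\<forall>i<n. q i < L" using pq(2) by (rule below_L)
    have "(\<Sum>i<n. w (i * L + r i)) = (\<Sum>i<n. table N fs i (r i))" if "\<forall>i<n. r i < L" for r
      using that by (intro sum.cong) (simp_all add: wt)
    then show ?thesis
      using W(3)[rule_format, OF norm[OF p q]] p q unfolding dot_diff[OF p q] G_def by simp
  qed
  have convex: "0 \<le> G i (j + 2) - 2 * G i (j + 1) + G i j" if i: "i < n" and j: "j + 2 \<le> 2 * N" for i j
  proof -
    define k where "k = i * L + j"
    have jL: "j < L" "j + 1 < L" "j + 2 < L" using j by (simp_all add: L_def)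
    have k: "k < d" "k + 1 < d" "k + 2 < d"
      using index[OF i jL(1)] index[OF i jL(2)] index[OF i jL(3)] by (simp_all add: k_def)
    define v where "v l = (if l = k then 1 else if l = k + 1 then -2 else if l = k + 2 then 1 else 0 :: int)" for l
    have subset: "{k, k + 1, k + 2} \<subseteq> {..<d}" using k by auto
    have dot: "dot d v y = y (k + 2) - 2 * y (k + 1) + y k" for y
    proof -
      have "dot d v y = (\<Sum>l\<in>{k, k + 1, k + 2}. of_int (v l) * y l)"
        unfolding dot_def by (rule sum.mono_neutral_right) (use subset in \<open>auto simp: v_def\<close>)
      then show ?thesis by (simp add: v_def)
    qed
    have "(\<Sum>l<d. \<bar>v l\<bar>) = (\<Sum>l\<in>{k, k + 1, k + 2}. \<bar>v l\<bar>)"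
      by (rule sum.mono_neutral_right) (use subset in \<open>auto simp: v_def\<close>)
    then have "(\<Sum>l<d. \<bar>v l\<bar>) = 4" by (simp add: v_def)
    moreover have "(2 :: int) ^ (1 + 1) \<le> 2 ^ (d + 1)" using k by (intro power_increasing) auto
    ultimately have "sgn (dot d v w) = sgn (dot d v W)" using W(3) by simp
    moreover have "0 \<le> dot d v w"
    proof -
      have "w (k + 2) = table N fs i (j + 2)" "w (k + 1) = table N fs i (j + 1)" "w k = table N fs i j"
        using wt[OF jL(1), of i] wt[OF jL(2), of i] wt[OF jL(3), of i] by (simp_all add: k_def add.assoc)
      then show ?thesis
        unfolding dot using table_second_difference[of fs i N j] f i by (simp add: separable_convex_by_def)
    qed
    ultimately have "0 \<le> dot d v W" by (metis sgn_less linorder_not_less)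
    then show ?thesis unfolding dot by (simp add: G_def k_def add.assoc)
  qed
  have bound: "\<bar>(\<Sum>i<n. G i (p i)) - (\<Sum>i<n. G i (q i))\<bar> \<le> 2 ^ (400 * (n * N) ^ 3)"
    if pq: "\<And>i. i < n \<Longrightarrow> p i \<le> 2 * N" "\<And>i. i < n \<Longrightarrow> q i \<le> 2 * N" for p q
  proof (cases "n = 0 \<or> N = 0")
    \<comment> \<open>The claimed bound degenerates to 1, but the box has a single point and all
      differences vanish.\<close>
    case True
    have "(\<Sum>i<n. G i (p i)) = (\<Sum>i<n. G i (q i))"
    proof (rule sum.cong)
      fix i assume "i \<in> {..<n}"
      then have "p i = 0" "q i = 0" using True pq[of i] by auto
      then show "G i (p i) = G i (q i)" by simp
    qed simp
    then show ?thesis by simp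
  next
    case False
    have sum_le: "\<bar>\<Sum>i<n. G i (r i)\<bar> \<le> real n * B" if "\<And>i. i < n \<Longrightarrow> r i \<le> 2 * N" for r
    proof -
      have "\<bar>\<Sum>i<n. G i (r i)\<bar> \<le> (\<Sum>i<n. \<bar>G i (r i)\<bar>)" by (rule sum_abs)
      also have "\<dots> \<le> (\<Sum>i<n. B)"
      proof (rule sum_mono)
        fix i assume i: "i \<in> {..<n}"
        then have "i * L + r i < d" using that[of i] by (intro index) (auto simp: L_def)
        then show "\<bar>G i (r i)\<bar> \<le> B" using W(2) unfolding G_def B_def by blast
      qed
      finally show ?thesis by simp
    qed
    have "\<bar>\<Sum>i<n. G i (p i)\<bar> \<le> real n * B" using pq(1) by (rule sum_le)
    moreover have "\<bar>\<Sum>i<n. G i (q i)\<bar> \<le> real n * B" using pq(2) by (rule sum_le)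
    moreover have "2 * real n * B \<le> 2 ^ (400 * (n * N) ^ 3)"
      unfolding B_def using False by (intro table_bound) (auto simp: d_def L_def)
    ultimately show ?thesis by linarith
  qed
  have "reduces_table n N (table N fs) G (2 ^ (400 * (n * N) ^ 3))"
    unfolding reduces_table_def using int order convex bound by simp
  note eq = equivalent_from_table(1-4)[OF f this]
  have "computes_within (compile reduction) (T n N) n N fs (\<lambda>i. interpolate N (G i))"
  proof (rule W(4))
    fix i m assume "m < L"
    then have "m \<le> 2 * N" by (simp add: L_def)
    then show "interpolate N (G i) (real m - real N) = W (i * L + m)" by (simp add: interpolate_at G_def)
  qed
  with eq show ?thesis by blast
qed

theorem corollary72:
  "\<exists>(P :: program) (k :: nat) (c\<^sub>1 :: nat) (c\<^sub>2 :: nat).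
     \<forall>(n :: nat) (f :: (nat \<Rightarrow> real) \<Rightarrow> real) (fs :: nat \<Rightarrow> real \<Rightarrow> real).
       separable_convex_by n fs f \<longrightarrow>
       (\<forall>N :: nat. \<exists>g\<^sub>1 g\<^sub>2 gs\<^sub>2.
          separable_convex n g\<^sub>1 \<and>
          equivalent_on (int_box n N) f g\<^sub>1 \<and>
          (\<forall>x\<in>int_box n N. g\<^sub>1 x \<in> \<int>) \<and>
          ((n, N) \<noteq> (1, 1) \<longrightarrow>
             max_diff g\<^sub>1 (int_box n N) \<le> real ((n\<^sup>2 * N) ^ (n * (2 * N + 1) + 1))) \<and>
          separable_convex_by n gs\<^sub>2 g\<^sub>2 \<and>
          equivalent_on (int_box n N) f g\<^sub>2 \<and>
          (\<forall>x\<in>int_box n N. g\<^sub>2 x \<in> \<int>) \<and>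
          computes_within P (k * (n + N) ^ k + k) n N fs gs\<^sub>2 \<and>
          max_diff g\<^sub>2 (int_box n N) \<le>
            real (2 ^ (c\<^sub>1 * (n * N) ^ 3) * (n * N) ^ (c\<^sub>2 * (n * N)\<^sup>2)))"
proof -
  obtain k where k: "\<forall>n N. time reduction ((\<lambda>_. 0)(0 := n, 1 := N)) \<le> k * (n + N) ^ k + k"
    using poly_time[of reduction] by blast
  show ?thesis
  \<comment> \<open>The 400 comes from \<open>table_bound\<close>. With exponent 0 the second factor
    is 1, also for \<open>n * N = 0\<close>, so the required bound is literally the one proved for
    the computed table.\<close>
  proof (rule exI[of _ "compile reduction"], rule exI[of _ k], rule exI[of _ 400], rule exI[of _ 0],
      intro allI impI, goal_cases)
    case (1 n f fs N)
    have "real (2 ^ (400 * (n * N) ^ 3) * (n * N) ^ (0 * (n * N)\<^sup>2)) = 2 ^ (400 * (n * N) ^ 3)" by simp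
    then show ?case
      using exists_small_equivalent[OF 1, of N] computable_equivalent[OF k 1, of N] by metis
  qed
qed

end
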